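(* Let $\mathcal{C}$ be a triangulated category together with a given stability condition $\tau=(\mathcal{P},Z)$ and its collection of thin triangles $\Delta_\tau$. Assume that the moduli of the central charges (i.e. the masses) of the stable objects are independent over $\mathbb{Z}$. Then the extriangulated Grothendieck group associated to the stability condition $\tau$, denoted $K_0^\tau(\mathcal{C})$, is freely generated over $\mathbb{Z}[s^{\pm1}]$ by the isomorphism classes of the stable objects that are in the heart $\mathcal{P}([0,1))$ of the preferred $t$-structure associated to $\tau$. The variable $s$ accounts for the triangulated shift: $s[X]=[X[1]]$.
   Context: **Stability condition.** A stability condition $\tau=(\mathcal{P},Z)$ on a triangulated category $\mathcal{C}$ consists of a slicing $\mathcal{P}$, i.e. a full additive subcategory $\mathcal{P}(\phi)\subset\mathcal{C}$ for each $\phi\in\mathbb{R}$, and a group homomorphism $Z:K_0(\mathcal{C})\to\mathbb{C}$ (the central charge), such that: (1) $\mathcal{P}(\phi+1)=\mathcal{P}(\phi)[1]$; (2) if $A\in\mathcal{P}(\phi)$, $B\in\mathcal{P}(\psi)$ and $\phi>\psi$, then $\mathrm{Hom}(A,B)=0$; (3) every non-zero $X\in\mathcal{C}$ has a Harder–Narasimhan (HN) filtration, i.e. a sequence $0=X_0\to X_1\to\cdots\to X_n=X$ with exact triangles $X_{i-1}\to X_i\to Y_i\to X_{i-1}[1]$, where $Y_i\in\mathcal{P}(\phi_i)$ and $\phi_1>\cdots>\phi_n$; (4) $Z(\mathcal{P}(\phi)\setminus\{0\})\subset\mathbb{R}_{>0}\,e^{i\pi\phi}$. Objects of the subcategories $\mathcal{P}(\phi)$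 are called semi-stable (of phase $\phi$). Each $\mathcal{P}(\phi)$ is an abelian category, and the semi-stable objects that are simple in it are called stable. The slices $\mathcal{P}([0,1))$ form the heart of a preferred $t$-structure associated to the slicing; the stable objects in the heart are those with phase in $[0,1)$. **Mass and thin triangles.** The mass of $X$ is $m_\tau(X)=\sum_i|Z(Y_i)|$, the sum being over the HN factors $Y_i$ of $X$, with $m_\tau(0)=0$; for a stable object $S$ it is $|Z(S)|$. $\Delta_\tau$ is the set of exact triangles $A\to B\to C\to A[1]$ in $\mathcal{C}$ with $m_\tau(B)=m_\tau(A)+m_\tau(C)$ (thin triangles). **Extriangulated Grothendieck group.** $K_0^\tau(\mathcal{C})$ is the quotient of the free abelian group generated by the isomorphism classes $[X]$ of objects $X\in\mathcal{C}$ by the relations $[A]-[B]+[C]=0$ for all triangles $A\to B\to C\to A[1]$ in $\Delta_\tau$. Multiplication by $s$ is the action induced by the triangulated shift endofunctor.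
   Formalization: Adds the assumption that every semi-stable object has a finite Jordan–Hölder filtration by stable objects of the same phase (else false); independence of masses is required of pairwise non-isomorphic stable objects of the heart. *)

theory Defs
  imports Complex_Main "HOL-Algebra.Module" "HOL-Algebra.Free_Abelian_Groups"
begin

section \<open>Categories\<close>

text \<open>Arrows carry their source and target, so hom-sets are automatically disjoint.
  \<open>cmp C g f\<close> is ``g after f''; it is only constrained on composable arrows.\<close>

record ('o, 'm) cat =
  obj :: "'o set"
  arr :: "'m set"
  src :: "'m \<Rightarrow> 'o"
  tgt :: "'m \<Rightarrow> 'o"
  ident :: "'o \<Rightarrow> 'm"
  cmp :: "'m \<Rightarrow> 'm \<Rightarrow> 'm"  (infixl \<open>\<cdot>\<index>\<close> 75)

definition Mor :: "('o, 'm, 'x) cat_scheme \<Rightarrow> 'o \<Rightarrow> 'o \<Rightarrow> 'm set" where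
  "Mor C A B = {f \<in> arr C. src C f = A \<and> tgt C f = B}"

locale category =
  fixes C :: "('o, 'm, 'x) cat_scheme" (structure)
  assumes src_obj: "f \<in> arr C \<Longrightarrow> src C f \<in> obj C"
    and tgt_obj: "f \<in> arr C \<Longrightarrow> tgt C f \<in> obj C"
    and ident_Mor: "A \<in> obj C \<Longrightarrow> ident C A \<in> Mor C A A"
    and cmp_Mor: "\<lbrakk>f \<in> Mor C A B; g \<in> Mor C B D\<rbrakk> \<Longrightarrow> g \<cdot> f \<in> Mor C A D"
    and cmp_assoc: "\<lbrakk>f \<in> Mor C A B; g \<in> Mor C B D; h \<in> Mor C D E\<rbrakk> \<Longrightarrow> (h \<cdot> g) \<cdot> f = h \<cdot> (g \<cdot> f)"
    and cmp_ident_right: "f \<in> Mor C A B \<Longrightarrow> f \<cdot> ident C A = f"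
    and cmp_ident_left: "f \<in> Mor C A B \<Longrightarrow> ident C B \<cdot> f = f"

definition is_iso :: "('o, 'm, 'x) cat_scheme \<Rightarrow> 'o \<Rightarrow> 'o \<Rightarrow> 'm \<Rightarrow> bool" where
  "is_iso C A B f \<longleftrightarrow> f \<in> Mor C A B \<and>
     (\<exists>g \<in> Mor C B A. g \<cdot>\<^bsub>C\<^esub> f = ident C A \<and> f \<cdot>\<^bsub>C\<^esub> g = ident C B)"

definition isomorphic :: "('o, 'm, 'x) cat_scheme \<Rightarrow> 'o \<Rightarrow> 'o \<Rightarrow> bool" where
  "isomorphic C A B \<longleftrightarrow> (\<exists>f. is_iso C A B f)"

definition iso_class :: "('o, 'm, 'x) cat_scheme \<Rightarrow> 'o \<Rightarrow> 'o set" where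
  "iso_class C A = {B \<in> obj C. isomorphic C A B}"

definition is_zero_object :: "('o, 'm, 'x) cat_scheme \<Rightarrow> 'o \<Rightarrow> bool" where
  "is_zero_object C N \<longleftrightarrow> N \<in> obj C \<and>
     (\<forall>A \<in> obj C. (\<exists>!f. f \<in> Mor C A N) \<and> (\<exists>!f. f \<in> Mor C N A))"


section \<open>Additive categories\<close>

record ('o, 'm) additive_cat = "('o, 'm) cat" +
  hadd :: "'m \<Rightarrow> 'm \<Rightarrow> 'm"
  hzero :: "'o \<Rightarrow> 'o \<Rightarrow> 'm"

definition Mor_group :: "('o, 'm, 'x) additive_cat_scheme \<Rightarrow> 'o \<Rightarrow> 'o \<Rightarrow> 'm monoid" where
  "Mor_group C A B = \<lparr>carrier = Mor C A B, monoid.mult = hadd C, one = hzero C A B\<rparr>"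

definition hminus :: "('o, 'm, 'x) additive_cat_scheme \<Rightarrow> 'm \<Rightarrow> 'm" where
  "hminus C f = m_inv (Mor_group C (src C f) (tgt C f)) f"

definition is_biproduct :: "('o, 'm, 'x) additive_cat_scheme \<Rightarrow> 'o \<Rightarrow> 'o \<Rightarrow> 'o \<Rightarrow> bool" where
  "is_biproduct C A B S \<longleftrightarrow> S \<in> obj C \<and>
     (\<exists>i \<in> Mor C A S. \<exists>j \<in> Mor C B S. \<exists>p \<in> Mor C S A. \<exists>q \<in> Mor C S B.
        p \<cdot>\<^bsub>C\<^esub> i = ident C A \<and> q \<cdot>\<^bsub>C\<^esub> j = ident C B \<and>
        q \<cdot>\<^bsub>C\<^esub> i = hzero C A B \<and> p \<cdot>\<^bsub>C\<^esub> j = hzero C B A \<and>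
        hadd C (i \<cdot>\<^bsub>C\<^esub> p) (j \<cdot>\<^bsub>C\<^esub> q) = ident C S)"

locale additive_category = category C
  for C :: "('o, 'm, 'x) additive_cat_scheme" (structure) +
  assumes Mor_comm_group: "\<lbrakk>A \<in> obj C; B \<in> obj C\<rbrakk> \<Longrightarrow> comm_group (Mor_group C A B)"
    and cmp_hadd_right:
      "\<lbrakk>f \<in> Mor C A B; f' \<in> Mor C A B; g \<in> Mor C B D\<rbrakk> \<Longrightarrow> g \<cdot> hadd C f f' = hadd C (g \<cdot> f) (g \<cdot> f')"
    and cmp_hadd_left:
      "\<lbrakk>f \<in> Mor C A B; g \<in> Mor C B D; g' \<in> Mor C B D\<rbrakk> \<Longrightarrow> hadd C g g' \<cdot> f = hadd C (g \<cdot> f) (g' \<cdot> f)"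
    and ex_zero_object: "\<exists>N. is_zero_object C N"
    and ex_biproduct: "\<lbrakk>A \<in> obj C; B \<in> obj C\<rbrakk> \<Longrightarrow> \<exists>S. is_biproduct C A B S"

text \<open>A full subcategory is given by its set of objects; it is taken to be closed under
  isomorphism.\<close>

definition full_additive_subcategory :: "('o, 'm, 'x) additive_cat_scheme \<Rightarrow> 'o set \<Rightarrow> bool" where
  "full_additive_subcategory C D \<longleftrightarrow> D \<subseteq> obj C \<and>
     (\<exists>N \<in> D. is_zero_object C N) \<and>
     (\<forall>A \<in> D. \<forall>B \<in> obj C. isomorphic C A B \<longrightarrow> B \<in> D) \<and>
     (\<forall>A \<in> D. \<forall>B \<in> D. \<forall>S. is_biproduct C A B S \<longrightarrow> S \<in> D)"

definition mono_in :: "('o, 'm, 'x) cat_scheme \<Rightarrow> 'o set \<Rightarrow> 'o \<Rightarrow> 'o \<Rightarrow> 'm \<Rightarrow> bool" where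
  "mono_in C D A B f \<longleftrightarrow> f \<in> Mor C A B \<and>
     (\<forall>W \<in> D. \<forall>u \<in> Mor C W A. \<forall>v \<in> Mor C W A. f \<cdot>\<^bsub>C\<^esub> u = f \<cdot>\<^bsub>C\<^esub> v \<longrightarrow> u = v)"

definition simple_in :: "('o, 'm, 'x) cat_scheme \<Rightarrow> 'o set \<Rightarrow> 'o \<Rightarrow> bool" where
  "simple_in C D X \<longleftrightarrow> X \<in> D \<and> \<not> is_zero_object C X \<and>
     (\<forall>A \<in> D. \<forall>f. mono_in C D A X f \<longrightarrow> is_zero_object C A \<or> is_iso C A X f)"


section \<open>Triangulated categories\<close>

text \<open>A triangle \<open>A \<rightarrow> B \<rightarrow> D \<rightarrow> A[1]\<close> is stored as the triple of its arrows.\<close>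

record ('o, 'm) triang_cat = "('o, 'm) additive_cat" +
  shift_ob :: "'o \<Rightarrow> 'o"
  shift_arr :: "'m \<Rightarrow> 'm"
  triangles :: "('m \<times> 'm \<times> 'm) set"

definition triangle :: "('o, 'm, 'x) triang_cat_scheme \<Rightarrow> 'o \<Rightarrow> 'o \<Rightarrow> 'o \<Rightarrow> 'm \<Rightarrow> 'm \<Rightarrow> 'm \<Rightarrow> bool" where
  "triangle C A B D f g h \<longleftrightarrow> f \<in> Mor C A B \<and> g \<in> Mor C B D \<and> h \<in> Mor C D (shift_ob C A)"

definition exact_triangle ::
  "('o, 'm, 'x) triang_cat_scheme \<Rightarrow> 'o \<Rightarrow> 'o \<Rightarrow> 'o \<Rightarrow> 'm \<Rightarrow> 'm \<Rightarrow> 'm \<Rightarrow> bool" where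
  "exact_triangle C A B D f g h \<longleftrightarrow> triangle C A B D f g h \<and> (f, g, h) \<in> triangles C"

text \<open>The shift is an additive auto-equivalence (fully faithful and essentially surjective), not
  necessarily a strict automorphism. The axioms on triangles are Verdier's TR1--TR4.\<close>

locale triangulated_category = additive_category C
  for C :: "('o, 'm, 'x) triang_cat_scheme" (structure) +
  assumes shift_obj: "A \<in> obj C \<Longrightarrow> shift_ob C A \<in> obj C"
    and shift_ident: "A \<in> obj C \<Longrightarrow> shift_arr C (ident C A) = ident C (shift_ob C A)"
    and shift_cmp: "\<lbrakk>f \<in> Mor C A B; g \<in> Mor C B D\<rbrakk> \<Longrightarrow>
          shift_arr C (g \<cdot> f) = shift_arr C g \<cdot> shift_arr C f"
    and shift_hadd: "\<lbrakk>f \<in> Mor C A B; f' \<in> Mor C A B\<rbrakk> \<Longrightarrow>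
          shift_arr C (hadd C f f') = hadd C (shift_arr C f) (shift_arr C f')"
    and shift_fully_faithful: "\<lbrakk>A \<in> obj C; B \<in> obj C\<rbrakk> \<Longrightarrow>
          bij_betw (shift_arr C) (Mor C A B) (Mor C (shift_ob C A) (shift_ob C B))"
    and shift_ess_surj: "B \<in> obj C \<Longrightarrow> \<exists>A \<in> obj C. isomorphic C (shift_ob C A) B"
    and triangles_wf: "(f, g, h) \<in> triangles C \<Longrightarrow>
          triangle C (src C f) (tgt C f) (tgt C g) f g h"
    and TR1_ident: "\<lbrakk>A \<in> obj C; is_zero_object C N\<rbrakk> \<Longrightarrow>
          exact_triangle C A A N (ident C A) (hzero C A N) (hzero C N (shift_ob C A))"
    and TR1_iso: "\<lbrakk>exact_triangle C A B D f g h; triangle C A' B' D' f' g' h';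
          is_iso C A A' a; is_iso C B B' b; is_iso C D D' c;
          b \<cdot> f = f' \<cdot> a; c \<cdot> g = g' \<cdot> b; shift_arr C a \<cdot> h = h' \<cdot> c\<rbrakk> \<Longrightarrow>
          exact_triangle C A' B' D' f' g' h'"
    and TR1_cone: "f \<in> Mor C A B \<Longrightarrow> \<exists>D g h. exact_triangle C A B D f g h"
    and TR2: "triangle C A B D f g h \<Longrightarrow>
          exact_triangle C A B D f g h \<longleftrightarrow>
          exact_triangle C B D (shift_ob C A) g h (hminus C (shift_arr C f))"
    and TR3: "\<lbrakk>exact_triangle C A B D f g h; exact_triangle C A' B' D' f' g' h';
          a \<in> Mor C A A'; b \<in> Mor C B B'; b \<cdot> f = f' \<cdot> a\<rbrakk> \<Longrightarrow>
          \<exists>c \<in> Mor C D D'. c \<cdot> g = g' \<cdot> b \<and> shift_arr C a \<cdot> h = h' \<cdot> c"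
    and TR4: "\<lbrakk>exact_triangle C X Y Q1 f p1 d1; exact_triangle C X W Q2 (g \<cdot> f) p2 d2;
          exact_triangle C Y W Q3 g p3 d3\<rbrakk> \<Longrightarrow>
          \<exists>a b. exact_triangle C Q1 Q2 Q3 a b (shift_arr C p1 \<cdot> d3) \<and>
            a \<cdot> p1 = p2 \<cdot> g \<and> d2 \<cdot> a = d1 \<and> b \<cdot> p2 = p3 \<and> d3 \<cdot> b = shift_arr C f \<cdot> d2"


section \<open>Grothendieck groups\<close>

text \<open>The Grothendieck group relative to a set \<open>T\<close> of exact triangles: \<open>K\<^sub>0(C)\<close> is the case
  where \<open>T\<close> consists of all exact triangles.\<close>

definition iso_free_group :: "('o, 'm, 'x) cat_scheme \<Rightarrow> ('o set \<Rightarrow>\<^sub>0 int) monoid" where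
  "iso_free_group C = free_Abelian_group (iso_class C ` obj C)"

definition triangle_relations ::
  "('o, 'm, 'x) triang_cat_scheme \<Rightarrow> ('m \<times> 'm \<times> 'm) set \<Rightarrow> ('o set \<Rightarrow>\<^sub>0 int) set" where
  "triangle_relations C T = generate (iso_free_group C)
     {frag_of (iso_class C A) - frag_of (iso_class C B) + frag_of (iso_class C D) | A B D.
        \<exists>f g h. exact_triangle C A B D f g h \<and> (f, g, h) \<in> T}"

definition groth_group ::
  "('o, 'm, 'x) triang_cat_scheme \<Rightarrow> ('m \<times> 'm \<times> 'm) set \<Rightarrow> ('o set \<Rightarrow>\<^sub>0 int) set monoid" where
  "groth_group C T = iso_free_group C Mod triangle_relations C T"

definition groth_proj ::
  "('o, 'm, 'x) triang_cat_scheme \<Rightarrow> ('m \<times> 'm \<times> 'm) set \<Rightarrow> ('o set \<Rightarrow>\<^sub>0 int) \<Rightarrow> ('o set \<Rightarrow>\<^sub>0 int) set" where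
  "groth_proj C T x = triangle_relations C T #>\<^bsub>iso_free_group C\<^esub> x"

definition groth_class ::
  "('o, 'm, 'x) triang_cat_scheme \<Rightarrow> ('m \<times> 'm \<times> 'm) set \<Rightarrow> 'o \<Rightarrow> ('o set \<Rightarrow>\<^sub>0 int) set" where
  "groth_class C T X = groth_proj C T (frag_of (iso_class C X))"

definition complex_group :: "complex monoid" where
  "complex_group = \<lparr>carrier = UNIV, monoid.mult = (+), one = 0\<rparr>"


section \<open>Stability conditions\<close>

text \<open>\<open>E\<close> is the chain \<open>0 = E\<^sub>0 \<rightarrow> \<dots> \<rightarrow> E\<^sub>n = X\<close>, and the factor of \<open>E\<^sub>i \<rightarrow> E\<^sub>i\<^sub>+\<^sub>1\<close> is \<open>Y\<^sub>i\<close>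
  (indices start at 0). Factors may be zero objects, which do not contribute to the mass.\<close>

definition HN_filtration ::
  "('o, 'm, 'x) triang_cat_scheme \<Rightarrow> (real \<Rightarrow> 'o set) \<Rightarrow> 'o \<Rightarrow>
    nat \<Rightarrow> (nat \<Rightarrow> 'o) \<Rightarrow> (nat \<Rightarrow> 'o) \<Rightarrow> (nat \<Rightarrow> real) \<Rightarrow> bool" where
  "HN_filtration C P X n E Y \<phi> \<longleftrightarrow> is_zero_object C (E 0) \<and> E n = X \<and>
     (\<forall>i<n. (\<exists>f g h. exact_triangle C (E i) (E (Suc i)) (Y i) f g h) \<and> Y i \<in> P (\<phi> i)) \<and>
     (\<forall>i j. i < j \<and> j < n \<longrightarrow> \<phi> i > \<phi> j)"

locale stability_condition = triangulated_category C
  for C :: "('o, 'm, 'x) triang_cat_scheme" (structure) +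
  fixes P :: "real \<Rightarrow> 'o set" and Z :: "('o set \<Rightarrow>\<^sub>0 int) set \<Rightarrow> complex"
  assumes slice_additive: "full_additive_subcategory C (P \<phi>)"
    and charge_hom: "Z \<in> hom (groth_group C (triangles C)) complex_group"
    and slice_shift: "X \<in> obj C \<Longrightarrow> shift_ob C X \<in> P (\<phi> + 1) \<longleftrightarrow> X \<in> P \<phi>"
    and slice_Mor: "\<lbrakk>A \<in> P \<phi>; B \<in> P \<psi>; \<phi> > \<psi>; f \<in> Mor C A B\<rbrakk> \<Longrightarrow> f = hzero C A B"
    and ex_HN: "\<lbrakk>X \<in> obj C; \<not> is_zero_object C X\<rbrakk> \<Longrightarrow> \<exists>n E Y \<phi>. HN_filtration C P X n E Y \<phi>"
    and charge_slice: "\<lbrakk>X \<in> P \<phi>; \<not> is_zero_object C X\<rbrakk> \<Longrightarrow>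
          \<exists>r>0. Z (groth_class C (triangles C) X) = complex_of_real r * cis (pi * \<phi>)"

definition charge ::
  "('o, 'm, 'x) triang_cat_scheme \<Rightarrow> (('o set \<Rightarrow>\<^sub>0 int) set \<Rightarrow> complex) \<Rightarrow> 'o \<Rightarrow> complex" where
  "charge C Z X = Z (groth_class C (triangles C) X)"

definition stable_of_phase ::
  "('o, 'm, 'x) triang_cat_scheme \<Rightarrow> (real \<Rightarrow> 'o set) \<Rightarrow> real \<Rightarrow> 'o \<Rightarrow> bool" where
  "stable_of_phase C P \<phi> X \<longleftrightarrow> simple_in C (P \<phi>) X"

text \<open>\<open>interval_slice C P I\<close> is \<open>P(I)\<close>: the objects all of whose HN phases lie in \<open>I\<close>.\<close>

definition interval_slice ::
  "('o, 'm, 'x) triang_cat_scheme \<Rightarrow> (real \<Rightarrow> 'o set) \<Rightarrow> real set \<Rightarrow> 'o set" where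
  "interval_slice C P I =
     {X \<in> obj C. \<exists>n E Y \<phi>. HN_filtration C P X n E Y \<phi> \<and> (\<forall>i<n. \<phi> i \<in> I)}"

definition heart_stables ::
  "('o, 'm, 'x) triang_cat_scheme \<Rightarrow> (real \<Rightarrow> 'o set) \<Rightarrow> 'o set" where
  "heart_stables C P = {X \<in> interval_slice C P {0..<1}. \<exists>\<phi>. stable_of_phase C P \<phi> X}"

text \<open>Every semistable object has finite length, i.e. a Jordan--Hoelder filtration: short exact
  sequences in the abelian category \<open>P \<phi>\<close> are the exact triangles with vertices in \<open>P \<phi>\<close>.\<close>

definition finite_length_slices ::
  "('o, 'm, 'x) triang_cat_scheme \<Rightarrow> (real \<Rightarrow> 'o set) \<Rightarrow> bool" where
  "finite_length_slices C P \<longleftrightarrow> (\<forall>\<phi>. \<forall>X \<in> P \<phi>. \<exists>n E S. is_zero_object C (E 0) \<and> E n = X \<and>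
     (\<forall>i\<le>n. E i \<in> P \<phi>) \<and>
     (\<forall>i<n. (\<exists>f g h. exact_triangle C (E i) (E (Suc i)) (S i) f g h) \<and>
        stable_of_phase C P \<phi> (S i)))"

definition mass ::
  "('o, 'm, 'x) triang_cat_scheme \<Rightarrow> (real \<Rightarrow> 'o set) \<Rightarrow>
    (('o set \<Rightarrow>\<^sub>0 int) set \<Rightarrow> complex) \<Rightarrow> 'o \<Rightarrow> real" where
  "mass C P Z X = (if is_zero_object C X then 0 else
     (THE m. \<exists>n E Y \<phi>. HN_filtration C P X n E Y \<phi> \<and> m = (\<Sum>i<n. cmod (charge C Z (Y i)))))"

definition thin_triangles ::
  "('o, 'm, 'x) triang_cat_scheme \<Rightarrow> (real \<Rightarrow> 'o set) \<Rightarrow>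
    (('o set \<Rightarrow>\<^sub>0 int) set \<Rightarrow> complex) \<Rightarrow> ('m \<times> 'm \<times> 'm) set" where
  "thin_triangles C P Z = {(f, g, h). \<exists>A B D. exact_triangle C A B D f g h \<and>
     mass C P Z B = mass C P Z A + mass C P Z D}"

text \<open>Since \<open>S\<close> and \<open>S[1]\<close> have the same mass, independence concerns the stable objects up to
  isomorphism and shift; those in the heart represent each shift orbit exactly once.\<close>

definition independent_stable_masses ::
  "('o, 'm, 'x) triang_cat_scheme \<Rightarrow> (real \<Rightarrow> 'o set) \<Rightarrow>
    (('o set \<Rightarrow>\<^sub>0 int) set \<Rightarrow> complex) \<Rightarrow> bool" where
  "independent_stable_masses C P Z \<longleftrightarrow>
     (\<forall>F c. finite F \<and> F \<subseteq> heart_stables C P \<and>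
        (\<forall>S \<in> F. \<forall>S' \<in> F. isomorphic C S S' \<longrightarrow> S = S') \<and>
        (\<Sum>S\<in>F. real_of_int (c S) * cmod (charge C Z S)) = 0 \<longrightarrow>
        (\<forall>S \<in> F. c S = (0::int)))"


section \<open>The module over Laurent polynomials\<close>

text \<open>\<open>int \<Rightarrow>\<^sub>0 int\<close> with the convolution product is the group ring of the infinite cyclic group,
  i.e. the ring of Laurent polynomials; \<open>Poly_Mapping.single n a\<close> is \<open>a s\<^sup>n\<close>.\<close>

definition laurent_ring :: "(int \<Rightarrow>\<^sub>0 int) ring" where
  "laurent_ring = \<lparr>carrier = UNIV, monoid.mult = (*), one = 1, ring.zero = 0, add = (+)\<rparr>"

definition laurent_s :: "int \<Rightarrow>\<^sub>0 int" where
  "laurent_s = Poly_Mapping.single 1 1"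

definition shift_iso_class :: "('o, 'm, 'x) triang_cat_scheme \<Rightarrow> 'o set \<Rightarrow> 'o set" where
  "shift_iso_class C c = {Y \<in> obj C. \<exists>X \<in> c. isomorphic C (shift_ob C X) Y}"

text \<open>The endomorphism induced on the quotient by \<open>[X] \<mapsto> [X[1]]\<close>; a coset is sent to the union
  of the cosets of the shifts of its elements, a single coset when \<open>T\<close> is closed under shift.\<close>

definition groth_shift ::
  "('o, 'm, 'x) triang_cat_scheme \<Rightarrow> ('m \<times> 'm \<times> 'm) set \<Rightarrow>
    ('o set \<Rightarrow>\<^sub>0 int) set \<Rightarrow> ('o set \<Rightarrow>\<^sub>0 int) set" where
  "groth_shift C T a =
     (\<Union>x\<in>a. groth_proj C T (frag_extend (\<lambda>c. frag_of (shift_iso_class C c)) x))"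

definition groth_shift_power ::
  "('o, 'm, 'x) triang_cat_scheme \<Rightarrow> ('m \<times> 'm \<times> 'm) set \<Rightarrow> int \<Rightarrow>
    ('o set \<Rightarrow>\<^sub>0 int) set \<Rightarrow> ('o set \<Rightarrow>\<^sub>0 int) set" where
  "groth_shift_power C T n = (if n \<ge> 0 then groth_shift C T ^^ nat n
     else inv_into (carrier (groth_group C T)) (groth_shift C T) ^^ nat (- n))"

text \<open>\<open>groth_group\<close> is written multiplicatively, so the integer multiple \<open>k x\<close> is a power. The
  multiplicative part of the module record is irrelevant.\<close>

definition groth_module ::
  "('o, 'm, 'x) triang_cat_scheme \<Rightarrow> ('m \<times> 'm \<times> 'm) set \<Rightarrow>
    (int \<Rightarrow>\<^sub>0 int, ('o set \<Rightarrow>\<^sub>0 int) set) module" where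
  "groth_module C T = \<lparr>carrier = carrier (groth_group C T),
     monoid.mult = undefined, one = undefined,
     ring.zero = one (groth_group C T), add = monoid.mult (groth_group C T),
     smult = (\<lambda>p x. finprod (groth_group C T)
       (\<lambda>n. groth_shift_power C T n x [^]\<^bsub>groth_group C T\<^esub> (Poly_Mapping.lookup p n))
       (Poly_Mapping.keys p))\<rparr>"

definition K0_tau ::
  "('o, 'm, 'x) triang_cat_scheme \<Rightarrow> (real \<Rightarrow> 'o set) \<Rightarrow>
    (('o set \<Rightarrow>\<^sub>0 int) set \<Rightarrow> complex) \<Rightarrow> (int \<Rightarrow>\<^sub>0 int, ('o set \<Rightarrow>\<^sub>0 int) set) module" where
  "K0_tau C P Z = groth_module C (thin_triangles C P Z)"

definition K0_tau_class ::
  "('o, 'm, 'x) triang_cat_scheme \<Rightarrow> (real \<Rightarrow> 'o set) \<Rightarrow>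
    (('o set \<Rightarrow>\<^sub>0 int) set \<Rightarrow> complex) \<Rightarrow> 'o set \<Rightarrow> ('o set \<Rightarrow>\<^sub>0 int) set" where
  "K0_tau_class C P Z c = groth_proj C (thin_triangles C P Z) (frag_of c)"

text \<open>The family \<open>b\<close> indexed by \<open>I\<close> is a basis of \<open>M\<close> over \<open>R\<close>.\<close>

definition freely_generated_by ::
  "('a, 'y) ring_scheme \<Rightarrow> ('a, 'b, 'z) module_scheme \<Rightarrow> 'i set \<Rightarrow> ('i \<Rightarrow> 'b) \<Rightarrow> bool" where
  "freely_generated_by R M I b \<longleftrightarrow> b \<in> I \<rightarrow> carrier M \<and>
     (\<forall>x \<in> carrier M. \<exists>!c. c \<in> UNIV \<rightarrow> carrier R \<and>
        finite {i. c i \<noteq> \<zero>\<^bsub>R\<^esub>} \<and> {i. c i \<noteq> \<zero>\<^bsub>R\<^esub>} \<subseteq> I \<and>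
        x = (\<Oplus>\<^bsub>M\<^esub>i\<in>{i. c i \<noteq> \<zero>\<^bsub>R\<^esub>}. c i \<odot>\<^bsub>M\<^esub> b i))"

end

theory Submission
  imports Defs
begin

text \<open>Let \<open>a\<^sub>X \<psi>\<close> be the mass of the HN factor of \<open>X\<close> of phase \<open>\<psi>\<close>. For a triangle
  \<open>A \<rightarrow> B \<rightarrow> D\<close> put \<open>d = a\<^sub>A + a\<^sub>D - a\<^sub>B\<close>. Truncating at phase \<open>\<phi>\<close>, the defect
  \<open>Z A\<^sub>\<ge> + Z D\<^sub>\<ge> - Z B\<^sub>\<ge>\<close> (the parts of phase at least \<open>\<phi>\<close>) is the charge of an object of
  \<open>P [\<phi>, \<phi> + 1)\<close>, which gives \<open>\<Sum>\<psi>\<ge>\<phi>. d \<psi> * sin (pi * (\<psi> - \<phi>)) \<ge> 0\<close> for every \<open>\<phi>\<close>.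
  Integrated over \<open>\<phi>\<close> this is the triangle inequality for the mass, and equality forces \<open>d = 0\<close>.
  The case \<open>X \<rightarrow> X \<rightarrow> 0\<close>, with two HN filtrations of \<open>X\<close>, shows that \<open>a\<^sub>X\<close> is well defined; a thin
  triangle has \<open>a\<^sub>B = a\<^sub>A + a\<^sub>D\<close>. As the masses of the stable objects are independent, \<open>a\<^sub>X\<close>
  determines the multiplicities of the stable factors of \<open>X\<close>. These are therefore additive on thin
  triangles and split the presentation of the Grothendieck group: it is free over the integers on
  the stable classes, on which the shift acts freely with the heart as a fundamental domain.\<close>

section \<open>Categories and triangles\<close>

text \<open>Thinness is a single real equation between masses, and masses do not distinguish
  \<open>S\<close> from \<open>S[1]\<close>; charges alone do not help either, since
  \<open>Z\<close> changes sign under the shift and cancels between phases. The equation therefore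
  has to be refined phase by phase: at one phase each shift orbit of stable objects has, up to
  isomorphism, at most one member, so that independence, a statement about the heart, can be applied
  there. The sine comes from the heart \<open>P [\<phi>, \<phi> + 1)\<close>: the charges of its
  objects lie in the closed upper half-plane turned by \<open>pi * \<phi>\<close>, and the imaginary
  part after turning back is what is retained. The integral becomes a mass because a primitive of
  the sine is, up to the factor \<open>pi\<close>, \<open>1 - cos\<close>: with the cutoff below all
  phases, the cosines add up to the real part of a rotated charge defect, zero by additivity of
  \<open>Z\<close>, and the constants add up to the mass defect. In the equality case the monotone
  primitive is squeezed to 0, while just below the largest phase of the support of \<open>d\<close>
  it consists of a single nonzero term.\<close>

context category
begin

lemma Mor_obj:
  assumes "f \<in> Mor C A B"
  shows "A \<in> obj C" "B \<in> obj C"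
  using assms src_obj tgt_obj by (auto simp: Mor_def)

lemma is_isoI:
  assumes "f \<in> Mor C A B" "g \<in> Mor C B A" "g \<cdot> f = ident C A" "f \<cdot> g = ident C B"
  shows "is_iso C A B f"
  using assms by (auto simp: is_iso_def)

lemma is_isoE:
  assumes "is_iso C A B f"
  obtains g where "f \<in> Mor C A B" "g \<in> Mor C B A" "g \<cdot> f = ident C A" "f \<cdot> g = ident C B"
  using assms by (auto simp: is_iso_def)

lemma is_iso_ident: "A \<in> obj C \<Longrightarrow> is_iso C A A (ident C A)"
  by (intro is_isoI[where g = "ident C A"]) (auto intro: ident_Mor cmp_ident_left)

lemma is_iso_cmp:
  assumes "is_iso C A B f" "is_iso C B D g"
  shows "is_iso C A D (g \<cdot> f)"
proof -
  obtain f' where f: "f \<in> Mor C A B" "f' \<in> Mor C B A" "f' \<cdot> f = ident C A" "f \<cdot> f' = ident C B"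
    using assms(1) by (rule is_isoE)
  obtain g' where g: "g \<in> Mor C B D" "g' \<in> Mor C D B" "g' \<cdot> g = ident C B" "g \<cdot> g' = ident C D"
    using assms(2) by (rule is_isoE)
  have "(f' \<cdot> g') \<cdot> (g \<cdot> f) = f' \<cdot> ((g' \<cdot> g) \<cdot> f)"
    using cmp_assoc[OF f(1) g(1) g(2)] cmp_assoc[OF cmp_Mor[OF f(1) g(1)] g(2) f(2)] by simp
  moreover have "(g \<cdot> f) \<cdot> (f' \<cdot> g') = g \<cdot> ((f \<cdot> f') \<cdot> g')"
    using cmp_assoc[OF g(2) f(2) f(1)] cmp_assoc[OF cmp_Mor[OF g(2) f(2)] f(1) g(1)] by simp
  ultimately show ?thesis
    using f g by (intro is_isoI[where g = "f' \<cdot> g'"]) (auto intro: cmp_Mor simp: cmp_ident_left)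
qed

lemma isomorphic_obj: "isomorphic C A B \<Longrightarrow> A \<in> obj C \<and> B \<in> obj C"
  by (auto simp: isomorphic_def is_iso_def dest: Mor_obj)

lemma isomorphic_refl: "A \<in> obj C \<Longrightarrow> isomorphic C A A"
  using is_iso_ident by (auto simp: isomorphic_def)

lemma isomorphic_sym: "isomorphic C A B \<Longrightarrow> isomorphic C B A"
  unfolding isomorphic_def is_iso_def by blast

lemma isomorphic_trans: "isomorphic C A B \<Longrightarrow> isomorphic C B D \<Longrightarrow> isomorphic C A D"
  unfolding isomorphic_def using is_iso_cmp by blast

lemma iso_class_eq_iff:
  assumes "A \<in> obj C" "B \<in> obj C"
  shows "iso_class C A = iso_class C B \<longleftrightarrow> isomorphic C A B"
proof
  assume "iso_class C A = iso_class C B"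
  moreover have "B \<in> iso_class C B"
    using assms isomorphic_refl by (auto simp: iso_class_def)
  ultimately show "isomorphic C A B"
    by (auto simp: iso_class_def)
next
  assume "isomorphic C A B"
  then show "iso_class C A = iso_class C B"
    unfolding iso_class_def using isomorphic_sym isomorphic_trans by blast
qed

lemma mem_iso_class: "A \<in> obj C \<Longrightarrow> A \<in> iso_class C A"
  by (simp add: iso_class_def isomorphic_refl)

lemma zero_object_obj: "is_zero_object C N \<Longrightarrow> N \<in> obj C"
  by (simp add: is_zero_object_def)

end


lemma Mor_group_simps:
  "carrier (Mor_group C A B) = Mor C A B"
  "monoid.mult (Mor_group C A B) = hadd C"
  "one (Mor_group C A B) = hzero C A B"
  by (simp_all add: Mor_group_def)

context additive_category
begin

lemma Mor_group: "A \<in> obj C \<Longrightarrow> B \<in> obj C \<Longrightarrow> group (Mor_group C A B)"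
  using Mor_comm_group by (simp add: comm_group_def)

lemma hzero_Mor: "A \<in> obj C \<Longrightarrow> B \<in> obj C \<Longrightarrow> hzero C A B \<in> Mor C A B"
  using group.is_monoid[OF Mor_group, THEN monoid.one_closed, of A B] by (simp add: Mor_group_simps)

text \<open>An additive map sends zero to an idempotent for addition, and in a group only zero is
  one; composites with zero arrows and shifted zero arrows are treated this way.\<close>

lemma hadd_idem_imp_hzero:
  assumes "f \<in> Mor C A B" "hadd C f f = f"
  shows "f = hzero C A B"
proof -
  interpret comm_group "Mor_group C A B"
    using Mor_comm_group Mor_obj assms(1) by blast
  show ?thesis
    using assms l_cancel_one[of f f] by (auto simp: Mor_group_simps)
qed

lemma cmp_hzero_right:
  assumes "g \<in> Mor C B D" "A \<in> obj C"
  shows "g \<cdot> hzero C A B = hzero C A D"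
proof (rule hadd_idem_imp_hzero)
  have z: "hzero C A B \<in> Mor C A B"
    using assms Mor_obj hzero_Mor by blast
  show "g \<cdot> hzero C A B \<in> Mor C A D"
    using z assms cmp_Mor by blast
  interpret comm_group "Mor_group C A B"
    using Mor_comm_group Mor_obj z by blast
  have "hadd C (hzero C A B) (hzero C A B) = hzero C A B"
    using l_one[of "hzero C A B"] z by (simp add: Mor_group_simps)
  then show "hadd C (g \<cdot> hzero C A B) (g \<cdot> hzero C A B) = g \<cdot> hzero C A B"
    using cmp_hadd_right[OF z z assms(1)] by simp
qed

lemma cmp_hzero_left:
  assumes "f \<in> Mor C A B" "D \<in> obj C"
  shows "hzero C B D \<cdot> f = hzero C A D"
proof (rule hadd_idem_imp_hzero)
  have z: "hzero C B D \<in> Mor C B D"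
    using assms Mor_obj hzero_Mor by blast
  show "hzero C B D \<cdot> f \<in> Mor C A D"
    using z assms cmp_Mor by blast
  interpret comm_group "Mor_group C B D"
    using Mor_comm_group Mor_obj z by blast
  have "hadd C (hzero C B D) (hzero C B D) = hzero C B D"
    using l_one[of "hzero C B D"] z by (simp add: Mor_group_simps)
  then show "hadd C (hzero C B D \<cdot> f) (hzero C B D \<cdot> f) = hzero C B D \<cdot> f"
    using cmp_hadd_left[OF assms(1) z z] by simp
qed

lemma hminus_eq_inv: "f \<in> Mor C A B \<Longrightarrow> hminus C f = inv\<^bsub>Mor_group C A B\<^esub> f"
  by (auto simp: hminus_def Mor_def)

lemma hminus_Mor:
  assumes "f \<in> Mor C A B"
  shows "hminus C f \<in> Mor C A B"
proof -
  interpret comm_group "Mor_group C A B"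
    using Mor_comm_group Mor_obj assms by blast
  show ?thesis
    using inv_closed[of f] assms by (simp add: hminus_eq_inv[OF assms] Mor_group_simps)
qed

lemma hminus_hminus:
  assumes "f \<in> Mor C A B"
  shows "hminus C (hminus C f) = f"
proof -
  interpret comm_group "Mor_group C A B"
    using Mor_comm_group Mor_obj assms by blast
  show ?thesis
    using inv_inv[of f] assms hminus_eq_inv[OF hminus_Mor[OF assms]] hminus_eq_inv[OF assms]
    by (simp add: Mor_group_simps)
qed

lemma hminus_eq_iff:
  assumes "f \<in> Mor C A B" "g \<in> Mor C A B"
  shows "hminus C f = hminus C g \<longleftrightarrow> f = g"
  using assms hminus_hminus by metis

lemma hadd_hminus:
  assumes "f \<in> Mor C A B"
  shows "hadd C f (hminus C f) = hzero C A B"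
proof -
  interpret comm_group "Mor_group C A B"
    using Mor_comm_group Mor_obj assms by blast
  show ?thesis
    using r_inv[of f] assms by (simp add: hminus_eq_inv[OF assms] Mor_group_simps)
qed

lemma hminus_unique:
  assumes "f \<in> Mor C A B" "g \<in> Mor C A B" "hadd C f g = hzero C A B"
  shows "hminus C f = g"
proof -
  interpret comm_group "Mor_group C A B"
    using Mor_comm_group Mor_obj assms(1) by blast
  show ?thesis
    using inv_unique'[of f g] m_comm[of f g] assms hminus_eq_inv[OF assms(1)]
    by (simp add: Mor_group_simps)
qed

lemma hminus_hzero: "A \<in> obj C \<Longrightarrow> B \<in> obj C \<Longrightarrow> hminus C (hzero C A B) = hzero C A B"
proof -
  assume *: "A \<in> obj C" "B \<in> obj C"
  interpret comm_group "Mor_group C A B"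
    using Mor_comm_group * by blast
  show ?thesis
    using l_one[of "hzero C A B"] hzero_Mor[OF *]
    by (intro hminus_unique) (simp_all add: Mor_group_simps)
qed

lemma cmp_hminus_right:
  assumes "f \<in> Mor C A B" "g \<in> Mor C B D"
  shows "g \<cdot> hminus C f = hminus C (g \<cdot> f)"
proof (rule sym, rule hminus_unique)
  show "g \<cdot> f \<in> Mor C A D" "g \<cdot> hminus C f \<in> Mor C A D"
    using assms cmp_Mor hminus_Mor by blast+
  show "hadd C (g \<cdot> f) (g \<cdot> hminus C f) = hzero C A D"
    using cmp_hadd_right[OF assms(1) hminus_Mor[OF assms(1)] assms(2)]
      hadd_hminus[OF assms(1)] cmp_hzero_right[OF assms(2)] Mor_obj[OF assms(1)] by simp
qed

lemma cmp_hminus_left: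
  assumes "f \<in> Mor C A B" "g \<in> Mor C B D"
  shows "hminus C g \<cdot> f = hminus C (g \<cdot> f)"
proof (rule sym, rule hminus_unique)
  show "g \<cdot> f \<in> Mor C A D" "hminus C g \<cdot> f \<in> Mor C A D"
    using assms cmp_Mor hminus_Mor by blast+
  show "hadd C (g \<cdot> f) (hminus C g \<cdot> f) = hzero C A D"
    using cmp_hadd_left[OF assms(1) assms(2) hminus_Mor[OF assms(2)]]
      hadd_hminus[OF assms(2)] cmp_hzero_left[OF assms(1)] Mor_obj[OF assms(2)] by simp
qed

lemma zero_object_Mor_to:
  assumes "is_zero_object C N" "f \<in> Mor C A N"
  shows "f = hzero C A N"
  using assms Mor_obj[OF assms(2)] hzero_Mor unfolding is_zero_object_def by blast

lemma zero_object_Mor_from: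
  assumes "is_zero_object C N" "f \<in> Mor C N A"
  shows "f = hzero C N A"
  using assms Mor_obj[OF assms(2)] hzero_Mor unfolding is_zero_object_def by blast

text \<open>Being zero becomes an equation between two arrows, which a faithful additive functor
  such as the shift preserves and reflects.\<close>

lemma zero_object_iff:
  assumes "A \<in> obj C"
  shows "is_zero_object C A \<longleftrightarrow> ident C A = hzero C A A"
proof
  assume "is_zero_object C A"
  then show "ident C A = hzero C A A"
    using zero_object_Mor_to ident_Mor assms by blast
next
  assume *: "ident C A = hzero C A A"
  have "f = hzero C B A" if "f \<in> Mor C B A" for B f
    using cmp_ident_left[OF that] cmp_hzero_left[OF that assms] * by simp
  moreover have "f = hzero C A B" if "f \<in> Mor C A B" for B f
    using cmp_ident_right[OF that] cmp_hzero_right[OF that assms] * by simp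
  ultimately show "is_zero_object C A"
    unfolding is_zero_object_def using assms hzero_Mor by metis
qed

lemma zero_object_isomorphic:
  assumes "is_zero_object C A" "isomorphic C A B"
  shows "is_zero_object C B"
proof -
  obtain f g where f: "f \<in> Mor C A B" "g \<in> Mor C B A" "f \<cdot> g = ident C B"
    using assms(2) by (auto simp: isomorphic_def elim: is_isoE)
  have "f \<cdot> g = hzero C B B"
    using zero_object_Mor_from[OF assms(1) f(1)] cmp_hzero_left[OF f(2)] Mor_obj[OF f(1)] by simp
  then show ?thesis
    using f zero_object_iff Mor_obj by metis
qed

lemma zero_objects_isomorphic:
  assumes "is_zero_object C A" "is_zero_object C B"
  shows "isomorphic C A B"
proof -
  have o: "A \<in> obj C" "B \<in> obj C"
    using assms zero_object_obj by auto
  have "is_iso C A B (hzero C A B)"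
    using assms o hzero_Mor zero_object_iff cmp_hzero_left by (intro is_isoI) auto
  then show ?thesis
    by (auto simp: isomorphic_def)
qed

end


context triangulated_category
begin

lemma shift_Mor: "f \<in> Mor C A B \<Longrightarrow> shift_arr C f \<in> Mor C (shift_ob C A) (shift_ob C B)"
  using shift_fully_faithful[of A B] Mor_obj by (auto simp: bij_betw_def)

lemma shift_inj: "\<lbrakk>f \<in> Mor C A B; g \<in> Mor C A B; shift_arr C f = shift_arr C g\<rbrakk> \<Longrightarrow> f = g"
  using shift_fully_faithful[of A B] Mor_obj by (fastforce simp: bij_betw_def inj_on_def)

lemma shift_full:
  assumes "A \<in> obj C" "B \<in> obj C" "f \<in> Mor C (shift_ob C A) (shift_ob C B)"
  obtains g where "g \<in> Mor C A B" "f = shift_arr C g"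
  using shift_fully_faithful[of A B] assms by (auto simp: bij_betw_def)

lemma shift_hzero:
  assumes "A \<in> obj C" "B \<in> obj C"
  shows "shift_arr C (hzero C A B) = hzero C (shift_ob C A) (shift_ob C B)"
proof (rule hadd_idem_imp_hzero)
  show "shift_arr C (hzero C A B) \<in> Mor C (shift_ob C A) (shift_ob C B)"
    using assms hzero_Mor shift_Mor by blast
  interpret comm_group "Mor_group C A B"
    using Mor_comm_group assms by blast
  have "hadd C (hzero C A B) (hzero C A B) = hzero C A B"
    using l_one[of "hzero C A B"] hzero_Mor[OF assms] by (simp add: Mor_group_simps)
  then show "hadd C (shift_arr C (hzero C A B)) (shift_arr C (hzero C A B)) = shift_arr C (hzero C A B)"
    using shift_hadd hzero_Mor[OF assms] by metis
qed

lemma shift_eq_hzero: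
  assumes "f \<in> Mor C A B" "shift_arr C f = hzero C (shift_ob C A) (shift_ob C B)"
  shows "f = hzero C A B"
  using assms shift_hzero shift_inj hzero_Mor Mor_obj by metis

lemma shift_zero_object_iff:
  assumes "A \<in> obj C"
  shows "is_zero_object C (shift_ob C A) \<longleftrightarrow> is_zero_object C A"
  using assms zero_object_iff shift_obj shift_ident shift_eq_hzero[OF ident_Mor] shift_hzero by metis

lemma shift_is_iso_iff:
  assumes "A \<in> obj C" "B \<in> obj C" "f \<in> Mor C A B"
  shows "is_iso C (shift_ob C A) (shift_ob C B) (shift_arr C f) \<longleftrightarrow> is_iso C A B f"
proof
  assume "is_iso C (shift_ob C A) (shift_ob C B) (shift_arr C f)"
  then obtain g where g: "g \<in> Mor C (shift_ob C B) (shift_ob C A)"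
    "g \<cdot> shift_arr C f = ident C (shift_ob C A)" "shift_arr C f \<cdot> g = ident C (shift_ob C B)"
    by (auto elim: is_isoE)
  obtain g' where g': "g' \<in> Mor C B A" "g = shift_arr C g'"
    using shift_full[OF assms(2,1) g(1)] by blast
  have "g' \<cdot> f = ident C A"
    using g(2) g'(2) shift_ident[OF assms(1)] shift_cmp[OF assms(3) g'(1)]
    by (intro shift_inj[OF cmp_Mor[OF assms(3) g'(1)] ident_Mor[OF assms(1)]]) simp
  moreover have "f \<cdot> g' = ident C B"
    using g(3) g'(2) shift_ident[OF assms(2)] shift_cmp[OF g'(1) assms(3)]
    by (intro shift_inj[OF cmp_Mor[OF g'(1) assms(3)] ident_Mor[OF assms(2)]]) simp
  ultimately show "is_iso C A B f"
    using assms g' is_isoI by blast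
next
  assume "is_iso C A B f"
  then show "is_iso C (shift_ob C A) (shift_ob C B) (shift_arr C f)"
    using assms shift_cmp shift_ident shift_Mor unfolding is_iso_def by metis
qed

lemma shift_isomorphic_iff:
  assumes "A \<in> obj C" "B \<in> obj C"
  shows "isomorphic C (shift_ob C A) (shift_ob C B) \<longleftrightarrow> isomorphic C A B"
proof
  assume "isomorphic C (shift_ob C A) (shift_ob C B)"
  then obtain f where f: "is_iso C (shift_ob C A) (shift_ob C B) f"
    by (auto simp: isomorphic_def)
  then obtain f' where "f' \<in> Mor C A B" "f = shift_arr C f'"
    using shift_full[OF assms] by (metis is_isoE)
  then show "isomorphic C A B"
    using f assms shift_is_iso_iff by (auto simp: isomorphic_def)
next
  assume "isomorphic C A B"
  then show "isomorphic C (shift_ob C A) (shift_ob C B)"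
    using assms shift_is_iso_iff unfolding isomorphic_def by (metis is_isoE)
qed

section \<open>Exact triangles: rotation, lifting and extension of arrows\<close>

lemma exact_triangleD:
  assumes "exact_triangle C A B D f g h"
  shows "f \<in> Mor C A B" "g \<in> Mor C B D" "h \<in> Mor C D (shift_ob C A)"
    "A \<in> obj C" "B \<in> obj C" "D \<in> obj C"
  using assms Mor_obj unfolding exact_triangle_def triangle_def by blast+

lemma exact_rotate:
  assumes "exact_triangle C A B D f g h"
  shows "exact_triangle C B D (shift_ob C A) g h (hminus C (shift_arr C f))"
  using assms TR2 unfolding exact_triangle_def by blast

text \<open>Rotating three times introduces signs in the arrows; they are left existential because
  only the vertices matter later.\<close>

lemma exact_shift:
  assumes "exact_triangle C A B D f g h"
  shows "\<exists>f g h. exact_triangle C (shift_ob C A) (shift_ob C B) (shift_ob C D) f g h"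
  using exact_rotate[OF exact_rotate[OF exact_rotate[OF assms]]] by blast

text \<open>The trivial triangle \<open>W -> W -> N[1]\<close>, with \<open>N[1]\<close> again zero,
  rotated backwards.\<close>

lemma exact_zero_left:
  assumes "W \<in> obj C" "is_zero_object C N"
  shows "exact_triangle C N W W (hzero C N W) (ident C W) (hzero C W (shift_ob C N))"
proof -
  have o: "N \<in> obj C" "shift_ob C N \<in> obj C" "is_zero_object C (shift_ob C N)"
    using assms zero_object_obj shift_obj shift_zero_object_iff by auto
  have "exact_triangle C W W (shift_ob C N) (ident C W) (hzero C W (shift_ob C N))
     (hminus C (shift_arr C (hzero C N W)))"
    using TR1_ident[OF assms(1) o(3)] shift_hzero hminus_hzero o assms(1) shift_obj by simp
  then show ?thesis
    using TR2[of N W W "hzero C N W" "ident C W" "hzero C W (shift_ob C N)"] assms o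
    by (auto simp: triangle_def intro: hzero_Mor ident_Mor)
qed

text \<open>Exactness of \<open>Hom(W, -)\<close> at \<open>B\<close>: TR3 compares
  \<open>W -> 0 -> W[1]\<close> with the rotation \<open>B -> D -> A[1]\<close>, and the resulting
  arrow \<open>W[1] -> A[1]\<close> descends to \<open>W -> A\<close> because the shift is full. The
  signs from the two rotations cancel.\<close>

lemma exact_lift:
  assumes t: "exact_triangle C A B D f g h" and w: "w \<in> Mor C W B" and z: "g \<cdot> w = hzero C W D"
  shows "\<exists>u \<in> Mor C W A. f \<cdot> u = w"
proof -
  obtain N where N: "is_zero_object C N"
    using ex_zero_object by blast
  note T = exact_triangleD[OF t]
  have o: "W \<in> obj C" "N \<in> obj C" "shift_ob C W \<in> obj C"
    using w Mor_obj N zero_object_obj shift_obj by auto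
  have "exact_triangle C W N (shift_ob C W) (hzero C W N) (hzero C N (shift_ob C W))
     (hminus C (shift_arr C (ident C W)))"
    using exact_rotate[OF TR1_ident[OF o(1) N]] .
  moreover have "hzero C N D \<cdot> hzero C W N = g \<cdot> w"
    using z cmp_hzero_right o T hzero_Mor by simp
  ultimately obtain c where c: "c \<in> Mor C (shift_ob C W) (shift_ob C A)"
    "shift_arr C w \<cdot> hminus C (shift_arr C (ident C W)) = hminus C (shift_arr C f) \<cdot> c"
    using TR3[OF _ exact_rotate[OF t] w, of N] hzero_Mor o T by blast
  obtain u where u: "u \<in> Mor C W A" "c = shift_arr C u"
    using c shift_full o T by blast
  have "hminus C (shift_arr C w) = hminus C (shift_arr C f \<cdot> shift_arr C u)"
    using c u cmp_hminus_right[OF ident_Mor shift_Mor[OF w]] cmp_ident_right[OF shift_Mor[OF w]]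
      shift_ident o cmp_hminus_left[OF shift_Mor[OF u(1)] shift_Mor[OF T(1)]] by simp
  then have "hminus C (shift_arr C w) = hminus C (shift_arr C (f \<cdot> u))"
    using shift_cmp u T by metis
  then have "w = f \<cdot> u"
    using hminus_eq_iff shift_Mor w cmp_Mor[OF u(1) T(1)] shift_inj by metis
  then show ?thesis
    using u by blast
qed

text \<open>Exactness of \<open>Hom(-, W)\<close> at \<open>B\<close>: TR3 compares the triangle
  with \<open>0 -> W -> W\<close>, and the third arrow is the extension.\<close>

lemma exact_extend:
  assumes t: "exact_triangle C A B D f g h" and w: "w \<in> Mor C B W" and z: "w \<cdot> f = hzero C A W"
  shows "\<exists>u \<in> Mor C D W. u \<cdot> g = w"
proof -
  obtain N where N: "is_zero_object C N"
    using ex_zero_object by blast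
  note T = exact_triangleD[OF t]
  have o: "W \<in> obj C" "N \<in> obj C"
    using w Mor_obj N zero_object_obj by auto
  have "w \<cdot> f = hzero C N W \<cdot> hzero C A N"
    using z cmp_hzero_left[OF hzero_Mor] o T by simp
  then obtain c where "c \<in> Mor C D W" "c \<cdot> g = ident C W \<cdot> w"
    using TR3[OF t exact_zero_left[OF o(1) N], of "hzero C A N" w] hzero_Mor o T w by blast
  then show ?thesis
    using cmp_ident_left[OF w] by auto
qed

lemma iso_class_shift:
  assumes "X \<in> obj C"
  shows "shift_iso_class C (iso_class C X) = iso_class C (shift_ob C X)"
proof -
  have "isomorphic C (shift_ob C X) Y" if "isomorphic C X X'" "isomorphic C (shift_ob C X') Y" for X' Y
    using that isomorphic_trans shift_isomorphic_iff isomorphic_obj by meson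
  then show ?thesis
    using isomorphic_refl[OF assms] assms by (auto simp: shift_iso_class_def iso_class_def)
qed

text \<open>The shift is only an equivalence on objects, but on isomorphism classes it is
  invertible, which allows negative powers of \<open>s\<close>.\<close>

lemma bij_shift_iso_class:
  "bij_betw (shift_iso_class C) (iso_class C ` obj C) (iso_class C ` obj C)"
  unfolding bij_betw_def
proof
  show "inj_on (shift_iso_class C) (iso_class C ` obj C)"
  proof (rule inj_onI)
    fix a b
    assume "a \<in> iso_class C ` obj C" "b \<in> iso_class C ` obj C"
      and eq: "shift_iso_class C a = shift_iso_class C b"
    then obtain A B where "A \<in> obj C" "B \<in> obj C" "a = iso_class C A" "b = iso_class C B"
      by blast
    then show "a = b"
      using eq iso_class_shift iso_class_eq_iff shift_obj shift_isomorphic_iff by simp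
  qed
  show "shift_iso_class C ` iso_class C ` obj C = iso_class C ` obj C"
  proof
    show "shift_iso_class C ` iso_class C ` obj C \<subseteq> iso_class C ` obj C"
      using iso_class_shift shift_obj by auto
    show "iso_class C ` obj C \<subseteq> shift_iso_class C ` iso_class C ` obj C"
    proof
      fix b assume "b \<in> iso_class C ` obj C"
      then obtain B A where "B \<in> obj C" "b = iso_class C B" "A \<in> obj C" "isomorphic C (shift_ob C A) B"
        using shift_ess_surj by blast
      then show "b \<in> shift_iso_class C ` iso_class C ` obj C"
        using iso_class_shift iso_class_eq_iff shift_obj isomorphic_sym
          by (intro image_eqI[of _ _ "iso_class C A"]) auto
    qed
  qed
qed

end

section \<open>Relations in the Grothendieck group\<close>

context triangulated_category
begin

lemma carrier_iso_free_group:
  "x \<in> carrier (iso_free_group C) \<longleftrightarrow> Poly_Mapping.keys x \<subseteq> iso_class C ` obj C"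
  by (simp add: iso_free_group_def)

lemma subgroup_triangle_relations: "subgroup (triangle_relations C T) (iso_free_group C)"
proof -
  interpret group "iso_free_group C"
    by (simp add: iso_free_group_def)
  have "Poly_Mapping.keys (frag_of (iso_class C A) - frag_of (iso_class C B) + frag_of (iso_class C D))
      \<subseteq> iso_class C ` obj C" if "exact_triangle C A B D f g h" for A B D f g h
    using exact_triangleD[OF that] keys_add keys_diff
    by (smt (verit) UnE empty_iff image_eqI insert_iff keys_frag_of subset_iff)
  then show ?thesis
    unfolding triangle_relations_def
    by (intro generate_is_subgroup) (auto simp: carrier_iso_free_group)
qed

lemma triangle_relations_keys:
  "x \<in> triangle_relations C T \<Longrightarrow> Poly_Mapping.keys x \<subseteq> iso_class C ` obj C"
  using subgroup.subset[OF subgroup_triangle_relations] carrier_iso_free_group by blast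

lemma triangle_relations_add:
  "\<lbrakk>x \<in> triangle_relations C T; y \<in> triangle_relations C T\<rbrakk> \<Longrightarrow> x + y \<in> triangle_relations C T"
  using subgroup.m_closed[OF subgroup_triangle_relations] by (simp add: iso_free_group_def)

lemma triangle_relations_zero: "0 \<in> triangle_relations C T"
  using subgroup.one_closed[OF subgroup_triangle_relations] by (simp add: iso_free_group_def)

lemma triangle_relations_uminus:
  "x \<in> triangle_relations C T \<Longrightarrow> - x \<in> triangle_relations C T"
  using subgroup.m_inv_closed[OF subgroup_triangle_relations, of x T] triangle_relations_keys
  by (simp add: iso_free_group_def)

lemma triangle_relations_diff:
  "\<lbrakk>x \<in> triangle_relations C T; y \<in> triangle_relations C T\<rbrakk> \<Longrightarrow> x - y \<in> triangle_relations C T"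
  using triangle_relations_add[OF _ triangle_relations_uminus] by fastforce

lemma exact_in_triangle_relations:
  assumes "exact_triangle C A B D f g h" "(f, g, h) \<in> T"
  shows "frag_of (iso_class C A) - frag_of (iso_class C B) + frag_of (iso_class C D)
    \<in> triangle_relations C T"
  unfolding triangle_relations_def using assms by (blast intro: generate.incl)

lemma triangle_relations_normal: "triangle_relations C T \<lhd> iso_free_group C"
  using subgroup_triangle_relations abelian_free_Abelian_group
  by (metis comm_group.subgroup_imp_normal iso_free_group_def)

lemma comm_group_groth_group: "comm_group (groth_group C T)"
  unfolding groth_group_def
  by (intro comm_group.abelian_FactGroup subgroup_triangle_relations)
    (simp add: iso_free_group_def abelian_free_Abelian_group)

lemma carrier_groth_group:
  "carrier (groth_group C T) = groth_proj C T ` {x. Poly_Mapping.keys x \<subseteq> iso_class C ` obj C}"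
  by (auto simp: groth_group_def groth_proj_def carrier_FactGroup carrier_iso_free_group)

lemma groth_proj_add:
  assumes "Poly_Mapping.keys x \<subseteq> iso_class C ` obj C" "Poly_Mapping.keys y \<subseteq> iso_class C ` obj C"
  shows "groth_proj C T x \<otimes>\<^bsub>groth_group C T\<^esub> groth_proj C T y = groth_proj C T (x + y)"
  using assms normal.rcos_sum[OF triangle_relations_normal, of x y T]
  by (simp add: groth_group_def groth_proj_def carrier_iso_free_group) (simp add: iso_free_group_def)

lemma groth_proj_eq_iff:
  assumes "Poly_Mapping.keys x \<subseteq> iso_class C ` obj C" "Poly_Mapping.keys y \<subseteq> iso_class C ` obj C"
  shows "groth_proj C T x = groth_proj C T y \<longleftrightarrow> x - y \<in> triangle_relations C T"
proof -
  interpret group "iso_free_group C"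
    by (simp add: iso_free_group_def)
  have "groth_proj C T x = groth_proj C T y \<longleftrightarrow> x \<in> groth_proj C T y"
    unfolding groth_proj_def using assms subgroup_triangle_relations
    by (metis carrier_iso_free_group rcos_self repr_independence)
  also have "\<dots> \<longleftrightarrow> (\<exists>n \<in> triangle_relations C T. x = n + y)"
    by (simp add: groth_proj_def r_coset_def iso_free_group_def)
  also have "\<dots> \<longleftrightarrow> x - y \<in> triangle_relations C T"
    by (metis add_diff_cancel_right' diff_add_cancel)
  finally show ?thesis .
qed

lemma mem_groth_proj_iff:
  "y \<in> groth_proj C T x \<longleftrightarrow> y - x \<in> triangle_relations C T"
  by (auto simp: groth_proj_def r_coset_def iso_free_group_def) (metis diff_add_cancel)

lemma one_groth_group: "\<one>\<^bsub>groth_group C T\<^esub> = groth_proj C T 0"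
proof -
  have "\<one>\<^bsub>groth_group C T\<^esub> = triangle_relations C T"
    by (simp add: groth_group_def)
  also have "\<dots> = groth_proj C T 0"
    by (auto simp: groth_proj_def r_coset_def iso_free_group_def)
  finally show ?thesis .
qed

lemma groth_proj_int_pow:
  assumes "Poly_Mapping.keys x \<subseteq> iso_class C ` obj C"
  shows "groth_proj C T x [^]\<^bsub>groth_group C T\<^esub> (k::int) = groth_proj C T (frag_cmul k x)"
  using normal.FactGroup_int_pow[OF triangle_relations_normal, of x T k] assms
  by (simp add: groth_group_def groth_proj_def carrier_iso_free_group) (simp add: iso_free_group_def)

end

section \<open>Sine sums\<close>

text \<open>The integral of \<open>w\<close> against the finitely supported measure
  \<open>a\<close>. Values of \<open>w\<close> in any real vector space let one notation serve for
  masses, charges, truncated charges and sine sums. An infinite support would give the default 0, so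
  finiteness is carried along.\<close>

definition msum :: "(real \<Rightarrow> real) \<Rightarrow> (real \<Rightarrow> 'a) \<Rightarrow> 'a::real_vector" where
  "msum a w = (\<Sum>\<psi> | a \<psi> \<noteq> 0. a \<psi> *\<^sub>R w \<psi>)"

lemma msum_superset:
  assumes "finite S" "{\<psi>. a \<psi> \<noteq> 0} \<subseteq> S"
  shows "msum a w = (\<Sum>\<psi>\<in>S. a \<psi> *\<^sub>R w \<psi>)"
  unfolding msum_def using assms by (intro sum.mono_neutral_left) auto

lemma msum_combine:
  assumes "finite {\<psi>. a \<psi> \<noteq> 0}" "finite {\<psi>. b \<psi> \<noteq> 0}" "finite {\<psi>. c \<psi> \<noteq> 0}"
  shows "finite {\<psi>. a \<psi> + b \<psi> - c \<psi> \<noteq> 0}"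
    and "msum (\<lambda>\<psi>. a \<psi> + b \<psi> - c \<psi>) w = msum a w + msum b w - msum c w"
proof -
  define S where "S = {\<psi>. a \<psi> \<noteq> 0} \<union> {\<psi>. b \<psi> \<noteq> 0} \<union> {\<psi>. c \<psi> \<noteq> 0}"
  have S: "finite S" "{\<psi>. a \<psi> \<noteq> 0} \<subseteq> S" "{\<psi>. b \<psi> \<noteq> 0} \<subseteq> S" "{\<psi>. c \<psi> \<noteq> 0} \<subseteq> S"
    "{\<psi>. a \<psi> + b \<psi> - c \<psi> \<noteq> 0} \<subseteq> S"
    using assms by (auto simp: S_def)
  then show "finite {\<psi>. a \<psi> + b \<psi> - c \<psi> \<noteq> 0}"
    using finite_subset by blast
  show "msum (\<lambda>\<psi>. a \<psi> + b \<psi> - c \<psi>) w = msum a w + msum b w - msum c w"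
    unfolding S(2-5)[THEN msum_superset[OF S(1)]]
    by (simp add: sum.distrib sum_subtractf scaleR_add_left scaleR_diff_left)
qed

lemma msum_zero: "msum (\<lambda>_. 0) w = 0"
  by (simp add: msum_def)

lemma msum_linear: "linear f \<Longrightarrow> f (msum a w) = msum a (\<lambda>\<psi>. f (w \<psi>))"
  unfolding msum_def by (simp add: linear_sum linear_cmul)

lemma msum_diff_weights: "msum a (\<lambda>\<psi>. v \<psi> - w \<psi>) = msum a v - msum a w"
  unfolding msum_def by (simp add: sum_subtractf scaleR_diff_right)

text \<open>The function \<open>1 - cos (pi * x)\<close> vanishes to second order at 0, so cutting
  it off on the left keeps it differentiable; there the difference quotient is dominated by that of
  the uncut function.\<close>

lemma DERIV_versine_cutoff:
  "((\<lambda>x. if 0 \<le> x then 1 - cos (pi * x) else 0) has_real_derivative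
     (if 0 \<le> x then pi * sin (pi * x) else 0)) (at x)" (is "(?k has_real_derivative ?k') _")
proof -
  have d: "((\<lambda>x. 1 - cos (pi * x)) has_real_derivative pi * sin (pi * x)) (at x)" for x
    by (auto intro!: derivative_eq_intros)
  consider "x > 0" | "x < 0" | "x = 0"
    by linarith
  then show ?thesis
  proof cases
    case 1
    then have "eventually (\<lambda>y. ?k y = 1 - cos (pi * y)) (nhds x)"
      using eventually_nhds_in_open[of "{0<..}" x] by (auto elim!: eventually_mono)
    then show ?thesis
      using d[of x] 1 DERIV_cong_ev[OF refl _ refl, of ?k "\<lambda>y. 1 - cos (pi * y)" x "pi * sin (pi * x)"]
      by simp
  next
    case 2
    then have "eventually (\<lambda>y. ?k y = 0) (nhds x)"
      using eventually_nhds_in_open[of "{..<0}" x] by (auto elim!: eventually_mono)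
    then show ?thesis
      using 2 DERIV_cong_ev[OF refl _ refl, of ?k "\<lambda>y. 0" x 0] by simp
  next
    case 3
    have "(\<lambda>h. (1 - cos (pi * h)) / h) \<midarrow>0\<rightarrow> 0"
      using d[of 0] by (simp add: DERIV_def)
    then have "(\<lambda>h. ?k h / h) \<midarrow>0\<rightarrow> 0"
      by (rule tendsto_0_le[where K = 1]) (auto intro!: always_eventually divide_nonneg_neg simp: divide_nonneg_neg divide_nonneg_nonpos)
    then show ?thesis
      using 3 by (simp add: DERIV_def cong: if_cong)
  qed
qed

text \<open>Weighted with \<open>1 - cos (pi (\<psi> - \<phi>))\<close>, the part of \<open>d\<close> above \<open>\<phi>\<close> is a function of \<open>\<phi>\<close> that is
  nonincreasing by \<open>nonneg\<close>, and is \<open>\<le> 0\<close> far to the left and \<open>0\<close> far to the right; so it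
  vanishes on the support of \<open>d\<close>.\<close>

lemma sine_transform_nonneg_imp_zero:
  fixes d :: "real \<Rightarrow> real"
  assumes fin: "finite {\<psi>. d \<psi> \<noteq> 0}"
    and nonneg: "\<And>\<phi>. 0 \<le> msum d (\<lambda>\<psi>. if \<phi> \<le> \<psi> then sin (pi * (\<psi> - \<phi>)) else 0)"
    and cis: "msum d (\<lambda>\<psi>. cis (pi * \<psi>)) = 0"
    and total: "msum d (\<lambda>_. 1 :: real) \<le> 0"
  shows "d \<psi> = 0"
proof (rule ccontr)
  assume "d \<psi> \<noteq> 0"
  define S where "S = {\<psi>. d \<psi> \<noteq> 0}"
  have S: "finite S" "S \<noteq> {}"
    using fin \<open>d \<psi> \<noteq> 0\<close> by (auto simp: S_def)
  define k where "k x = (if 0 \<le> x then 1 - cos (pi * x) else 0)" for x :: real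
  define k' where "k' x = (if 0 \<le> x then pi * sin (pi * x) else 0)" for x :: real
  define H where "H \<phi> = (\<Sum>\<psi>\<in>S. d \<psi> * k (\<psi> - \<phi>))" for \<phi>
  have k: "(k has_real_derivative k' x) (at x)" for x
    unfolding k_def k'_def by (rule DERIV_versine_cutoff)
  have "((\<lambda>\<phi>. k (\<psi> - \<phi>)) has_real_derivative - k' (\<psi> - \<phi>)) (at \<phi>)" for \<psi> \<phi>
    by (rule DERIV_chain2[OF k, THEN DERIV_cong]) (auto intro!: derivative_eq_intros)
  then have H: "(H has_real_derivative (\<Sum>\<psi>\<in>S. d \<psi> * - k' (\<psi> - \<phi>))) (at \<phi>)" for \<phi>
    unfolding H_def by (intro DERIV_sum DERIV_cmult)
  have "(\<Sum>\<psi>\<in>S. d \<psi> * - k' (\<psi> - \<phi>))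
      = - (pi * msum d (\<lambda>\<psi>. if \<phi> \<le> \<psi> then sin (pi * (\<psi> - \<phi>)) else 0))" for \<phi>
    unfolding msum_def S_def sum_distrib_left sum_negf[symmetric] k'_def
    by (intro sum.cong) auto
  then have "(\<Sum>\<psi>\<in>S. d \<psi> * - k' (\<psi> - \<phi>)) \<le> 0" for \<phi>
    using nonneg by simp
  then have mono: "H y \<le> H x" if "x \<le> y" for x y
    using that H by (intro DERIV_nonpos_imp_nonincreasing[of x y H]) blast+
  define p where "p = Max S"
  have p: "p \<in> S" "\<And>\<psi>. \<psi> \<in> S \<Longrightarrow> \<psi> \<le> p"
    using S by (auto simp: p_def)
  \<comment> \<open>The next phase of the support below \<open>p\<close>, but at least
    \<open>p - 1\<close>; inserting \<open>p - 1\<close> also keeps the set nonempty when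
    \<open>p\<close> is alone.\<close>
  define q where "q = Max (insert (p - 1) (S - {p}))"
  have q: "q < p" "p - 1 \<le> q" "\<And>\<psi>. \<psi> \<in> S - {p} \<Longrightarrow> \<psi> \<le> q"
  proof -
    have "q \<in> insert (p - 1) (S - {p})"
      unfolding q_def using S by (intro Max_in) auto
    then show "q < p"
      using p(2) by (auto simp: less_le)
  qed (use S in \<open>auto simp: q_def\<close>)
  \<comment> \<open>Strictly between \<open>q\<close> and \<open>p\<close>: the cutoff at
    \<open>r\<close> leaves only the term of \<open>p\<close>, and \<open>p - r < 1\<close> keeps
    the argument of the cosine in \<open>(0, pi)\<close>, so that the coefficient of
    \<open>d p\<close> is positive.\<close>
  define r where "r = (p + q) / 2"
  have r: "q < r" "r < p" "p - r < 1"
    using q(1,2) by (auto simp: r_def field_simps)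
  \<comment> \<open>No point of the support lies left of \<open>m\<close>, so the cutoff is inactive
    there; \<open>m \<le> r\<close> lets monotonicity compare \<open>H m\<close> with
    \<open>H r\<close>.\<close>
  define m where "m = min r (Min S)"
  have m: "m \<le> r" "\<And>\<psi>. \<psi> \<in> S \<Longrightarrow> m \<le> \<psi>"
    using S by (auto simp: m_def min.coboundedI2)
  have "H m = (\<Sum>\<psi>\<in>S. d \<psi> * (1 - cos (pi * (\<psi> - m))))"
    using m by (simp add: H_def k_def)
  \<comment> \<open>The cosine terms form the real part of the vanishing total charge, rotated by
    \<open>- pi * m\<close>.\<close>
  also have "\<dots> = msum d (\<lambda>_. 1) - Re (cis (- pi * m) * msum d (\<lambda>\<psi>. cis (pi * \<psi>)))"
    unfolding msum_def S_def sum_distrib_left Re_sum sum_subtractf[symmetric]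
    by (intro sum.cong refl) (simp add: cis_mult algebra_simps)
  finally have "H m \<le> 0"
    using cis total by simp
  moreover have "H (p + 1) = 0"
    using p(2) by (fastforce simp: H_def k_def intro!: sum.neutral)
  \<comment> \<open>\<open>0 = H (p + 1) \<le> H r \<le> H m \<le> 0\<close>.\<close>
  ultimately have "H r = 0"
    using mono[OF m(1)] mono[of r "p + 1"] r by linarith
  moreover have "H r = d p * (1 - cos (pi * (p - r)))"
  proof -
    have "(\<Sum>\<psi>\<in>S - {p}. d \<psi> * k (\<psi> - r)) = 0"
      using q(3) r by (fastforce simp: k_def intro!: sum.neutral)
    then show ?thesis
      using S p(1) r unfolding H_def by (subst sum.remove[of S p]) (auto simp: k_def)
  qed
  moreover have "cos (pi * (p - r)) < cos 0"
    using r by (intro cos_monotone_0_pi) (auto simp: mult_le_cancel_left1)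
  ultimately show False
    using p(1) by (simp add: S_def)
qed

section \<open>Truncations\<close>

context stability_condition
begin

lemma slice_obj: "X \<in> P \<phi> \<Longrightarrow> X \<in> obj C"
  using slice_additive unfolding full_additive_subcategory_def by blast

lemma slice_iso: "X \<in> P \<phi> \<Longrightarrow> isomorphic C X Y \<Longrightarrow> Y \<in> P \<phi>"
  using slice_additive isomorphic_obj unfolding full_additive_subcategory_def by blast

lemma zero_object_slice:
  assumes "is_zero_object C N"
  shows "N \<in> P \<phi>"
  using slice_additive[of \<phi>] zero_objects_isomorphic[OF _ assms] slice_iso
  unfolding full_additive_subcategory_def by blast

text \<open>Defined by orthogonality, so that closure under extensions is immediate and no uniqueness of HN
  filtrations is needed.\<close>

definition Ge :: "real \<Rightarrow> 'o set" where
  "Ge \<phi> = {X \<in> obj C. \<forall>\<psi><\<phi>. \<forall>Y\<in>P \<psi>. \<forall>f\<in>Mor C X Y. f = hzero C X Y}"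

definition Lt :: "real \<Rightarrow> 'o set" where
  "Lt \<phi> = {Y \<in> obj C. \<forall>X\<in>Ge \<phi>. \<forall>f\<in>Mor C X Y. f = hzero C X Y}"

lemma Ge_obj: "X \<in> Ge \<phi> \<Longrightarrow> X \<in> obj C"
  by (simp add: Ge_def)

lemma Lt_obj: "X \<in> Lt \<phi> \<Longrightarrow> X \<in> obj C"
  by (simp add: Lt_def)

lemma GeD: "\<lbrakk>X \<in> Ge \<phi>; \<psi> < \<phi>; Y \<in> P \<psi>; f \<in> Mor C X Y\<rbrakk> \<Longrightarrow> f = hzero C X Y"
  by (simp add: Ge_def)

lemma Ge_Lt_Mor: "\<lbrakk>X \<in> Ge \<phi>; Y \<in> Lt \<phi>; f \<in> Mor C X Y\<rbrakk> \<Longrightarrow> f = hzero C X Y"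
  by (simp add: Lt_def)

lemma Ge_mono: "\<phi> \<le> \<psi> \<Longrightarrow> X \<in> Ge \<psi> \<Longrightarrow> X \<in> Ge \<phi>"
  by (force simp: Ge_def)

lemma Lt_mono: "\<phi> \<le> \<psi> \<Longrightarrow> X \<in> Lt \<phi> \<Longrightarrow> X \<in> Lt \<psi>"
  using Ge_mono by (force simp: Lt_def)

lemma slice_Ge: "X \<in> P \<psi> \<Longrightarrow> \<phi> \<le> \<psi> \<Longrightarrow> X \<in> Ge \<phi>"
  using slice_obj slice_Mor by (fastforce simp: Ge_def)

lemma slice_Lt: "X \<in> P \<psi> \<Longrightarrow> \<psi> < \<phi> \<Longrightarrow> X \<in> Lt \<phi>"
  using slice_obj by (auto simp: Ge_def Lt_def)

lemma zero_object_Ge: "is_zero_object C N \<Longrightarrow> N \<in> Ge \<phi>"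
  using zero_object_slice slice_Ge by blast

lemma zero_object_Lt: "is_zero_object C N \<Longrightarrow> N \<in> Lt \<phi>"
  using zero_object_slice[of N "\<phi> - 1"] slice_Lt by simp

text \<open>An arrow from \<open>B\<close> to a slice of phase below \<open>\<phi>\<close> dies on
  \<open>A\<close>, hence factors through \<open>D\<close>, where it dies as well.\<close>

lemma Ge_extension:
  assumes t: "exact_triangle C A B D f g h" and "A \<in> Ge \<phi>" "D \<in> Ge \<phi>"
  shows "B \<in> Ge \<phi>"
proof -
  note T = exact_triangleD[OF t]
  have "w = hzero C B Y" if w: "\<psi> < \<phi>" "Y \<in> P \<psi>" "w \<in> Mor C B Y" for \<psi> Y w
  proof -
    have "w \<cdot> f = hzero C A Y"
      using GeD[OF assms(2) w(1,2)] cmp_Mor T w by blast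
    then obtain u where "u \<in> Mor C D Y" "u \<cdot> g = w"
      using exact_extend[OF t w(3)] by blast
    then show ?thesis
      using GeD[OF assms(3) w(1,2)] cmp_hzero_left[OF T(2)] slice_obj[OF w(2)] by auto
  qed
  then show ?thesis
    using T by (auto simp: Ge_def)
qed

text \<open>An arrow from \<open>Ge \<phi>\<close> into \<open>B\<close> dies in \<open>D\<close>,
  hence lifts to \<open>A\<close>, where it dies as well.\<close>

lemma Lt_extension:
  assumes t: "exact_triangle C A B D f g h" and "A \<in> Lt \<phi>" "D \<in> Lt \<phi>"
  shows "B \<in> Lt \<phi>"
proof -
  note T = exact_triangleD[OF t]
  have "w = hzero C X B" if w: "X \<in> Ge \<phi>" "w \<in> Mor C X B" for X w
  proof -
    have "g \<cdot> w = hzero C X D"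
      using Ge_Lt_Mor[OF w(1) assms(3)] cmp_Mor T w by blast
    then obtain u where "u \<in> Mor C X A" "f \<cdot> u = w"
      using exact_lift[OF t w(2)] by blast
    then show ?thesis
      using Ge_Lt_Mor[OF w(1) assms(2)] cmp_hzero_right[OF T(1)] Ge_obj[OF w(1)] by auto
  qed
  then show ?thesis
    using T by (auto simp: Lt_def)
qed

lemma Ge_iso:
  assumes "X \<in> Ge \<phi>" "isomorphic C X Y"
  shows "Y \<in> Ge \<phi>"
proof -
  obtain f g where f: "f \<in> Mor C X Y" "g \<in> Mor C Y X" "f \<cdot> g = ident C Y"
    using assms(2) by (auto simp: isomorphic_def elim: is_isoE)
  have "w = hzero C Y W" if w: "\<psi> < \<phi>" "W \<in> P \<psi>" "w \<in> Mor C Y W" for \<psi> W w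
  proof -
    have "w \<cdot> f = hzero C X W"
      using GeD[OF assms(1) w(1,2)] cmp_Mor f w by blast
    moreover have "w = (w \<cdot> f) \<cdot> g"
      using cmp_assoc[OF f(2,1) w(3)] f(3) cmp_ident_right[OF w(3)] by simp
    ultimately show ?thesis
      using cmp_hzero_left[OF f(2)] slice_obj[OF w(2)] by simp
  qed
  then show ?thesis
    using isomorphic_obj[OF assms(2)] by (auto simp: Ge_def)
qed

section \<open>Slices and their orthogonal classes under the shift\<close>

lemma slice_unshift:
  assumes "Y \<in> P \<psi>"
  obtains Y' where "Y' \<in> P (\<psi> - 1)" "isomorphic C (shift_ob C Y') Y"
proof -
  obtain Y' where Y': "Y' \<in> obj C" "isomorphic C (shift_ob C Y') Y"
    using shift_ess_surj slice_obj assms by blast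
  then have "shift_ob C Y' \<in> P (\<psi> - 1 + 1)"
    using slice_iso assms isomorphic_sym by (metis diff_add_cancel)
  then show thesis
    using slice_shift[OF Y'(1)] that Y' by blast
qed

text \<open>An arrow from \<open>X[1]\<close> into a slice descends to an arrow from
  \<open>X\<close> only after its target is replaced by an isomorphic shift \<open>Y'[1]\<close>, as
  the shift is only essentially surjective; this lowers the phase by one.\<close>

lemma shift_Ge_iff:
  assumes "X \<in> obj C"
  shows "shift_ob C X \<in> Ge (\<phi> + 1) \<longleftrightarrow> X \<in> Ge \<phi>"
proof
  assume X: "shift_ob C X \<in> Ge (\<phi> + 1)"
  have "w = hzero C X Y" if w: "\<psi> < \<phi>" "Y \<in> P \<psi>" "w \<in> Mor C X Y" for \<psi> Y w
    using GeD[OF X _ _ shift_Mor[OF w(3)], of "\<psi> + 1"] w slice_shift slice_obj shift_eq_hzero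
    by auto
  then show "X \<in> Ge \<phi>"
    using assms by (auto simp: Ge_def)
next
  assume X: "X \<in> Ge \<phi>"
  have "w = hzero C (shift_ob C X) Y" if w: "\<psi> < \<phi> + 1" "Y \<in> P \<psi>" "w \<in> Mor C (shift_ob C X) Y"
    for \<psi> Y w
  proof -
    obtain Y' where Y': "Y' \<in> P (\<psi> - 1)" "isomorphic C (shift_ob C Y') Y"
      using slice_unshift[OF w(2)] .
    then obtain f g where f: "f \<in> Mor C (shift_ob C Y') Y" "g \<in> Mor C Y (shift_ob C Y')"
      "f \<cdot> g = ident C Y"
      by (auto simp: isomorphic_def elim: is_isoE)
    obtain v where v: "v \<in> Mor C X Y'" "g \<cdot> w = shift_arr C v"
      using shift_full[OF assms slice_obj[OF Y'(1)] cmp_Mor[OF w(3) f(2)]] .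
    have "v = hzero C X Y'"
      using GeD[OF X _ Y'(1) v(1)] w(1) by simp
    then have "g \<cdot> w = hzero C (shift_ob C X) (shift_ob C Y')"
      using v shift_hzero assms slice_obj[OF Y'(1)] by simp
    moreover have "w = f \<cdot> (g \<cdot> w)"
      using cmp_assoc[OF w(3) f(2,1)] f(3) cmp_ident_left[OF w(3)] by simp
    ultimately show ?thesis
      using cmp_hzero_right[OF f(1)] shift_obj[OF assms] by simp
  qed
  then show "shift_ob C X \<in> Ge (\<phi> + 1)"
    using assms shift_obj by (auto simp: Ge_def)
qed

text \<open>Here it is the source of the test arrow that is replaced by an isomorphic shift.\<close>

lemma shift_Lt:
  assumes "Y \<in> Lt \<phi>"
  shows "shift_ob C Y \<in> Lt (\<phi> + 1)"
proof -
  have Y: "Y \<in> obj C"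
    using assms Lt_obj by blast
  have "w = hzero C X (shift_ob C Y)" if w: "X \<in> Ge (\<phi> + 1)" "w \<in> Mor C X (shift_ob C Y)" for X w
  proof -
    obtain X' where X': "X' \<in> obj C" "isomorphic C (shift_ob C X') X"
      using shift_ess_surj Ge_obj[OF w(1)] by blast
    then obtain f g where f: "f \<in> Mor C (shift_ob C X') X" "g \<in> Mor C X (shift_ob C X')"
      "f \<cdot> g = ident C X"
      by (auto simp: isomorphic_def elim: is_isoE)
    have "X' \<in> Ge \<phi>"
      using shift_Ge_iff[OF X'(1)] Ge_iso[OF w(1)] X'(2) isomorphic_sym by blast
    moreover obtain v where v: "v \<in> Mor C X' Y" "w \<cdot> f = shift_arr C v"
      using shift_full[OF X'(1) Y cmp_Mor[OF f(1) w(2)]] .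
    ultimately have "w \<cdot> f = hzero C (shift_ob C X') (shift_ob C Y)"
      using Ge_Lt_Mor[OF _ assms v(1)] shift_hzero X'(1) Y by simp
    moreover have "w = (w \<cdot> f) \<cdot> g"
      using cmp_assoc[OF f(2,1) w(2)] f(3) cmp_ident_right[OF w(2)] by simp
    ultimately show ?thesis
      using cmp_hzero_left[OF f(2)] shift_obj[OF Y] by simp
  qed
  then show ?thesis
    using shift_obj[OF Y] by (auto simp: Lt_def)
qed

text \<open>The long exact sequence squeezes \<open>Hom(X, A)\<close> between
  \<open>Hom(X, D[-1])\<close> and \<open>Hom(X, B)\<close>. Everything is shifted once so that no
  \<open>D[-1]\<close> has to be chosen: an arrow \<open>X[1] -> A[1]\<close> that dies in
  \<open>B[1]\<close> lifts to \<open>D\<close>.\<close>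

lemma Lt_fibre:
  assumes t: "exact_triangle C A B D f g h" and B: "B \<in> Lt (\<phi> + 1)" and D: "D \<in> Lt \<phi>"
  shows "A \<in> Lt (\<phi> + 1)"
proof -
  note T = exact_triangleD[OF t]
  have "w = hzero C X A" if X: "X \<in> Ge (\<phi> + 1)" and w: "w \<in> Mor C X A" for X w
  proof -
    have o: "X \<in> obj C" "shift_ob C X \<in> obj C" "shift_ob C A \<in> obj C"
      using Ge_obj[OF X] shift_obj T by auto
    have "f \<cdot> w = hzero C X B"
      using Ge_Lt_Mor[OF X B] cmp_Mor w T by blast
    then have "shift_arr C f \<cdot> shift_arr C w = hzero C (shift_ob C X) (shift_ob C B)"
      using shift_cmp[OF w T(1)] shift_hzero o T by simp
    then have "hminus C (shift_arr C f) \<cdot> shift_arr C w = hzero C (shift_ob C X) (shift_ob C B)"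
      using cmp_hminus_left[OF shift_Mor[OF w] shift_Mor[OF T(1)]] hminus_hzero o shift_obj T by simp
    then obtain u where u: "u \<in> Mor C (shift_ob C X) D" "h \<cdot> u = shift_arr C w"
      using exact_lift[OF exact_rotate[OF exact_rotate[OF t]] shift_Mor[OF w]] by blast
    \<comment> \<open>\<open>X[1]\<close> even lies in \<open>Ge (\<phi> + 2)\<close>, well inside
      \<open>Ge \<phi>\<close>.\<close>
    have "shift_ob C X \<in> Ge \<phi>"
      using shift_Ge_iff[OF o(1), of "\<phi> + 1"] X Ge_mono[of \<phi> "\<phi> + 1 + 1"] by simp
    then have "u = hzero C (shift_ob C X) D"
      using Ge_Lt_Mor D u by blast
    then have "shift_arr C w = hzero C (shift_ob C X) (shift_ob C A)"
      using u cmp_hzero_right[OF T(3)] o by simp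
    then show ?thesis
      using shift_eq_hzero w by blast
  qed
  then show ?thesis
    using T by (auto simp: Lt_def)
qed

section \<open>Additivity of the central charge\<close>

lemma charge_exact:
  assumes t: "exact_triangle C A B D f g h"
  shows "charge C Z B = charge C Z A + charge C Z D"
proof -
  note T = exact_triangleD[OF t]
  let ?x = "\<lambda>X. frag_of (iso_class C X)"
  let ?G = "groth_group C (triangles C)"
  have k: "Poly_Mapping.keys (?x A) \<subseteq> iso_class C ` obj C" "Poly_Mapping.keys (?x B) \<subseteq> iso_class C ` obj C"
    "Poly_Mapping.keys (?x D) \<subseteq> iso_class C ` obj C"
    using T by auto
  have k': "Poly_Mapping.keys (?x A + ?x D) \<subseteq> iso_class C ` obj C"
    using k by (intro order_trans[OF keys_add]) (simp del: keys_single)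
  have "(?x A - ?x B + ?x D) \<in> triangle_relations C (triangles C)"
    using t by (intro exact_in_triangle_relations) (auto simp: exact_triangle_def)
  then have "groth_proj C (triangles C) (?x A + ?x D) = groth_proj C (triangles C) (?x B)"
    using groth_proj_eq_iff[OF k' k(2)] by (simp add: algebra_simps)
  then have "groth_class C (triangles C) B = groth_class C (triangles C) A \<otimes>\<^bsub>?G\<^esub> groth_class C (triangles C) D"
    using groth_proj_add[OF k(1,3)] by (simp add: groth_class_def)
  moreover have "groth_class C (triangles C) X \<in> carrier ?G" if "X \<in> obj C" for X
    using that by (auto simp: groth_class_def carrier_groth_group)
  ultimately show ?thesis
    using hom_mult[OF charge_hom] T by (simp add: charge_def complex_group_def)
qed

lemma charge_zero_object:
  assumes "is_zero_object C N"
  shows "charge C Z N = 0"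
  using charge_exact[OF TR1_ident[OF zero_object_obj[OF assms] assms]] by simp

lemma charge_shift:
  assumes "X \<in> obj C"
  shows "charge C Z (shift_ob C X) = - charge C Z X"
proof -
  obtain N where N: "is_zero_object C N"
    using ex_zero_object by blast
  show ?thesis
    using charge_exact[OF exact_rotate[OF TR1_ident[OF assms N]]] charge_zero_object[OF N]
    by (simp add: eq_neg_iff_add_eq_0 add.commute)
qed

section \<open>Truncation triangles\<close>

definition truncation :: "real \<Rightarrow> 'o \<Rightarrow> 'o \<Rightarrow> 'o \<Rightarrow> bool" where
  "truncation \<phi> X U V \<longleftrightarrow> U \<in> Ge \<phi> \<and> V \<in> Lt \<phi> \<and> (\<exists>f g h. exact_triangle C U X V f g h)"

lemma truncation_charge: "truncation \<phi> X U V \<Longrightarrow> charge C Z X = charge C Z U + charge C Z V"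
  unfolding truncation_def using charge_exact by blast

text \<open>The object \<open>I\<close> is the image of the connecting morphism from the degree 0 cohomology of \<open>D\<close> to
  the degree 1 cohomology of \<open>A\<close>, for the t-structure with heart \<open>P [\<phi>, \<phi> + 1)\<close>.\<close>

lemma truncation_defect:
  assumes t: "exact_triangle C A B D f g h"
    and "truncation \<phi> A A\<^sub>1 A\<^sub>2" "truncation \<phi> B B\<^sub>1 B\<^sub>2" "truncation \<phi> D D\<^sub>1 D\<^sub>2"
  obtains I where "I \<in> Ge \<phi>" "I \<in> Lt (\<phi> + 1)"
    "charge C Z I = charge C Z A\<^sub>1 + charge C Z D\<^sub>1 - charge C Z B\<^sub>1"
proof -
  obtain i p s where A: "A\<^sub>1 \<in> Ge \<phi>" "A\<^sub>2 \<in> Lt \<phi>" "exact_triangle C A\<^sub>1 A A\<^sub>2 i p s"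
    using assms(2) unfolding truncation_def by blast
  obtain j q s' where B: "B\<^sub>1 \<in> Ge \<phi>" "B\<^sub>2 \<in> Lt \<phi>" "exact_triangle C B\<^sub>1 B B\<^sub>2 j q s'"
    using assms(3) unfolding truncation_def by blast
  obtain k r s'' where D: "D\<^sub>1 \<in> Ge \<phi>" "D\<^sub>2 \<in> Lt \<phi>" "exact_triangle C D\<^sub>1 D D\<^sub>2 k r s''"
    using assms(4) unfolding truncation_def by blast
  note T = exact_triangleD[OF t] and TA = exact_triangleD[OF A(3)]
    and TB = exact_triangleD[OF B(3)] and TD = exact_triangleD[OF D(3)]
  have fi: "f \<cdot> i \<in> Mor C A\<^sub>1 B"
    using cmp_Mor T TA by blast
  have "q \<cdot> (f \<cdot> i) = hzero C A\<^sub>1 B\<^sub>2"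
    using Ge_Lt_Mor[OF A(1) B(2)] cmp_Mor[OF fi TB(2)] by blast
  then obtain l where l: "l \<in> Mor C A\<^sub>1 B\<^sub>1" "j \<cdot> l = f \<cdot> i"
    using exact_lift[OF B(3) fi] by blast
  \<comment> \<open>\<open>Q\<close> is the cone of \<open>A\<^sub>1 -> B\<close>, an arrow that
    factors both through \<open>A\<close> and through \<open>B\<^sub>1\<close>. The octahedra of the
    two factorizations give \<open>A\<^sub>2 -> Q -> D\<close> and
    \<open>N -> Q -> B\<^sub>2\<close>, with \<open>N\<close> the cone of
    \<open>A\<^sub>1 -> B\<^sub>1\<close>.\<close>
  obtain Q e d where Q: "exact_triangle C A\<^sub>1 B Q (f \<cdot> i) e d"
    using TR1_cone[OF fi] by blast
  obtain a b where ab: "exact_triangle C A\<^sub>2 Q D a b (shift_arr C p \<cdot> h)"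
    using TR4[OF A(3) Q t] by blast
  obtain N m c where N: "exact_triangle C A\<^sub>1 B\<^sub>1 N l m c"
    using TR1_cone[OF l(1)] by blast
  obtain a' b' where ab': "exact_triangle C N Q B\<^sub>2 a' b' (shift_arr C m \<cdot> s')"
    using TR4[OF N Q[folded l(2)] B(3)] by blast
  have shift_Ge: "shift_ob C X \<in> Ge \<phi>" if "X \<in> Ge \<phi>" for X
    using shift_Ge_iff[OF Ge_obj[OF that], of \<phi>] that Ge_mono[of \<phi> "\<phi> + 1"] by simp
  \<comment> \<open>Rotated, the triangle of \<open>N\<close> shows an extension of
    \<open>A\<^sub>1[1]\<close> by \<open>B\<^sub>1\<close>.\<close>
  have N_Ge: "N \<in> Ge \<phi>"
    using Ge_extension[OF exact_rotate[OF N]] B(1) shift_Ge[OF A(1)] by blast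
  have ba: "b \<cdot> a' \<in> Mor C N D"
    using cmp_Mor exact_triangleD[OF ab'] exact_triangleD[OF ab] by blast
  have "r \<cdot> (b \<cdot> a') = hzero C N D\<^sub>2"
    using Ge_Lt_Mor[OF N_Ge D(2)] cmp_Mor[OF ba TD(2)] by blast
  then obtain v where v: "v \<in> Mor C N D\<^sub>1" "k \<cdot> v = b \<cdot> a'"
    using exact_lift[OF D(3) ba] by blast
  \<comment> \<open>\<open>M\<close> is the cone of \<open>N -> Q -> D\<close>; the octahedron makes
    it an extension of \<open>A\<^sub>2[1]\<close> by \<open>B\<^sub>2\<close>, which puts it into
    \<open>Lt (\<phi> + 1)\<close>.\<close>
  obtain M x y where M: "exact_triangle C N D M (b \<cdot> a') x y"
    using TR1_cone[OF ba] by blast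
  obtain z z' z'' where "exact_triangle C B\<^sub>2 M (shift_ob C A\<^sub>2) z z' z''"
    using TR4[OF ab' M exact_rotate[OF ab]] by blast
  then have M_Lt: "M \<in> Lt (\<phi> + 1)"
    using Lt_extension Lt_mono[OF _ B(2), of "\<phi> + 1"] shift_Lt[OF A(2)] by simp
  \<comment> \<open>The arrow \<open>N -> D\<close> also factors through \<open>D\<^sub>1\<close>,
    and \<open>I\<close> is the cone of \<open>N -> D\<^sub>1\<close>. It is the fibre of an arrow
    \<open>M -> D\<^sub>2\<close> and an extension of \<open>N[1]\<close> by
    \<open>D\<^sub>1\<close>; the two descriptions give the two bounds.\<close>
  obtain I n n' where I: "exact_triangle C N D\<^sub>1 I v n n'"
    using TR1_cone[OF v(1)] by blast
  obtain z z' z'' where "exact_triangle C I M D\<^sub>2 z z' z''"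
    using TR4[OF I M[folded v(2)] D(3)] by blast
  then have "I \<in> Lt (\<phi> + 1)"
    using Lt_fibre M_Lt D(2) by blast
  moreover have "I \<in> Ge \<phi>"
    using Ge_extension[OF exact_rotate[OF I]] D(1) shift_Ge[OF N_Ge] by blast
  \<comment> \<open>\<open>Z I = Z D\<^sub>1 - Z N\<close> and
    \<open>Z N = Z B\<^sub>1 - Z A\<^sub>1\<close>.\<close>
  moreover have "charge C Z I = charge C Z A\<^sub>1 + charge C Z D\<^sub>1 - charge C Z B\<^sub>1"
    using charge_exact[OF I] charge_exact[OF N] by simp
  ultimately show thesis
    using that by blast
qed

text \<open>\<open>X -> V\<close> vanishes, so the identity of \<open>V\<close> factors through
  \<open>U[1]\<close>; but \<open>U[1]\<close> is in \<open>Ge \<phi>\<close> and admits only the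
  zero arrow to \<open>V\<close>.\<close>

lemma truncation_Ge:
  assumes X: "X \<in> Ge \<phi>" and "truncation \<phi> X U V"
  shows "is_zero_object C V"
proof -
  obtain f g h where t: "U \<in> Ge \<phi>" "V \<in> Lt \<phi>" "exact_triangle C U X V f g h"
    using assms(2) unfolding truncation_def by blast
  note T = exact_triangleD[OF t(3)]
  have "ident C V \<cdot> g = hzero C X V"
    using Ge_Lt_Mor[OF X t(2) T(2)] cmp_ident_left[OF T(2)] by simp
  then obtain u where u: "u \<in> Mor C (shift_ob C U) V" "u \<cdot> h = ident C V"
    using exact_extend[OF exact_rotate[OF t(3)] ident_Mor[OF T(6)]] by blast
  have "shift_ob C U \<in> Ge \<phi>"
    using shift_Ge_iff[OF Ge_obj[OF t(1)], of \<phi>] t(1) Ge_mono[of \<phi> "\<phi> + 1"] by simp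
  then have "u = hzero C (shift_ob C U) V"
    using Ge_Lt_Mor t(2) u by blast
  then show ?thesis
    using u cmp_hzero_left[OF T(3) T(6)] zero_object_iff T by simp
qed

text \<open>\<open>U -> X\<close> vanishes, so the identity of \<open>U[1]\<close> factors through
  \<open>V\<close>; again \<open>U[1] -> V\<close> can only be zero.\<close>

lemma truncation_Lt:
  assumes X: "X \<in> Lt \<phi>" and "truncation \<phi> X U V"
  shows "is_zero_object C U"
proof -
  obtain f g h where t: "U \<in> Ge \<phi>" "V \<in> Lt \<phi>" "exact_triangle C U X V f g h"
    using assms(2) unfolding truncation_def by blast
  note T = exact_triangleD[OF t(3)]
  have o: "shift_ob C U \<in> obj C" "shift_ob C X \<in> obj C"
    using T shift_obj by auto
  have "f = hzero C U X"
    using Ge_Lt_Mor[OF t(1) X T(1)] .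
  then have "hminus C (shift_arr C f) \<cdot> ident C (shift_ob C U) = hzero C (shift_ob C U) (shift_ob C X)"
    using shift_hzero hminus_hzero o T cmp_hzero_left[OF ident_Mor] by simp
  then obtain u where u: "u \<in> Mor C (shift_ob C U) V" "h \<cdot> u = ident C (shift_ob C U)"
    using exact_lift[OF exact_rotate[OF exact_rotate[OF t(3)]] ident_Mor[OF o(1)]] by blast
  have "shift_ob C U \<in> Ge \<phi>"
    using shift_Ge_iff[OF Ge_obj[OF t(1)], of \<phi>] t(1) Ge_mono[of \<phi> "\<phi> + 1"] by simp
  then have "u = hzero C (shift_ob C U) V"
    using Ge_Lt_Mor t(2) u by blast
  then have "is_zero_object C (shift_ob C U)"
    using u cmp_hzero_right[OF T(3)] zero_object_iff o by simp
  then show ?thesis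
    using shift_zero_object_iff T by blast
qed

section \<open>Charges and truncations computed from HN filtrations\<close>

lemma HN_filtration_truncate:
  assumes "HN_filtration C P X n E Y \<phi>"
  shows "HN_filtration C P (E m) m E Y \<phi> \<or> n < m"
  using assms unfolding HN_filtration_def by force

lemma HN_filtration_obj:
  assumes "HN_filtration C P X n E Y \<phi>"
  shows "X \<in> obj C"
proof (cases n)
  case 0
  then show ?thesis
    using assms zero_object_obj by (auto simp: HN_filtration_def)
next
  case (Suc m)
  then obtain f g h where "exact_triangle C (E m) (E (Suc m)) (Y m) f g h"
    using assms by (force simp: HN_filtration_def)
  then show ?thesis
    using assms Suc exact_triangleD by (auto simp: HN_filtration_def)
qed

lemma HN_filtration_Ge:
  assumes "HN_filtration C P X n E Y \<phi>" "\<And>i. i < n \<Longrightarrow> \<psi> \<le> \<phi> i"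
  shows "X \<in> Ge \<psi>"
  using assms
proof (induction n arbitrary: X)
  case 0
  then show ?case
    using zero_object_Ge by (auto simp: HN_filtration_def)
next
  case (Suc n)
  have "E n \<in> Ge \<psi>"
    using Suc HN_filtration_truncate[OF Suc.prems(1), of n] by simp
  moreover obtain f g h where "exact_triangle C (E n) X (Y n) f g h" "Y n \<in> P (\<phi> n)"
    using Suc.prems(1) by (fastforce simp: HN_filtration_def)
  ultimately show ?case
    using Ge_extension slice_Ge Suc.prems(2) by blast
qed

lemma HN_filtration_charge:
  assumes "HN_filtration C P X n E Y \<phi>"
  shows "charge C Z X = (\<Sum>i<n. charge C Z (Y i))"
  using assms
proof (induction n arbitrary: X)
  case 0
  then show ?case
    using charge_zero_object by (auto simp: HN_filtration_def)
next
  case (Suc n)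
  have "charge C Z (E n) = (\<Sum>i<n. charge C Z (Y i))"
    using Suc HN_filtration_truncate[OF Suc.prems(1), of n] by simp
  moreover obtain f g h where "exact_triangle C (E n) X (Y n) f g h"
    using Suc.prems(1) by (fastforce simp: HN_filtration_def)
  ultimately show ?case
    using charge_exact by auto
qed

text \<open>Phases decrease along the filtration, so the factors of phase at least
  \<open>\<psi>\<close> come first. If the last factor is among them, \<open>X\<close> is its own
  truncation; otherwise \<open>U\<close> is inherited from \<open>E n\<close>, and the octahedron of
  \<open>U -> E n -> X\<close> makes the new \<open>V'\<close> an extension of \<open>Y n\<close> by
  \<open>V\<close>.\<close>

lemma HN_filtration_truncation:
  assumes "HN_filtration C P X n E Y \<phi>"
  shows "\<exists>U V. truncation \<psi> X U V \<and>
    charge C Z U = (\<Sum>i<n. if \<psi> \<le> \<phi> i then charge C Z (Y i) else 0)"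
  using assms
proof (induction n arbitrary: X)
  case 0
  then have "is_zero_object C X"
    by (auto simp: HN_filtration_def)
  then have "truncation \<psi> X X X"
    using zero_object_Ge zero_object_Lt TR1_ident zero_object_obj unfolding truncation_def by blast
  then show ?case
    using charge_zero_object \<open>is_zero_object C X\<close> by auto
next
  case (Suc n)
  show ?case
  proof (cases "\<psi> \<le> \<phi> n")
    case True
    have *: "\<psi> \<le> \<phi> i" if "i < Suc n" for i
    proof (cases "i = n")
      case False
      then have "\<phi> n < \<phi> i"
        using Suc.prems that unfolding HN_filtration_def by auto
      then show ?thesis
        using True by simp
    qed (use True in simp)
    obtain N where N: "is_zero_object C N"
      using ex_zero_object by blast
    have "truncation \<psi> X X N"
      unfolding truncation_def
      using HN_filtration_Ge[OF Suc.prems *] zero_object_Lt[OF N]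
        TR1_ident[OF HN_filtration_obj[OF Suc.prems] N] by blast
    moreover have "charge C Z X = (\<Sum>i<Suc n. if \<psi> \<le> \<phi> i then charge C Z (Y i) else 0)"
      unfolding HN_filtration_charge[OF Suc.prems] by (rule sum.cong) (simp_all add: *)
    ultimately show ?thesis
      by blast
  next
    case False
    have "HN_filtration C P (E n) n E Y \<phi>"
      using HN_filtration_truncate[OF Suc.prems, of n] by simp
    then obtain U V where UV: "truncation \<psi> (E n) U V"
      "charge C Z U = (\<Sum>i<n. if \<psi> \<le> \<phi> i then charge C Z (Y i) else 0)"
      using Suc.IH by blast
    then obtain f g h where t: "U \<in> Ge \<psi>" "V \<in> Lt \<psi>" "exact_triangle C U (E n) V f g h"
      unfolding truncation_def by blast
    obtain f' g' h' where t': "exact_triangle C (E n) X (Y n) f' g' h'" "Y n \<in> P (\<phi> n)"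
      using Suc.prems by (fastforce simp: HN_filtration_def)
    obtain V' x y where V': "exact_triangle C U X V' (f' \<cdot> f) x y"
      using TR1_cone cmp_Mor exact_triangleD[OF t(3)] exact_triangleD[OF t'(1)] by blast
    obtain a b c where "exact_triangle C V V' (Y n) a b c"
      using TR4[OF t(3) V' t'(1)] by blast
    then have "V' \<in> Lt \<psi>"
      using Lt_extension t(2) slice_Lt[OF t'(2)] False by force
    then have "truncation \<psi> X U V'"
      unfolding truncation_def using V' t(1) by blast
    then show ?thesis
      using UV(2) False by auto
  qed
qed

end

section \<open>Mass by phase\<close>

text \<open>Translates between sums over HN factors and sums over phases: \<open>a\<close> is the
  image of the weights \<open>c\<close> under \<open>\<phi>\<close>, where several indices may share
  a phase.\<close>

lemma msum_fibres:
  fixes n :: nat and c :: "nat \<Rightarrow> real" and \<phi> :: "nat \<Rightarrow> real"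
  defines "a \<equiv> \<lambda>\<psi>. \<Sum>i | i < n \<and> \<phi> i = \<psi>. c i"
  shows "finite {\<psi>. a \<psi> \<noteq> 0}" "msum a w = (\<Sum>i<n. c i *\<^sub>R w (\<phi> i))"
proof -
  have sub: "{\<psi>. a \<psi> \<noteq> 0} \<subseteq> \<phi> ` {..<n}"
    by (auto simp: a_def elim!: sum.not_neutral_contains_not_neutral)
  then show "finite {\<psi>. a \<psi> \<noteq> 0}"
    using finite_subset by blast
  have "msum a w = (\<Sum>\<psi>\<in>\<phi> ` {..<n}. a \<psi> *\<^sub>R w \<psi>)"
    using sub by (intro msum_superset) auto
  also have "\<dots> = (\<Sum>\<psi>\<in>\<phi> ` {..<n}. \<Sum>i | i \<in> {..<n} \<and> \<phi> i = \<psi>. c i *\<^sub>R w (\<phi> i))"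
    by (intro sum.cong) (auto simp: a_def scaleR_left.sum)
  also have "\<dots> = (\<Sum>i<n. c i *\<^sub>R w (\<phi> i))"
    by (rule sum.image_gen[symmetric]) simp
  finally show "msum a w = (\<Sum>i<n. c i *\<^sub>R w (\<phi> i))" .
qed

lemma linear_Im_mult: "linear (\<lambda>z. Im (c * z))"
  by (simp add: linear_iff algebra_simps)

context stability_condition
begin

text \<open>A relation, because the independence of \<open>a\<close> from the HN filtration is only obtained in
  \<open>spectrum_unique\<close>.\<close>

definition spectrum :: "'o \<Rightarrow> (real \<Rightarrow> real) \<Rightarrow> bool" where
  "spectrum X a \<longleftrightarrow> (\<exists>n E Y \<phi>. HN_filtration C P X n E Y \<phi> \<and>
     a = (\<lambda>\<psi>. \<Sum>i | i < n \<and> \<phi> i = \<psi>. cmod (charge C Z (Y i))))"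

lemma spectrumE:
  assumes "spectrum X a"
  obtains n E Y \<phi> where "HN_filtration C P X n E Y \<phi>"
    "a = (\<lambda>\<psi>. \<Sum>i | i < n \<and> \<phi> i = \<psi>. cmod (charge C Z (Y i)))"
  using assms unfolding spectrum_def by blast

lemma charge_polar:
  assumes "X \<in> P \<phi>"
  shows "charge C Z X = cmod (charge C Z X) *\<^sub>R cis (pi * \<phi>)"
proof (cases "is_zero_object C X")
  case True
  then show ?thesis
    by (simp add: charge_zero_object)
next
  case False
  then obtain r where "r > 0" "charge C Z X = complex_of_real r * cis (pi * \<phi>)"
    using charge_slice[OF assms] by (auto simp: charge_def)
  then show ?thesis
    by (simp add: norm_mult scaleR_conv_of_real)
qed

lemma charge_slice_pos:
  assumes "X \<in> P \<phi>" "\<not> is_zero_object C X"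
  shows "0 < cmod (charge C Z X)"
  using charge_slice[OF assms] by (auto simp: charge_def norm_mult)

lemma spectrum_finite: "spectrum X a \<Longrightarrow> finite {\<psi>. a \<psi> \<noteq> 0}"
  by (elim spectrumE) (simp add: msum_fibres)

lemma spectrum_nonneg: "spectrum X a \<Longrightarrow> 0 \<le> a \<psi>"
  by (elim spectrumE) (simp add: sum_nonneg)

lemma HN_filtration_slice: "HN_filtration C P X n E Y \<phi> \<Longrightarrow> i < n \<Longrightarrow> Y i \<in> P (\<phi> i)"
  by (simp add: HN_filtration_def)

lemma spectrum_truncation:
  assumes "spectrum X a"
  shows "\<exists>U V. truncation \<psi> X U V \<and>
    charge C Z U = msum a (\<lambda>x. if \<psi> \<le> x then cis (pi * x) else 0)"
proof -
  obtain n E Y \<phi> where hn: "HN_filtration C P X n E Y \<phi>"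
    and a: "a = (\<lambda>\<psi>. \<Sum>i | i < n \<and> \<phi> i = \<psi>. cmod (charge C Z (Y i)))"
    using assms by (rule spectrumE)
  have "msum a (\<lambda>x. if \<psi> \<le> x then cis (pi * x) else 0)
      = (\<Sum>i<n. if \<psi> \<le> \<phi> i then charge C Z (Y i) else 0)"
    unfolding a msum_fibres
    by (intro sum.cong) (auto simp: charge_polar[OF HN_filtration_slice[OF hn], symmetric])
  then show ?thesis
    using HN_filtration_truncation[OF hn] by auto
qed

lemma spectrum_charge:
  assumes "spectrum X a"
  shows "charge C Z X = msum a (\<lambda>x. cis (pi * x))"
proof -
  obtain n E Y \<phi> where hn: "HN_filtration C P X n E Y \<phi>"
    and a: "a = (\<lambda>\<psi>. \<Sum>i | i < n \<and> \<phi> i = \<psi>. cmod (charge C Z (Y i)))"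
    using assms by (rule spectrumE)
  show ?thesis
    unfolding a msum_fibres HN_filtration_charge[OF hn]
    by (intro sum.cong) (auto simp: charge_polar[OF HN_filtration_slice[OF hn], symmetric])
qed

lemma spectrum_zero_object: "is_zero_object C N \<Longrightarrow> spectrum N (\<lambda>_. 0)"
  unfolding spectrum_def HN_filtration_def
  by (intro exI[of _ 0] exI[of _ "\<lambda>_. N"]) auto

lemma spectrum_exists:
  assumes "X \<in> obj C"
  shows "\<exists>a. spectrum X a"
  using assms spectrum_zero_object ex_HN[of X] unfolding spectrum_def by metis

lemma spectrum_obj: "spectrum X a \<Longrightarrow> X \<in> obj C"
  by (elim spectrumE) (rule HN_filtration_obj)

text \<open>The HN phases of \<open>X\<close> are not known to lie in the interval, but as far as
  charges go its truncation at \<open>\<phi>\<close> is everything and the one at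
  \<open>\<phi> + 1\<close> nothing. The difference of the two truncated sums keeps the phases in
  \<open>[\<phi>, \<phi> + 1)\<close>, where the sine is nonnegative.\<close>

lemma charge_interval_nonneg:
  assumes "X \<in> Ge \<phi>" "X \<in> Lt (\<phi> + 1)"
  shows "0 \<le> Im (cis (- (pi * \<phi>)) * charge C Z X)"
proof -
  obtain a where a: "spectrum X a"
    using spectrum_exists Ge_obj assms by blast
  let ?w = "\<lambda>\<phi> x. if \<phi> \<le> x then cis (pi * x) else 0"
  obtain U V where UV: "truncation \<phi> X U V" "charge C Z U = msum a (?w \<phi>)"
    using spectrum_truncation[OF a] by blast
  obtain U' V' where UV': "truncation (\<phi> + 1) X U' V'" "charge C Z U' = msum a (?w (\<phi> + 1))"
    using spectrum_truncation[OF a] by blast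
  have "charge C Z X = msum a (?w \<phi>)"
    using truncation_charge[OF UV(1)] UV(2) truncation_Ge[OF assms(1) UV(1)] charge_zero_object by simp
  also have "\<dots> = msum a (?w \<phi>) - msum a (?w (\<phi> + 1))"
    using UV'(2) truncation_Lt[OF assms(2) UV'(1)] charge_zero_object by simp
  also have "\<dots> = msum a (\<lambda>x. ?w \<phi> x - ?w (\<phi> + 1) x)"
    by (simp add: msum_diff_weights)
  finally have "Im (cis (- (pi * \<phi>)) * charge C Z X)
      = Im (cis (- (pi * \<phi>)) * msum a (\<lambda>x. ?w \<phi> x - ?w (\<phi> + 1) x))"
    by simp
  also have "\<dots> = msum a (\<lambda>x. Im (cis (- (pi * \<phi>)) * (?w \<phi> x - ?w (\<phi> + 1) x)))"
    by (rule msum_linear[OF linear_Im_mult])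
  also have "\<dots> \<ge> 0"
    unfolding msum_def
  proof (intro sum_nonneg)
    fix x
    have "0 \<le> Im (cis (- (pi * \<phi>)) * (?w \<phi> x - ?w (\<phi> + 1) x))"
    proof (cases "\<phi> \<le> x \<and> x < \<phi> + 1")
      case True
      then have "Im (cis (- (pi * \<phi>)) * (?w \<phi> x - ?w (\<phi> + 1) x)) = sin (pi * (x - \<phi>))"
        by (simp add: cis_mult right_diff_distrib)
      also have "\<dots> \<ge> 0"
        using True by (intro sin_ge_zero) (auto simp: mult_le_cancel_left1)
      finally show ?thesis .
    qed auto
    then show "0 \<le> a x *\<^sub>R Im (cis (- (pi * \<phi>)) * (?w \<phi> x - ?w (\<phi> + 1) x))"
      using spectrum_nonneg[OF a] by simp
  qed
  finally show ?thesis .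
qed

text \<open>\<open>le\<close> is the reverse of the triangle inequality for masses; against the sine
  inequalities at every \<open>\<phi>\<close> it leaves no room for a defect \<open>d\<close>. It is
  stated with totals of given spectra because \<open>mass\<close> is not yet known to be well
  defined.\<close>

lemma spectrum_exact:
  assumes t: "exact_triangle C A B D f g h"
    and a: "spectrum A a" and b: "spectrum B b" and c: "spectrum D c"
    and le: "msum a (\<lambda>_. 1) + msum c (\<lambda>_. 1) \<le> msum b (\<lambda>_. 1 :: real)"
  shows "b \<psi> = a \<psi> + c \<psi>"
proof -
  define d where "d x = a x + c x - b x" for x
  note d = msum_combine[OF a[THEN spectrum_finite] c[THEN spectrum_finite] b[THEN spectrum_finite],
      folded d_def]
  have "0 \<le> msum d (\<lambda>x. if \<phi> \<le> x then sin (pi * (x - \<phi>)) else 0)" for \<phi>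
  proof -
    let ?w = "\<lambda>x. if \<phi> \<le> x then cis (pi * x) else 0"
    obtain A\<^sub>1 A\<^sub>2 where A: "truncation \<phi> A A\<^sub>1 A\<^sub>2" "charge C Z A\<^sub>1 = msum a ?w"
      using spectrum_truncation[OF a] by blast
    obtain B\<^sub>1 B\<^sub>2 where B: "truncation \<phi> B B\<^sub>1 B\<^sub>2" "charge C Z B\<^sub>1 = msum b ?w"
      using spectrum_truncation[OF b] by blast
    obtain D\<^sub>1 D\<^sub>2 where D: "truncation \<phi> D D\<^sub>1 D\<^sub>2" "charge C Z D\<^sub>1 = msum c ?w"
      using spectrum_truncation[OF c] by blast
    obtain I where I: "I \<in> Ge \<phi>" "I \<in> Lt (\<phi> + 1)"
      "charge C Z I = charge C Z A\<^sub>1 + charge C Z D\<^sub>1 - charge C Z B\<^sub>1"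
      using truncation_defect[OF t A(1) B(1) D(1)] .
    \<comment> \<open>The truncated sum of \<open>d\<close> is the charge of
      \<open>I\<close>.\<close>
    have "0 \<le> Im (cis (- (pi * \<phi>)) * msum d ?w)"
      using charge_interval_nonneg[OF I(1,2)] by (simp add: I(3) A(2) B(2) D(2) d(2))
    also have "\<dots> = msum d (\<lambda>x. Im (cis (- (pi * \<phi>)) * ?w x))"
      by (rule msum_linear[OF linear_Im_mult])
    also have "(\<lambda>x. Im (cis (- (pi * \<phi>)) * ?w x)) = (\<lambda>x. if \<phi> \<le> x then sin (pi * (x - \<phi>)) else 0)"
      by (simp add: fun_eq_iff right_diff_distrib sin_diff mult.commute)
    finally show ?thesis .
  qed
  moreover have "msum d (\<lambda>x. cis (pi * x)) = 0"
    using spectrum_charge[OF a] spectrum_charge[OF b] spectrum_charge[OF c] charge_exact[OF t] by (simp add: d(2))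
  moreover have "msum d (\<lambda>_. 1 :: real) \<le> 0"
    using le by (simp add: d(2))
  ultimately have "d \<psi> = 0"
    using d(1) by (intro sine_transform_nonneg_imp_zero[of d]) auto
  then show ?thesis
    by (simp add: d_def)
qed

text \<open>The larger of the two totals is put in the middle of \<open>X -> X -> 0\<close>, so that
  the hypothesis \<open>le\<close> of \<open>spectrum_exact\<close> holds.\<close>

lemma spectrum_unique:
  assumes a: "spectrum X a" and b: "spectrum X b"
  shows "a = b"
proof -
  obtain N where N: "is_zero_object C N"
    using ex_zero_object by blast
  note t = TR1_ident[OF spectrum_obj[OF a] N] and z = spectrum_zero_object[OF N]
  show ?thesis
    using spectrum_exact[OF t a b z] spectrum_exact[OF t b a z]
    by (cases "msum a (\<lambda>_. 1 :: real) \<le> msum b (\<lambda>_. 1)") (auto simp: msum_zero fun_eq_iff)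
qed

text \<open>The definite description in \<open>mass\<close> denotes because every HN filtration sums
  to the total of the one spectrum of \<open>X\<close>.\<close>

lemma mass_HN_filtration:
  assumes hn: "HN_filtration C P X n E Y \<phi>"
  shows "mass C P Z X = (\<Sum>i<n. cmod (charge C Z (Y i)))"
proof -
  have total: "msum a (\<lambda>_. 1) = (\<Sum>i<n. cmod (charge C Z (Y i)))"
    if "HN_filtration C P X n E Y \<phi>" "spectrum X a" for n E Y \<phi> a
  proof -
    have "spectrum X (\<lambda>\<psi>. \<Sum>i | i < n \<and> \<phi> i = \<psi>. cmod (charge C Z (Y i)))"
      using that(1) unfolding spectrum_def by blast
    then show ?thesis
      using spectrum_unique[OF that(2)] by (simp add: msum_fibres)
  qed
  obtain a where a: "spectrum X a"
    using spectrum_exists HN_filtration_obj hn by blast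
  show ?thesis
  proof (cases "is_zero_object C X")
    case True
    then have "a = (\<lambda>_. 0)"
      using spectrum_unique[OF a] spectrum_zero_object by blast
    then show ?thesis
      using total[OF hn a] True by (simp add: mass_def msum_zero)
  next
    case False
    then show ?thesis
      unfolding mass_def if_not_P[OF False]
      by (intro the_equality) (use total a hn in metis)+
  qed
qed

lemma mass_spectrum:
  assumes "spectrum X a"
  shows "mass C P Z X = msum a (\<lambda>_. 1)"
  using assms by (elim spectrumE) (simp add: mass_HN_filtration msum_fibres)

lemma thin_trianglesI:
  assumes "exact_triangle C A B D f g h" "mass C P Z B = mass C P Z A + mass C P Z D"
  shows "(f, g, h) \<in> thin_triangles C P Z"
  using assms unfolding thin_triangles_def by blast

lemma thin_spectrum:
  assumes t: "exact_triangle C A B D f g h" and thin: "(f, g, h) \<in> thin_triangles C P Z"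
    and "spectrum A a" "spectrum B b" "spectrum D c"
  shows "b \<psi> = a \<psi> + c \<psi>"
proof -
  obtain A' B' D' where t': "exact_triangle C A' B' D' f g h"
    and m: "mass C P Z B' = mass C P Z A' + mass C P Z D'"
    using thin unfolding thin_triangles_def by blast
  \<comment> \<open>Arrows carry their source and target, so the vertices hidden in
    \<open>thin_triangles\<close> are those of \<open>t\<close>.\<close>
  have "A' = A" "B' = B" "D' = D"
    using exact_triangleD(1,2)[OF t] exact_triangleD(1,2)[OF t'] by (auto simp: Mor_def)
  then show ?thesis
    using spectrum_exact[OF t assms(3-5)] m assms(3-5)[THEN mass_spectrum] by simp
qed

section \<open>Thin triangles inside a slice and along an HN filtration\<close>

lemma slice_HN_filtration:
  assumes "X \<in> P \<phi>" "is_zero_object C N"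
  shows "HN_filtration C P X 1 (\<lambda>i. if i = 0 then N else X) (\<lambda>_. X) (\<lambda>_. \<phi>)"
  unfolding HN_filtration_def using assms exact_zero_left[OF slice_obj[OF assms(1)] assms(2)] by auto

lemma slice_spectrum:
  assumes "X \<in> P \<phi>"
  shows "spectrum X (\<lambda>\<psi>. if \<psi> = \<phi> then cmod (charge C Z X) else 0)"
proof -
  obtain N where "is_zero_object C N"
    using ex_zero_object by blast
  moreover have "(\<Sum>i | i < Suc 0 \<and> \<phi> = \<psi>. cmod (charge C Z X)) = (if \<psi> = \<phi> then cmod (charge C Z X) else 0)" for \<psi>
    by auto
  ultimately show ?thesis
    using slice_HN_filtration[OF assms] unfolding spectrum_def by fastforce
qed

lemma slice_mass: "X \<in> P \<phi> \<Longrightarrow> mass C P Z X = cmod (charge C Z X)"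
  using slice_HN_filtration ex_zero_object mass_HN_filtration by fastforce

text \<open>The three charges lie on one ray, where the modulus is additive.\<close>

lemma slice_triangle_charge:
  assumes t: "exact_triangle C A B D f g h" and "A \<in> P \<phi>" "B \<in> P \<phi>" "D \<in> P \<phi>"
  shows "cmod (charge C Z B) = cmod (charge C Z A) + cmod (charge C Z D)"
proof -
  have "cmod (charge C Z B) *\<^sub>R cis (pi * \<phi>) = (cmod (charge C Z A) + cmod (charge C Z D)) *\<^sub>R cis (pi * \<phi>)"
    using charge_exact[OF t] assms(2-4)[THEN charge_polar] by (simp add: scaleR_add_left)
  then show ?thesis
    by (metis scaleR_cancel_right cis_neq_zero)
qed

lemma slice_triangle_thin:
  assumes t: "exact_triangle C A B D f g h" and "A \<in> P \<phi>" "B \<in> P \<phi>" "D \<in> P \<phi>"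
  shows "(f, g, h) \<in> thin_triangles C P Z"
  using thin_trianglesI[OF t] slice_triangle_charge[OF assms] assms(2-4)[THEN slice_mass] by simp

text \<open>The masses of the stages \<open>E m\<close> are the partial sums of the masses of the
  factors.\<close>

lemma HN_triangle_thin:
  assumes hn: "HN_filtration C P X n E Y \<phi>" and "i < n"
    and t: "exact_triangle C (E i) (E (Suc i)) (Y i) f g h"
  shows "(f, g, h) \<in> thin_triangles C P Z"
proof -
  have "mass C P Z (E m) = (\<Sum>i<m. cmod (charge C Z (Y i)))" if "m \<le> n" for m
    using mass_HN_filtration HN_filtration_truncate[OF hn, of m] that by auto
  then show ?thesis
    using thin_trianglesI[OF t] slice_mass[OF HN_filtration_slice[OF hn \<open>i < n\<close>]] \<open>i < n\<close> by simp
qed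

text \<open>Phases move up by one and charges only change sign, so the moduli are kept.\<close>

lemma shift_spectrum:
  assumes "spectrum X a"
  shows "spectrum (shift_ob C X) (\<lambda>\<psi>. a (\<psi> - 1))"
proof -
  obtain n E Y \<phi> where hn: "HN_filtration C P X n E Y \<phi>"
    and a: "a = (\<lambda>\<psi>. \<Sum>i | i < n \<and> \<phi> i = \<psi>. cmod (charge C Z (Y i)))"
    using assms by (rule spectrumE)
  have Y: "Y i \<in> obj C" if "i < n" for i
    using slice_obj HN_filtration_slice[OF hn that] by blast
  have "HN_filtration C P (shift_ob C X) n (\<lambda>i. shift_ob C (E i)) (\<lambda>i. shift_ob C (Y i)) (\<lambda>i. \<phi> i + 1)"
    using hn exact_shift Y slice_shift shift_zero_object_iff zero_object_obj
    unfolding HN_filtration_def by (metis add_less_cancel_right)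
  moreover have "a (\<psi> - 1) = (\<Sum>i | i < n \<and> \<phi> i + 1 = \<psi>. cmod (charge C Z (shift_ob C (Y i))))" for \<psi>
    unfolding a using charge_shift Y by (intro sum.cong) auto
  ultimately show ?thesis
    unfolding spectrum_def by blast
qed

end

section \<open>Integral powers of the shift\<close>

text \<open>The shape of \<open>groth_shift_power\<close> for an arbitrary set: powers of the shift
  on classes, on formal sums and on the quotient follow from one set of lemmas. Negative powers are
  meaningful on \<open>K\<close> only, where \<open>inv_into\<close> is an inverse.\<close>

definition bij_power :: "'a set \<Rightarrow> ('a \<Rightarrow> 'a) \<Rightarrow> int \<Rightarrow> 'a \<Rightarrow> 'a" where
  "bij_power K f n = (if n \<ge> 0 then f ^^ nat n else inv_into K f ^^ nat (- n))"

lemma bij_power_0 [simp]: "bij_power K f 0 x = x"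
  by (simp add: bij_power_def)

lemma bij_power_closed:
  assumes "bij_betw f K K" "x \<in> K"
  shows "bij_power K f n x \<in> K"
proof -
  have "(g ^^ m) x \<in> K" if "bij_betw g K K" for g m
    using bij_betw_funpow[OF that, of m] assms(2) by (auto simp: bij_betw_def)
  then show ?thesis
    using assms(1) bij_betw_inv_into[OF assms(1)] by (auto simp: bij_power_def)
qed

lemma bij_power_Suc:
  assumes "bij_betw f K K" "x \<in> K"
  shows "bij_power K f (n + 1) x = f (bij_power K f n x)"
proof -
  \<comment> \<open>At \<open>n = - 1\<close> the exponent crosses from iterates of the inverse to
    iterates of \<open>f\<close>; below it, one factor of the inverse is cancelled.\<close>
  consider "n \<ge> 0" | "n = - 1" | "n \<le> - 2"
    by linarith
  then show ?thesis
  proof cases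
    case 1
    then show ?thesis
      by (simp add: bij_power_def nat_add_distrib)
  next
    case 2
    then show ?thesis
      using assms by (simp add: bij_power_def bij_betw_inv_into_right)
  next
    case 3
    define m where "m = nat (- (n + 1))"
    have m: "nat (- n) = Suc m"
      using 3 by (simp add: m_def)
    have "(inv_into K f ^^ m) x \<in> K"
      using bij_power_closed[OF assms, of "n + 1"] 3 by (simp add: bij_power_def m_def)
    then have "f ((inv_into K f ^^ Suc m) x) = (inv_into K f ^^ m) x"
      using bij_betw_inv_into_right[OF assms(1)] by simp
    then show ?thesis
      using 3 m by (simp add: bij_power_def m_def)
  qed
qed

lemma bij_power_pred:
  assumes "bij_betw f K K" "x \<in> K"
  shows "f (bij_power K f (n - 1) x) = bij_power K f n x"
  using bij_power_Suc[OF assms, of "n - 1"] by simp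

text \<open>Commutation is assumed for \<open>f\<close> itself; for negative powers one application
  of \<open>g\<close>, injective on \<open>L\<close>, is cancelled at each step down.\<close>

lemma bij_power_equivariant:
  assumes f: "bij_betw f K K" and g: "bij_betw g L L" and h: "h \<in> K \<rightarrow> L"
    and fg: "\<And>x. x \<in> K \<Longrightarrow> h (f x) = g (h x)" and x: "x \<in> K"
  shows "h (bij_power K f n x) = bij_power L g n (h x)"
proof (induction n rule: int_induct[of _ 0])
  case base
  show ?case by simp
next
  case (step1 i)
  then show ?case
    using bij_power_Suc[OF f x] bij_power_Suc[OF g] bij_power_closed[OF f x] fg h x by (simp add: Pi_iff)
next
  case (step2 i)
  have hx: "h x \<in> L"
    using h x by blast
  have "g (h (bij_power K f (i - 1) x)) = h (bij_power K f i x)"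
    using fg[OF bij_power_closed[OF f x], of "i - 1"] bij_power_pred[OF f x, of i] by simp
  also have "\<dots> = g (bij_power L g (i - 1) (h x))"
    using step2 bij_power_pred[OF g hx] by simp
  finally show ?case
    using bij_betw_imp_inj_on[OF g] bij_power_closed[OF f x] bij_power_closed[OF g hx] h
    by (auto dest: inj_onD)
qed

lemma bij_power_add:
  assumes f: "bij_betw f K K" and x: "x \<in> K"
  shows "bij_power K f (m + n) x = bij_power K f m (bij_power K f n x)"
proof (induction m rule: int_induct[of _ 0])
  case base
  show ?case by simp
next
  case (step1 i)
  then show ?case
    using bij_power_Suc[OF f x, of "i + n"] bij_power_Suc[OF f bij_power_closed[OF f x], of i n]
    by (simp add: algebra_simps)
next
  case (step2 i)
  then have "f (bij_power K f (i - 1 + n) x) = f (bij_power K f (i - 1) (bij_power K f n x))"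
    using bij_power_pred[OF f x, of "i + n"] bij_power_pred[OF f bij_power_closed[OF f x], of i n]
    by (simp add: algebra_simps)
  then show ?case
    using bij_betw_imp_inj_on[OF f] bij_power_closed[OF f] x by (auto dest: inj_onD)
qed

section \<open>Functoriality of free abelian groups\<close>

definition frag_map :: "('a \<Rightarrow> 'b) \<Rightarrow> ('a \<Rightarrow>\<^sub>0 int) \<Rightarrow> ('b \<Rightarrow>\<^sub>0 int)" where
  "frag_map f = frag_extend (\<lambda>c. frag_of (f c))"

lemma frag_map_add: "frag_map f (x + y) = frag_map f x + frag_map f y"
  by (simp add: frag_map_def frag_extend_add)

lemma frag_map_diff: "frag_map f (x - y) = frag_map f x - frag_map f y"
  by (simp add: frag_map_def frag_extend_diff)

lemma frag_map_of [simp]: "frag_map f (frag_of c) = frag_of (f c)"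
  by (simp add: frag_map_def)

lemma frag_map_zero [simp]: "frag_map f 0 = 0"
  by (simp add: frag_map_def)

lemma keys_frag_map: "Poly_Mapping.keys (frag_map f x) \<subseteq> f ` Poly_Mapping.keys x"
  unfolding frag_map_def using keys_frag_extend by fastforce

lemma frag_extend_frag_map:
  "frag_extend g (frag_map f x) = frag_extend (\<lambda>c. g (f c)) x"
  by (induction x rule: frag_induction[OF subset_UNIV])
    (simp_all add: frag_map_diff frag_extend_diff)

lemma frag_map_frag_extend:
  "frag_map f (frag_extend g x) = frag_extend (\<lambda>c. frag_map f (g c)) x"
  by (induction x rule: frag_induction[OF subset_UNIV])
    (simp_all add: frag_map_diff frag_extend_diff)

lemma frag_map_cong: "(\<And>c. c \<in> Poly_Mapping.keys x \<Longrightarrow> f c = g c) \<Longrightarrow> frag_map f x = frag_map g x"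
  unfolding frag_map_def by (rule frag_extend_eq) simp

lemma frag_map_frag_map: "frag_map f (frag_map g x) = frag_map (\<lambda>c. f (g c)) x"
  unfolding frag_map_def[of g] frag_map_frag_extend by (simp add: frag_map_def)

lemma frag_map_ident: "(\<And>c. c \<in> Poly_Mapping.keys x \<Longrightarrow> f c = c) \<Longrightarrow> frag_map f x = x"
  using frag_map_cong[of x f "\<lambda>c. c"] frag_expansion[of x] by (simp add: frag_map_def)

lemma lookup_frag_map_inj:
  assumes "inj f"
  shows "Poly_Mapping.lookup (frag_map f x) (f c) = Poly_Mapping.lookup x c"
  using assms by (induction x rule: frag_induction[OF subset_UNIV])
    (auto simp: frag_map_diff lookup_minus inj_eq)

lemma lookup_frag_map_notin:
  assumes "c \<notin> range f"
  shows "Poly_Mapping.lookup (frag_map f x) c = 0"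
  using assms keys_frag_map[of f x] by (meson image_mono in_keys_iff subset_UNIV subsetD)

lemma lookup_sum_frag: "Poly_Mapping.lookup (sum f A) c = (\<Sum>i\<in>A. Poly_Mapping.lookup (f i) c)"
  for f :: "'i \<Rightarrow> 'a \<Rightarrow>\<^sub>0 int"
  by (induction A rule: infinite_finite_induct) (simp_all add: lookup_add)

lemma frag_extend_add_fun: "frag_extend (\<lambda>c. f c + g c) x = frag_extend f x + frag_extend g x"
  by (simp add: frag_extend_def frag_cmul_distrib2 sum.distrib)

lemma bij_frag_map:
  assumes "bij_betw f K K"
  shows "bij_betw (frag_map f) {x. Poly_Mapping.keys x \<subseteq> K} {x. Poly_Mapping.keys x \<subseteq> K}"
proof (rule bij_betw_byWitness[where f' = "frag_map (inv_into K f)"])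
  note g = bij_betw_inv_into[OF assms]
  show "\<forall>x\<in>{x. Poly_Mapping.keys x \<subseteq> K}. frag_map (inv_into K f) (frag_map f x) = x"
    using bij_betw_inv_into_left[OF assms] by (auto simp: frag_map_frag_map intro!: frag_map_ident)
  show "\<forall>x\<in>{x. Poly_Mapping.keys x \<subseteq> K}. frag_map f (frag_map (inv_into K f) x) = x"
    using bij_betw_inv_into_right[OF assms] by (auto simp: frag_map_frag_map intro!: frag_map_ident)
  show "frag_map f ` {x. Poly_Mapping.keys x \<subseteq> K} \<subseteq> {x. Poly_Mapping.keys x \<subseteq> K}"
    using keys_frag_map[of f] bij_betw_imp_surj_on[OF assms] by blast
  show "frag_map (inv_into K f) ` {x. Poly_Mapping.keys x \<subseteq> K} \<subseteq> {x. Poly_Mapping.keys x \<subseteq> K}"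
    using keys_frag_map[of "inv_into K f"] bij_betw_imp_surj_on[OF g] by blast
qed

lemma cring_laurent_ring: "cring laurent_ring"
  unfolding laurent_ring_def
  by (intro cringI abelian_groupI comm_monoidI)
    (auto simp: algebra_simps intro: exI[of _ "- x" for x] left_minus)

text \<open>\<open>L\<close> sends the class of an object to the combination of classes in \<open>S\<close> it is equivalent to, and
  splits off the free group on \<open>S\<close> as the quotient by the relations of \<open>T\<close>; the shift acts freely on
  \<open>S\<close>, with \<open>I\<close> as a set of representatives of its orbits.\<close>

locale shift_basis = triangulated_category C
  for C :: "('o, 'm, 'x) triang_cat_scheme" (structure) +
  fixes T :: "('m \<times> 'm \<times> 'm) set" and L :: "'o set \<Rightarrow> 'o set \<Rightarrow>\<^sub>0 int" and K S I :: "'o set set"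
  assumes K_def: "K = iso_class C ` obj C"
    and S_subset: "S \<subseteq> K"
    and I_subset: "I \<subseteq> S"
    and L_keys: "c \<in> K \<Longrightarrow> Poly_Mapping.keys (L c) \<subseteq> S"
    and L_equiv: "c \<in> K \<Longrightarrow> frag_of c - L c \<in> triangle_relations C T"
    and L_exact: "\<lbrakk>exact_triangle C A B D f g h; (f, g, h) \<in> T\<rbrakk> \<Longrightarrow>
          L (iso_class C B) = L (iso_class C A) + L (iso_class C D)"
    and L_shift: "c \<in> K \<Longrightarrow>
          L (shift_iso_class C c) = frag_map (shift_iso_class C) (L c)"
    and L_basis: "c \<in> S \<Longrightarrow> L c = frag_of c"
    and shift_S: "i \<in> I \<Longrightarrow> bij_power K (shift_iso_class C) n i \<in> S"
    and shift_exhaust: "c \<in> S \<Longrightarrow>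
          \<exists>i\<in>I. \<exists>n. c = bij_power K (shift_iso_class C) n i"
    and shift_free: "\<lbrakk>i \<in> I; j \<in> I; bij_power K (shift_iso_class C) n i
          = bij_power K (shift_iso_class C) m j\<rbrakk> \<Longrightarrow> i = j \<and> n = m"
begin

lemma iso_class_K: "A \<in> obj C \<Longrightarrow> iso_class C A \<in> K"
  by (simp add: K_def)

lemmas triangle_relations_keys_K = triangle_relations_keys[folded K_def]
  and groth_proj_add_K = groth_proj_add[folded K_def]
  and groth_proj_eq_iff_K = groth_proj_eq_iff[folded K_def]
  and groth_proj_int_pow_K = groth_proj_int_pow[folded K_def]
  and carrier_groth_group_K = carrier_groth_group[folded K_def]
  and bij_shift_K = bij_shift_iso_class[folded K_def]

abbreviation Free :: "('o set \<Rightarrow>\<^sub>0 int) set" where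
  "Free \<equiv> {x. Poly_Mapping.keys x \<subseteq> K}"

abbreviation G :: "('o set \<Rightarrow>\<^sub>0 int) set monoid" where
  "G \<equiv> groth_group C T"

abbreviation proj :: "('o set \<Rightarrow>\<^sub>0 int) \<Rightarrow> ('o set \<Rightarrow>\<^sub>0 int) set" where
  "proj \<equiv> groth_proj C T"

abbreviation sh :: "int \<Rightarrow> 'o set \<Rightarrow> 'o set" where
  "sh \<equiv> bij_power K (shift_iso_class C)"

lemma Free_add: "x \<in> Free \<Longrightarrow> y \<in> Free \<Longrightarrow> x + y \<in> Free"
  using keys_add[of x y] by auto

lemma Free_diff: "x \<in> Free \<Longrightarrow> y \<in> Free \<Longrightarrow> x - y \<in> Free"
  using keys_diff[of x y] by auto

lemma Free_cmul: "x \<in> Free \<Longrightarrow> frag_cmul k x \<in> Free"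
  using keys_cmul[of k x] by auto

lemma Free_sum: "(\<And>i. i \<in> A \<Longrightarrow> f i \<in> Free) \<Longrightarrow> sum f A \<in> Free"
  using sum_closed_free_Abelian_group[of A f K] by simp

lemma sh_closed: "c \<in> K \<Longrightarrow> sh n c \<in> K"
  using bij_power_closed[OF bij_shift_K] .

lemma sh_add: "c \<in> K \<Longrightarrow> sh (m + n) c = sh m (sh n c)"
  using bij_power_add[OF bij_shift_K] .

lemma Free_sh: "x \<in> Free \<Longrightarrow> frag_map (sh n) x \<in> Free"
  using keys_frag_map[of "sh n" x] sh_closed[of _ n] by fastforce

section \<open>The retraction \<open>L\<close> and the kernel of the projection\<close>

lemma L_extend_equiv:
  assumes "x \<in> Free"
  shows "x - frag_extend L x \<in> triangle_relations C T"
proof -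
  have "Poly_Mapping.keys x \<subseteq> K"
    using assms by simp
  then show ?thesis
  proof (induction x rule: frag_induction)
    case (diff a b)
    then show ?case
      using triangle_relations_diff[of "a - frag_extend L a" T "b - frag_extend L b"]
      by (simp add: frag_extend_diff algebra_simps)
  qed (auto simp: triangle_relations_zero L_equiv)
qed

lemma L_extend_keys: "x \<in> Free \<Longrightarrow> Poly_Mapping.keys (frag_extend L x) \<subseteq> S"
  using keys_frag_extend[of L x] L_keys by fastforce

lemma L_extend_basis:
  assumes "Poly_Mapping.keys x \<subseteq> S"
  shows "frag_extend L x = x"
  using frag_extend_eq[of x L frag_of] frag_expansion[of x] L_basis assms by auto

lemma L_extend_relations:
  assumes "x \<in> triangle_relations C T"
  shows "frag_extend L x = 0"
proof -
  let ?R = "{frag_of (iso_class C A) - frag_of (iso_class C B) + frag_of (iso_class C D) | A B D.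
        \<exists>f g h. exact_triangle C A B D f g h \<and> (f, g, h) \<in> T}"
  have R: "frag_extend L h = 0" if "h \<in> ?R" for h
    using that L_exact by (auto simp: frag_extend_diff frag_extend_add)
  \<comment> \<open>The inverse in \<open>iso_free_group\<close> is negation only on the carrier,
    hence the detour through the keys of \<open>h\<close>.\<close>
  have inv_R: "inv\<^bsub>iso_free_group C\<^esub> h = - h" if "h \<in> ?R" for h
    using triangle_relations_keys[of h T] generate.incl[OF that]
    unfolding triangle_relations_def iso_free_group_def by (intro inv_free_Abelian_group) blast
  show ?thesis
    using assms unfolding triangle_relations_def
  proof induction
    case one
    show ?case
      by (simp add: iso_free_group_def)
  next
    case (incl h)
    show ?case
      by (rule R[OF incl])
  next
    case (inv h)
    show ?case
      unfolding inv_R[OF inv] frag_extend_minus R[OF inv] by simp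
  next
    case (eng h k)
    then show ?case
      by (simp add: iso_free_group_def frag_extend_add)
  qed
qed

text \<open>The linear extension of \<open>L\<close> kills every relation, while \<open>x\<close>
  and its image differ by a relation; so the relations are exactly the kernel, and membership
  becomes an equation between formal sums.\<close>

lemma triangle_relations_iff:
  assumes "x \<in> Free"
  shows "x \<in> triangle_relations C T \<longleftrightarrow> frag_extend L x = 0"
  using L_extend_relations L_extend_equiv[OF assms] by (metis diff_zero)

lemma L_extend_shift:
  assumes "x \<in> Free"
  shows "frag_extend L (frag_map (shift_iso_class C) x) = frag_map (shift_iso_class C) (frag_extend L x)"
  unfolding frag_extend_frag_map frag_map_frag_extend
  using assms L_shift by (intro frag_extend_eq) auto

lemma Free_shift: "x \<in> Free \<Longrightarrow> frag_map (shift_iso_class C) x \<in> Free"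
  using bij_betw_imp_surj_on[OF bij_frag_map[OF bij_shift_K]] by blast

text \<open>\<open>L\<close> commutes with the shift, which is injective on formal sums. The
  implication from left to right makes the shift injective on the quotient, hence \<open>s\<close>
  invertible.\<close>

lemma shift_relations_iff:
  assumes "x \<in> Free"
  shows "frag_map (shift_iso_class C) x \<in> triangle_relations C T \<longleftrightarrow> x \<in> triangle_relations C T"
proof -
  have "frag_extend L x \<in> Free" "0 \<in> Free"
    using L_extend_keys[OF assms] S_subset by auto
  then have "frag_map (shift_iso_class C) (frag_extend L x) = 0 \<longleftrightarrow> frag_extend L x = 0"
    using bij_betw_imp_inj_on[OF bij_frag_map[OF bij_shift_K]]
    by (metis (no_types, lifting) frag_map_zero inj_onD)
  then show ?thesis
    using triangle_relations_iff assms Free_shift L_extend_shift by simp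
qed

lemma proj_eq_iff: "x \<in> Free \<Longrightarrow> y \<in> Free \<Longrightarrow> proj x = proj y \<longleftrightarrow> x - y \<in> triangle_relations C T"
  using groth_proj_eq_iff_K by blast

lemma carrier_G: "carrier G = proj ` Free"
  by (rule carrier_groth_group_K)

text \<open>All members of a coset have the same shifted coset, so the union in
  \<open>groth_shift\<close> is over equal sets.\<close>

lemma groth_shift_proj:
  assumes x: "x \<in> Free"
  shows "groth_shift C T (proj x) = proj (frag_map (shift_iso_class C) x)"
proof -
  have "proj (frag_map (shift_iso_class C) y) = proj (frag_map (shift_iso_class C) x)" if "y \<in> proj x" for y
  proof -
    have d: "y - x \<in> triangle_relations C T"
      using that by (simp add: mem_groth_proj_iff)
    then have "y - x \<in> Free"
      using triangle_relations_keys_K by blast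
    then have "y \<in> Free"
      using Free_add[of "y - x" x] x by simp
    moreover have "frag_map (shift_iso_class C) y - frag_map (shift_iso_class C) x \<in> triangle_relations C T"
      using d shift_relations_iff[OF \<open>y - x \<in> Free\<close>] by (simp only: frag_map_diff)
    ultimately show ?thesis
      using proj_eq_iff Free_shift x by blast
  qed
  moreover have "x \<in> proj x"
    by (simp add: mem_groth_proj_iff triangle_relations_zero)
  ultimately show ?thesis
    unfolding groth_shift_def frag_map_def[symmetric] by blast
qed

lemma bij_groth_shift: "bij_betw (groth_shift C T) (carrier G) (carrier G)"
proof -
  note b = bij_frag_map[OF bij_shift_K]
  have "groth_shift C T ` proj ` Free = proj ` frag_map (shift_iso_class C) ` Free"
    unfolding image_image using groth_shift_proj by (intro image_cong) auto
  then have "groth_shift C T ` carrier G = carrier G"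
    using bij_betw_imp_surj_on[OF b] by (simp add: carrier_G)
  moreover have "inj_on (groth_shift C T) (carrier G)"
  proof (rule inj_onI)
    fix a b assume "a \<in> carrier G" "b \<in> carrier G" and eq: "groth_shift C T a = groth_shift C T b"
    then obtain x y where x: "x \<in> Free" "a = proj x" and y: "y \<in> Free" "b = proj y"
      unfolding carrier_G by blast
    then have "frag_map (shift_iso_class C) (x - y) \<in> triangle_relations C T"
      using eq groth_shift_proj proj_eq_iff Free_shift by (simp add: frag_map_diff)
    then have "x - y \<in> triangle_relations C T"
      using shift_relations_iff[OF Free_diff[OF x(1) y(1)]] by simp
    then show "a = b"
      using proj_eq_iff[OF x(1) y(1)] x(2) y(2) by simp
  qed
  ultimately show ?thesis
    by (simp add: bij_betw_def)
qed

lemma frag_map_sh: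
  assumes "x \<in> Free"
  shows "bij_power Free (frag_map (shift_iso_class C)) n x = frag_map (sh n) x"
proof -
  note b = bij_frag_map[OF bij_shift_K]
  have "Poly_Mapping.keys x \<subseteq> K"
    using assms by simp
  then show ?thesis
  proof (induction n rule: int_induct[of _ 0])
    case base
    show ?case
      by (simp add: frag_map_ident)
  next
    case (step1 n)
    have "frag_map (sh (n + 1)) x = frag_map (shift_iso_class C) (frag_map (sh n) x)"
      unfolding frag_map_frag_map using bij_power_Suc[OF bij_shift_K] assms
      by (intro frag_map_cong) blast
    then show ?case
      using step1 bij_power_Suc[OF b assms] by simp
  next
    case (step2 n)
    have "frag_map (sh n) x = frag_map (shift_iso_class C) (frag_map (sh (n - 1)) x)"
      unfolding frag_map_frag_map using bij_power_pred[OF bij_shift_K] assms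
      by (intro frag_map_cong) fastforce
    then have "frag_map (shift_iso_class C) (bij_power Free (frag_map (shift_iso_class C)) (n - 1) x)
        = frag_map (shift_iso_class C) (frag_map (sh (n - 1)) x)"
      using step2 bij_power_pred[OF b assms] by simp
    then show ?case
      using inj_onD[OF bij_betw_imp_inj_on[OF b]] bij_power_closed[OF b assms] Free_sh[OF assms]
      by blast
  qed
qed

lemma groth_shift_power_proj:
  assumes "x \<in> Free"
  shows "groth_shift_power C T n (proj x) = proj (frag_map (sh n) x)"
proof -
  have "proj (bij_power Free (frag_map (shift_iso_class C)) n x)
      = bij_power (carrier G) (groth_shift C T) n (proj x)"
    using bij_frag_map[OF bij_shift_K] bij_groth_shift groth_shift_proj assms
    by (intro bij_power_equivariant) (auto simp: carrier_G)
  moreover have "groth_shift_power C T n = bij_power (carrier G) (groth_shift C T) n"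
    unfolding groth_shift_power_def bij_power_def ..
  ultimately show ?thesis
    using frag_map_sh[OF assms] by simp
qed

text \<open>A Laurent polynomial is itself a formal sum, of exponents, so its action on formal sums
  of classes is a linear extension too. The module axioms are checked for this lift and pass to the
  quotient.\<close>

definition act :: "(int \<Rightarrow>\<^sub>0 int) \<Rightarrow> ('o set \<Rightarrow>\<^sub>0 int) \<Rightarrow> 'o set \<Rightarrow>\<^sub>0 int" where
  "act p x = frag_extend (\<lambda>n. frag_map (sh n) x) p"

lemma act_Free: "x \<in> Free \<Longrightarrow> act p x \<in> Free"
  unfolding act_def frag_extend_def by (intro Free_sum Free_cmul Free_sh)

lemma act_add_left: "act (p + q) x = act p x + act q x"
  by (simp add: act_def frag_extend_add)

lemma act_diff_left: "act (p - q) x = act p x - act q x"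
  by (simp add: act_def frag_extend_diff)

lemma act_zero_left: "act 0 x = 0"
  by (simp add: act_def)

lemma act_add_right: "act p (x + y) = act p x + act p y"
  by (simp add: act_def frag_map_add frag_extend_add_fun)

lemma act_single: "act (frag_of n) x = frag_map (sh n) x"
  by (simp add: act_def)

lemma act_one: "act 1 x = x"
  using act_single[of 0 x] by (simp add: frag_map_ident)

text \<open>Both sides are additive in \<open>p\<close> and in \<open>q\<close>, which leaves
  monomials, where the exponents add by \<open>sh_add\<close>.\<close>

lemma act_mult:
  assumes "x \<in> Free"
  shows "act (p * q) x = act p (act q x)"
proof -
  have single: "act (frag_of m * q) x = frag_map (sh m) (act q x)" for m q
  proof (induction q rule: frag_induction[OF subset_UNIV])
    case (2 n)
    have "frag_map (sh (m + n)) x = frag_map (sh m) (frag_map (sh n) x)"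
      unfolding frag_map_frag_map using assms sh_add by (intro frag_map_cong) auto
    then show ?case
      by (simp add: act_single mult_single)
  qed (simp_all add: act_diff_left frag_map_diff right_diff_distrib act_zero_left)
  show ?thesis
    by (induction p rule: frag_induction[OF subset_UNIV])
      (simp_all add: act_diff_left left_diff_distrib single act_single act_zero_left)
qed

lemma smult_proj:
  assumes x: "x \<in> Free"
  shows "p \<odot>\<^bsub>groth_module C T\<^esub> proj x = proj (act p x)"
proof -
  interpret G: comm_group G
    by (rule comm_group_groth_group)
  have f: "f i \<in> Free \<Longrightarrow> proj (f i) \<in> carrier G" for f :: "int \<Rightarrow> _" and i
    unfolding carrier_G by blast
  have fin: "finprod G (\<lambda>n. proj (f n)) A = proj (sum f A)" if "finite A" "\<And>n. n \<in> A \<Longrightarrow> f n \<in> Free"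
    for A and f :: "int \<Rightarrow> _"
    using that
  proof (induction A)
    case empty
    show ?case by (simp add: one_groth_group)
  next
    case (insert a A)
    have "finprod G (\<lambda>n. proj (f n)) (insert a A) = proj (f a) \<otimes>\<^bsub>G\<^esub> finprod G (\<lambda>n. proj (f n)) A"
      using insert.prems insert.hyps f by (intro G.finprod_insert) auto
    also have "\<dots> = proj (f a + sum f A)"
      using insert Free_sum[of A f] groth_proj_add_K[of "f a" "sum f A" T] by simp
    finally show ?case
      using insert.hyps by simp
  qed
  have "p \<odot>\<^bsub>groth_module C T\<^esub> proj x
      = finprod G (\<lambda>n. groth_shift_power C T n (proj x) [^]\<^bsub>G\<^esub> Poly_Mapping.lookup p n) (Poly_Mapping.keys p)"
    by (simp add: groth_module_def)
  also have "\<dots> = finprod G (\<lambda>n. proj (frag_cmul (Poly_Mapping.lookup p n) (frag_map (sh n) x)))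
      (Poly_Mapping.keys p)"
    using groth_proj_int_pow_K Free_sh[OF x] groth_shift_power_proj[OF x] by simp
  also have "\<dots> = proj (act p x)"
    unfolding act_def frag_extend_def using Free_cmul Free_sh[OF x] by (intro fin) auto
  finally show ?thesis .
qed

lemma carrier_groth_module: "carrier (groth_module C T) = proj ` Free"
  by (simp add: groth_module_def carrier_G)

lemma add_groth_module:
  "x \<in> Free \<Longrightarrow> y \<in> Free \<Longrightarrow> proj x \<oplus>\<^bsub>groth_module C T\<^esub> proj y = proj (x + y)"
  using groth_proj_add_K by (simp add: groth_module_def)

lemma zero_groth_module: "\<zero>\<^bsub>groth_module C T\<^esub> = proj 0"
  by (simp add: groth_module_def one_groth_group)

lemma abelian_group_groth_module: "abelian_group (groth_module C T)"
proof (rule abelian_groupI)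
  fix a assume "a \<in> carrier (groth_module C T)"
  then obtain x where x: "x \<in> Free" "a = proj x"
    by (auto simp: carrier_groth_module)
  then have "- x \<in> Free"
    by simp
  then show "\<exists>b\<in>carrier (groth_module C T). b \<oplus>\<^bsub>groth_module C T\<^esub> a = \<zero>\<^bsub>groth_module C T\<^esub>"
    using x add_groth_module[of "- x" x]
    by (intro bexI[of _ "proj (- x)"]) (auto simp: carrier_groth_module zero_groth_module)
qed (use Free_add in \<open>auto simp: carrier_groth_module add_groth_module zero_groth_module add_ac\<close>)

lemma module_groth_module: "Module.module laurent_ring (groth_module C T)"
  using cring_laurent_ring abelian_group_groth_module
proof (rule moduleI)
qed (use act_Free Free_add in \<open>auto simp: carrier_groth_module smult_proj add_groth_module
      laurent_ring_def act_add_left act_add_right act_mult act_one\<close>)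

lemma finsum_groth_module:
  assumes "finite A" "\<And>i. i \<in> A \<Longrightarrow> f i \<in> Free"
  shows "(\<Oplus>\<^bsub>groth_module C T\<^esub>i\<in>A. proj (f i)) = proj (sum f A)"
proof -
  interpret abelian_group "groth_module C T"
    by (rule abelian_group_groth_module)
  show ?thesis
    using assms
  proof (induction A)
    case empty
    then show ?case
      by (simp add: zero_groth_module)
  next
    case (insert a A)
    have "(\<Oplus>\<^bsub>groth_module C T\<^esub>i\<in>insert a A. proj (f i))
        = proj (f a) \<oplus>\<^bsub>groth_module C T\<^esub> (\<Oplus>\<^bsub>groth_module C T\<^esub>i\<in>A. proj (f i))"
      using insert.prems insert.hyps by (intro finsum_insert) (auto simp: carrier_groth_module)
    then show ?case
      using insert Free_sum[of A f] add_groth_module by simp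
  qed
qed

section \<open>Coordinates along the shift orbits\<close>

lemma act_frag_of: "act p (frag_of i) = frag_map (\<lambda>n. sh n i) p"
  by (simp add: act_def frag_map_def)

text \<open>The orbits are free and disjoint: \<open>sh n j\<close> is met only in the orbit of
  \<open>j\<close>, and there only by the monomial of degree \<open>n\<close>.\<close>

lemma lookup_act_frag_of:
  assumes "i \<in> I" "j \<in> I"
  shows "Poly_Mapping.lookup (act p (frag_of i)) (sh n j) = (if i = j then Poly_Mapping.lookup p n else 0)"
proof (cases "i = j")
  case True
  have "inj (\<lambda>n. sh n i)"
    using shift_free[OF assms(1,1)] by (auto intro: injI)
  then show ?thesis
    using lookup_frag_map_inj[of "\<lambda>n. sh n i"] True by (simp add: act_frag_of)
next
  case False
  then have "sh n j \<notin> range (\<lambda>n. sh n i)"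
    using shift_free[OF assms] by auto
  then show ?thesis
    using lookup_frag_map_notin False by (simp add: act_frag_of)
qed

lemma act_frag_of_keys: "i \<in> I \<Longrightarrow> Poly_Mapping.keys (act p (frag_of i)) \<subseteq> S"
  using keys_frag_map[of "\<lambda>n. sh n i" p] shift_S by (auto simp: act_frag_of)

lemma combination_keys:
  "J \<subseteq> I \<Longrightarrow> Poly_Mapping.keys (\<Sum>i\<in>J. act (c i) (frag_of i)) \<subseteq> S"
  using sum_closed_free_Abelian_group[of J "\<lambda>i. act (c i) (frag_of i)" S] act_frag_of_keys by auto

lemma lookup_combination:
  assumes "finite {i. c i \<noteq> 0}" "{i. c i \<noteq> 0} \<subseteq> I" "j \<in> I"
  shows "Poly_Mapping.lookup (\<Sum>i | c i \<noteq> 0. act (c i) (frag_of i)) (sh n j) = Poly_Mapping.lookup (c j) n"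
proof -
  have "Poly_Mapping.lookup (\<Sum>i | c i \<noteq> 0. act (c i) (frag_of i)) (sh n j)
      = (\<Sum>i | c i \<noteq> 0. if i = j then Poly_Mapping.lookup (c i) n else 0)"
    unfolding lookup_sum_frag
    by (intro sum.cong refl lookup_act_frag_of) (use assms in auto)
  then show ?thesis
    using assms(1) by simp
qed

lemma proj_combination:
  assumes "finite J" "J \<subseteq> I"
  shows "(\<Oplus>\<^bsub>groth_module C T\<^esub>i\<in>J. c i \<odot>\<^bsub>groth_module C T\<^esub> proj (frag_of i))
    = proj (\<Sum>i\<in>J. act (c i) (frag_of i))"
proof -
  interpret abelian_group "groth_module C T"
    by (rule abelian_group_groth_module)
  have F: "frag_of i \<in> Free" if "i \<in> J" for i
    using that assms I_subset S_subset by auto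
  have "(\<Oplus>\<^bsub>groth_module C T\<^esub>i\<in>J. c i \<odot>\<^bsub>groth_module C T\<^esub> proj (frag_of i))
      = (\<Oplus>\<^bsub>groth_module C T\<^esub>i\<in>J. proj (act (c i) (frag_of i)))"
    using F smult_proj act_Free by (intro finsum_cong') (auto simp: carrier_groth_module)
  then show ?thesis
    using finsum_groth_module[OF assms(1)] act_Free F by simp
qed

text \<open>Sums over \<open>S\<close> are fixed by the retraction \<open>L\<close>, so they are
  normal forms for the cosets.\<close>

lemma proj_eq_iff_S:
  assumes "Poly_Mapping.keys x \<subseteq> S" "Poly_Mapping.keys y \<subseteq> S"
  shows "proj x = proj y \<longleftrightarrow> x = y"
proof -
  have "x \<in> Free" "y \<in> Free" "Poly_Mapping.keys (x - y) \<subseteq> S"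
    using assms S_subset keys_diff[of x y] by auto
  then show ?thesis
    using proj_eq_iff triangle_relations_iff Free_diff L_extend_basis by simp
qed

lemma combination_exists:
  assumes y: "Poly_Mapping.keys y \<subseteq> S"
  obtains c where "finite {i. c i \<noteq> 0}" "{i. c i \<noteq> 0} \<subseteq> I" "y = (\<Sum>i | c i \<noteq> 0. act (c i) (frag_of i))"
proof -
  \<comment> \<open>The coefficients of \<open>y\<close> along the orbit of \<open>i\<close>, read
    as a Laurent polynomial.\<close>
  define c where "c i = (if i \<in> I then Abs_poly_mapping (\<lambda>n. Poly_Mapping.lookup y (sh n i)) else 0)" for i
  \<comment> \<open>Since the shift is free, \<open>?R\<close> embeds into the finite set of keys of
    \<open>y\<close>; its two projections bound the exponents of each \<open>c i\<close> and the
    indices with \<open>c i \<noteq> 0\<close>.\<close>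
  let ?R = "{(i, n). i \<in> I \<and> sh n i \<in> Poly_Mapping.keys y}"
  have "finite ?R"
    using shift_free by (intro finite_imageD[of "\<lambda>(i, n). sh n i"])
      (auto intro!: finite_subset[OF _ finite_keys[of y]] inj_onI)
  have "finite {n. Poly_Mapping.lookup y (sh n i) \<noteq> 0}" if "i \<in> I" for i
    using that by (intro finite_subset[OF _ finite_imageI[OF \<open>finite ?R\<close>, of snd]])
      (force simp: in_keys_iff)
  then have c: "Poly_Mapping.lookup (c i) n = Poly_Mapping.lookup y (sh n i)" if "i \<in> I" for i n
    using that by (simp add: c_def Abs_poly_mapping_inverse)
  have "{i. c i \<noteq> 0} \<subseteq> fst ` ?R"
  proof
    fix i assume i: "i \<in> {i. c i \<noteq> 0}"
    then have "i \<in> I"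
      by (auto simp: c_def split: if_splits)
    moreover obtain n where "Poly_Mapping.lookup (c i) n \<noteq> 0"
      using i by (metis (mono_tags) lookup_zero mem_Collect_eq poly_mapping_eqI)
    ultimately show "i \<in> fst ` ?R"
      using c by (force simp: in_keys_iff)
  qed
  then have fin: "finite {i. c i \<noteq> 0}" and sub: "{i. c i \<noteq> 0} \<subseteq> I"
    using \<open>finite ?R\<close> finite_surj by (blast, auto)
  have "y = (\<Sum>i | c i \<noteq> 0. act (c i) (frag_of i))"
  proof (rule poly_mapping_eqI)
    fix k
    show "Poly_Mapping.lookup y k = Poly_Mapping.lookup (\<Sum>i | c i \<noteq> 0. act (c i) (frag_of i)) k"
    proof (cases "k \<in> S")
      case True
      then obtain i n where "i \<in> I" "k = sh n i"
        using shift_exhaust by blast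
      then show ?thesis
        using lookup_combination[OF fin sub] c by simp
    next
      case False
      then have "k \<notin> Poly_Mapping.keys y"
        "k \<notin> Poly_Mapping.keys (\<Sum>i | c i \<noteq> 0. act (c i) (frag_of i))"
        using y combination_keys[OF sub, of c] by blast+
      then show ?thesis
        by (simp add: in_keys_iff)
    qed
  qed
  then show thesis
    using fin sub that by blast
qed

lemma freely_generated:
  "freely_generated_by laurent_ring (groth_module C T) I (\<lambda>c. proj (frag_of c))"
  unfolding freely_generated_by_def
proof (intro conjI ballI)
  show "(\<lambda>c. proj (frag_of c)) \<in> I \<rightarrow> carrier (groth_module C T)"
    using I_subset S_subset by (auto simp: carrier_groth_module)
  fix a assume "a \<in> carrier (groth_module C T)"
  then obtain x where x: "x \<in> Free" "a = proj x"
    by (auto simp: carrier_groth_module)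
  \<comment> \<open>The normal form of \<open>a\<close>.\<close>
  define y where "y = frag_extend L x"
  have y: "Poly_Mapping.keys y \<subseteq> S"
    unfolding y_def by (rule L_extend_keys[OF x(1)])
  then have "y \<in> Free"
    using S_subset by auto
  then have a: "a = proj y"
    using x proj_eq_iff L_extend_equiv[OF x(1)] by (simp add: y_def)
  \<comment> \<open>Both sides have normal forms over \<open>S\<close>, so an expansion of
    \<open>a\<close> in the module is the same as an expansion of \<open>y\<close> among formal
    sums.\<close>
  have eq: "a = (\<Oplus>\<^bsub>groth_module C T\<^esub>i\<in>{i. c i \<noteq> 0}. c i \<odot>\<^bsub>groth_module C T\<^esub> proj (frag_of i))
      \<longleftrightarrow> y = (\<Sum>i | c i \<noteq> 0. act (c i) (frag_of i))"
    if "finite {i. c i \<noteq> 0}" "{i. c i \<noteq> 0} \<subseteq> I" for c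
    unfolding proj_combination[OF that] a using proj_eq_iff_S[OF y combination_keys[OF that(2)]] .
  \<comment> \<open>Every coefficient can be read off from \<open>y\<close>, which gives
    uniqueness.\<close>
  have coeff: "Poly_Mapping.lookup (c j) n = Poly_Mapping.lookup y (sh n j)"
    if c: "finite {i. c i \<noteq> 0}" "{i. c i \<noteq> 0} \<subseteq> I"
      "a = (\<Oplus>\<^bsub>groth_module C T\<^esub>i\<in>{i. c i \<noteq> 0}. c i \<odot>\<^bsub>groth_module C T\<^esub> proj (frag_of i))"
      and "j \<in> I" for c j n
  proof -
    have "y = (\<Sum>i | c i \<noteq> 0. act (c i) (frag_of i))"
      using eq[OF c(1,2)] c(3) by (rule iffD1)
    then show ?thesis
      using lookup_combination[OF c(1,2) \<open>j \<in> I\<close>, of n] by simp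
  qed
  have "\<exists>!c. finite {i. c i \<noteq> 0} \<and> {i. c i \<noteq> 0} \<subseteq> I \<and>
      a = (\<Oplus>\<^bsub>groth_module C T\<^esub>i\<in>{i. c i \<noteq> 0}. c i \<odot>\<^bsub>groth_module C T\<^esub> proj (frag_of i))"
  proof (rule ex_ex1I)
    obtain c where c: "finite {i. c i \<noteq> 0}" "{i. c i \<noteq> 0} \<subseteq> I"
      "y = (\<Sum>i | c i \<noteq> 0. act (c i) (frag_of i))"
      using combination_exists[OF y] .
    have "a = (\<Oplus>\<^bsub>groth_module C T\<^esub>i\<in>{i. c i \<noteq> 0}. c i \<odot>\<^bsub>groth_module C T\<^esub> proj (frag_of i))"
      using eq[OF c(1,2)] c(3) by (rule iffD2)
    then show "\<exists>c. finite {i. c i \<noteq> 0} \<and> {i. c i \<noteq> 0} \<subseteq> I \<and>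
      a = (\<Oplus>\<^bsub>groth_module C T\<^esub>i\<in>{i. c i \<noteq> 0}. c i \<odot>\<^bsub>groth_module C T\<^esub> proj (frag_of i))"
      using c(1,2) by (intro exI[of _ c] conjI)
  next
    fix c d
    assume c': "finite {i. c i \<noteq> 0} \<and> {i. c i \<noteq> 0} \<subseteq> I \<and>
        a = (\<Oplus>\<^bsub>groth_module C T\<^esub>i\<in>{i. c i \<noteq> 0}. c i \<odot>\<^bsub>groth_module C T\<^esub> proj (frag_of i))"
      and d': "finite {i. d i \<noteq> 0} \<and> {i. d i \<noteq> 0} \<subseteq> I \<and>
        a = (\<Oplus>\<^bsub>groth_module C T\<^esub>i\<in>{i. d i \<noteq> 0}. d i \<odot>\<^bsub>groth_module C T\<^esub> proj (frag_of i))"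
    note c = c'[THEN conjunct1] c'[THEN conjunct2, THEN conjunct1] c'[THEN conjunct2, THEN conjunct2]
    note d = d'[THEN conjunct1] d'[THEN conjunct2, THEN conjunct1] d'[THEN conjunct2, THEN conjunct2]
    have "c j = d j" for j
    proof (cases "j \<in> I")
      case True
      show ?thesis
        by (rule poly_mapping_eqI) (simp only: coeff[OF c True] coeff[OF d True])
    next
      case False
      then have "c j = 0" "d j = 0"
        using c(2) d(2) by blast+
      then show ?thesis
        by simp
    qed
    then show "c = d"
      by (rule ext)
  qed
  then show "\<exists>!c. c \<in> UNIV \<rightarrow> carrier laurent_ring \<and> finite {i. c i \<noteq> \<zero>\<^bsub>laurent_ring\<^esub>} \<and>
      {i. c i \<noteq> \<zero>\<^bsub>laurent_ring\<^esub>} \<subseteq> I \<and>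
      a = (\<Oplus>\<^bsub>groth_module C T\<^esub>i\<in>{i. c i \<noteq> \<zero>\<^bsub>laurent_ring\<^esub>}. c i \<odot>\<^bsub>groth_module C T\<^esub> proj (frag_of i))"
    by (simp add: laurent_ring_def)
qed

lemma laurent_s_smult:
  assumes "A \<in> obj C"
  shows "laurent_s \<odot>\<^bsub>groth_module C T\<^esub> proj (frag_of (iso_class C A))
    = proj (frag_of (iso_class C (shift_ob C A)))"
proof -
  have "sh 1 (iso_class C A) = iso_class C (shift_ob C A)"
    using iso_class_shift[OF assms] by (simp add: bij_power_def)
  then show ?thesis
    using iso_class_K[OF assms] by (simp add: smult_proj laurent_s_def act_single)
qed

end

section \<open>Stable objects\<close>

context category
begin

lemma is_iso_cancel_left:
  assumes f: "f \<in> Mor C A B" and g: "is_iso C B D g" and gf: "is_iso C A D (g \<cdot> f)"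
  shows "is_iso C A B f"
proof -
  obtain g' where g': "g \<in> Mor C B D" "g' \<in> Mor C D B" "g' \<cdot> g = ident C B" "g \<cdot> g' = ident C D"
    using g by (rule is_isoE)
  then have "is_iso C D B g'"
    by (intro is_isoI)
  then have "is_iso C A B (g' \<cdot> (g \<cdot> f))"
    using is_iso_cmp gf by blast
  then show ?thesis
    using cmp_assoc[OF f g'(1,2)] g'(3) cmp_ident_left[OF f] by simp
qed

lemma is_iso_cancel_right:
  assumes f: "f \<in> Mor C B D" and e: "is_iso C A B e" and fe: "is_iso C A D (f \<cdot> e)"
  shows "is_iso C B D f"
proof -
  obtain e' where e': "e \<in> Mor C A B" "e' \<in> Mor C B A" "e' \<cdot> e = ident C A" "e \<cdot> e' = ident C B"
    using e by (rule is_isoE)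
  then have "is_iso C B A e'"
    by (intro is_isoI)
  then have "is_iso C B D ((f \<cdot> e) \<cdot> e')"
    using is_iso_cmp fe by blast
  then show ?thesis
    using cmp_assoc[OF e'(2,1) f] e'(4) cmp_ident_right[OF f] by simp
qed

lemma is_iso_epi:
  assumes e: "is_iso C A B e" and u: "u \<in> Mor C B D" "v \<in> Mor C B D" and eq: "u \<cdot> e = v \<cdot> e"
  shows "u = v"
proof -
  obtain e' where e': "e \<in> Mor C A B" "e' \<in> Mor C B A" "e \<cdot> e' = ident C B"
    using e by (rule is_isoE)
  have "u = (u \<cdot> e) \<cdot> e'" "v = (v \<cdot> e) \<cdot> e'"
    using cmp_assoc[OF e'(2,1)] u e'(3) cmp_ident_right by auto
  then show ?thesis
    using eq by simp
qed

lemma is_iso_mono: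
  assumes e: "is_iso C B D e" and u: "u \<in> Mor C A B" "v \<in> Mor C A B" and eq: "e \<cdot> u = e \<cdot> v"
  shows "u = v"
proof -
  obtain e' where e': "e \<in> Mor C B D" "e' \<in> Mor C D B" "e' \<cdot> e = ident C B"
    using e by (rule is_isoE)
  have "u = e' \<cdot> (e \<cdot> u)" "v = e' \<cdot> (e \<cdot> v)"
    using cmp_assoc[OF _ e'(1,2)] u e'(3) cmp_ident_left by metis+
  then show ?thesis
    using eq by simp
qed

end

context stability_condition
begin

section \<open>Stability under isomorphism and shift\<close>

lemma stable_slice: "stable_of_phase C P \<phi> X \<Longrightarrow> X \<in> P \<phi>"
  by (simp add: stable_of_phase_def simple_in_def)

lemma stable_obj: "stable_of_phase C P \<phi> X \<Longrightarrow> X \<in> obj C"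
  using stable_slice slice_obj by blast

lemma stable_nonzero: "stable_of_phase C P \<phi> X \<Longrightarrow> \<not> is_zero_object C X"
  by (simp add: stable_of_phase_def simple_in_def)

text \<open>Composition with an isomorphism carries monomorphisms into \<open>Y\<close> to
  monomorphisms into \<open>X\<close>.\<close>

lemma stable_iso:
  assumes X: "stable_of_phase C P \<phi> X" and "isomorphic C X Y"
  shows "stable_of_phase C P \<phi> Y"
proof -
  have o: "X \<in> obj C" "Y \<in> obj C"
    using isomorphic_obj assms(2) by blast+
  obtain e where e: "is_iso C Y X e"
    using isomorphic_sym[OF assms(2)] by (auto simp: isomorphic_def)
  have eM: "e \<in> Mor C Y X"
    using e by (auto elim: is_isoE)
  have "is_zero_object C A \<or> is_iso C A Y f" if A: "A \<in> P \<phi>" and f: "mono_in C (P \<phi>) A Y f" for A f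
  proof -
    have fM: "f \<in> Mor C A Y"
      using f by (simp add: mono_in_def)
    have "u = v" if "W \<in> P \<phi>" "u \<in> Mor C W A" "v \<in> Mor C W A" "(e \<cdot> f) \<cdot> u = (e \<cdot> f) \<cdot> v" for W u v
    proof -
      have "f \<cdot> u = f \<cdot> v"
        using that(4) cmp_assoc[OF that(2) fM eM] cmp_assoc[OF that(3) fM eM]
          is_iso_mono[OF e cmp_Mor[OF that(2) fM] cmp_Mor[OF that(3) fM]] by simp
      then show ?thesis
        using f that unfolding mono_in_def by blast
    qed
    then have "mono_in C (P \<phi>) A X (e \<cdot> f)"
      using cmp_Mor[OF fM eM] by (simp add: mono_in_def)
    then have "is_zero_object C A \<or> is_iso C A X (e \<cdot> f)"
      using X A unfolding stable_of_phase_def simple_in_def by blast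
    then show ?thesis
      using is_iso_cancel_left[OF fM e] by blast
  qed
  moreover have "Y \<in> P \<phi>"
    using slice_iso stable_slice assms by blast
  moreover have "\<not> is_zero_object C Y"
    using zero_object_isomorphic isomorphic_sym assms stable_nonzero by blast
  ultimately show ?thesis
    unfolding stable_of_phase_def simple_in_def by blast
qed

text \<open>A monomorphism into \<open>X[1]\<close> descends, up to an isomorphism \<open>e\<close>
  onto its source, to an arrow \<open>f'\<close> into \<open>X\<close>; this is monic because test
  arrows from \<open>W\<close> can be shifted.\<close>

lemma stable_shift:
  assumes X: "stable_of_phase C P \<phi> X"
  shows "stable_of_phase C P (\<phi> + 1) (shift_ob C X)"
proof -
  have o: "X \<in> obj C"
    using stable_obj X by blast
  have "is_zero_object C A \<or> is_iso C A (shift_ob C X) f"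
    if A: "A \<in> P (\<phi> + 1)" and f: "mono_in C (P (\<phi> + 1)) A (shift_ob C X) f" for A f
  proof -
    have fM: "f \<in> Mor C A (shift_ob C X)"
      using f by (simp add: mono_in_def)
    obtain A' where A': "A' \<in> P \<phi>" "isomorphic C (shift_ob C A') A"
      using slice_unshift[OF A] by auto
    have oA: "A' \<in> obj C"
      using slice_obj A'(1) by blast
    obtain e where e: "is_iso C (shift_ob C A') A e"
      using A'(2) by (auto simp: isomorphic_def)
    have eM: "e \<in> Mor C (shift_ob C A') A"
      using e by (auto elim: is_isoE)
    obtain f' where f': "f' \<in> Mor C A' X" "f \<cdot> e = shift_arr C f'"
      using shift_full[OF oA o cmp_Mor[OF eM fM]] .
    have "u = v" if W: "W \<in> P \<phi>" and uv: "u \<in> Mor C W A'" "v \<in> Mor C W A'" "f' \<cdot> u = f' \<cdot> v" for W u v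
    proof -
      note su = shift_Mor[OF uv(1)] and sv = shift_Mor[OF uv(2)]
      have "(f \<cdot> e) \<cdot> shift_arr C u = (f \<cdot> e) \<cdot> shift_arr C v"
        using shift_cmp[OF uv(1) f'(1)] shift_cmp[OF uv(2) f'(1)] uv(3) f'(2) by simp
      then have "f \<cdot> (e \<cdot> shift_arr C u) = f \<cdot> (e \<cdot> shift_arr C v)"
        using cmp_assoc[OF su eM fM] cmp_assoc[OF sv eM fM] by simp
      moreover have "shift_ob C W \<in> P (\<phi> + 1)"
        using slice_shift slice_obj W by blast
      ultimately have "e \<cdot> shift_arr C u = e \<cdot> shift_arr C v"
        using f cmp_Mor[OF su eM] cmp_Mor[OF sv eM] unfolding mono_in_def by blast
      then have "shift_arr C u = shift_arr C v"
        using is_iso_mono[OF e su sv] by blast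
      then show ?thesis
        using shift_inj uv by blast
    qed
    then have "mono_in C (P \<phi>) A' X f'"
      using f'(1) by (simp add: mono_in_def)
    then consider "is_zero_object C A'" | "is_iso C A' X f'"
      using X A'(1) unfolding stable_of_phase_def simple_in_def by blast
    then show ?thesis
    proof cases
      case 1
      then show ?thesis
        using shift_zero_object_iff[OF oA] zero_object_isomorphic A'(2) by blast
    next
      case 2
      then have "is_iso C (shift_ob C A') (shift_ob C X) (f \<cdot> e)"
        using shift_is_iso_iff[OF oA o f'(1)] f'(2) by simp
      then show ?thesis
        using is_iso_cancel_right[OF fM e] by blast
    qed
  qed
  moreover have "shift_ob C X \<in> P (\<phi> + 1)"
    using slice_shift o stable_slice X by blast
  moreover have "\<not> is_zero_object C (shift_ob C X)"
    using shift_zero_object_iff o stable_nonzero X by blast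
  ultimately show ?thesis
    unfolding stable_of_phase_def simple_in_def by blast
qed

text \<open>Shifting a monomorphism into \<open>X\<close> keeps it monic: a test object in
  \<open>P (\<phi> + 1)\<close> is isomorphic to some \<open>W'[1]\<close>, and the isomorphism
  \<open>e\<close> can be cancelled on the right.\<close>

lemma stable_unshift:
  assumes X: "stable_of_phase C P (\<phi> + 1) (shift_ob C X)" and o: "X \<in> obj C"
  shows "stable_of_phase C P \<phi> X"
proof -
  have "is_zero_object C A \<or> is_iso C A X f" if A: "A \<in> P \<phi>" and f: "mono_in C (P \<phi>) A X f" for A f
  proof -
    have fM: "f \<in> Mor C A X"
      using f by (simp add: mono_in_def)
    have oA: "A \<in> obj C"
      using slice_obj A by blast
    have "u = v" if W: "W \<in> P (\<phi> + 1)" and uv: "u \<in> Mor C W (shift_ob C A)" "v \<in> Mor C W (shift_ob C A)"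
      "shift_arr C f \<cdot> u = shift_arr C f \<cdot> v" for W u v
    proof -
      obtain W' where W': "W' \<in> P \<phi>" "isomorphic C (shift_ob C W') W"
        using slice_unshift[OF W] by auto
      have oW: "W' \<in> obj C"
        using slice_obj W'(1) by blast
      obtain e where e: "is_iso C (shift_ob C W') W e"
        using W'(2) by (auto simp: isomorphic_def)
      have eM: "e \<in> Mor C (shift_ob C W') W"
        using e by (auto elim: is_isoE)
      obtain u' where u': "u' \<in> Mor C W' A" "u \<cdot> e = shift_arr C u'"
        using shift_full[OF oW oA cmp_Mor[OF eM uv(1)]] .
      obtain v' where v': "v' \<in> Mor C W' A" "v \<cdot> e = shift_arr C v'"
        using shift_full[OF oW oA cmp_Mor[OF eM uv(2)]] .
      have "shift_arr C f \<cdot> shift_arr C u' = shift_arr C f \<cdot> shift_arr C v'"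
        using cmp_assoc[OF eM uv(1) shift_Mor[OF fM]] cmp_assoc[OF eM uv(2) shift_Mor[OF fM]]
          uv(3) u'(2) v'(2) by simp
      then have "shift_arr C (f \<cdot> u') = shift_arr C (f \<cdot> v')"
        using shift_cmp[OF u'(1) fM] shift_cmp[OF v'(1) fM] by simp
      then have "f \<cdot> u' = f \<cdot> v'"
        using shift_inj[OF cmp_Mor[OF u'(1) fM] cmp_Mor[OF v'(1) fM]] by blast
      then have "u' = v'"
        using f W'(1) u'(1) v'(1) unfolding mono_in_def by blast
      then show ?thesis
        using is_iso_epi[OF e uv(1,2)] u'(2) v'(2) by simp
    qed
    then have "mono_in C (P (\<phi> + 1)) (shift_ob C A) (shift_ob C X) (shift_arr C f)"
      using shift_Mor[OF fM] by (simp add: mono_in_def)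
    moreover have "shift_ob C A \<in> P (\<phi> + 1)"
      using slice_shift oA A by blast
    ultimately have "is_zero_object C (shift_ob C A) \<or>
        is_iso C (shift_ob C A) (shift_ob C X) (shift_arr C f)"
      using X unfolding stable_of_phase_def simple_in_def by blast
    then show ?thesis
      using shift_zero_object_iff[OF oA] shift_is_iso_iff[OF oA o fM] by blast
  qed
  moreover have "X \<in> P \<phi>"
    using slice_shift o stable_slice X by blast
  moreover have "\<not> is_zero_object C X"
    using shift_zero_object_iff o stable_nonzero X by blast
  ultimately show ?thesis
    unfolding stable_of_phase_def simple_in_def by blast
qed

lemma slices_disjoint:
  assumes "X \<in> P \<phi>" "X \<in> P \<psi>" "\<not> is_zero_object C X"
  shows "\<phi> = \<psi>"
proof (rule ccontr)
  assume "\<phi> \<noteq> \<psi>"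
  moreover have "ident C X \<in> Mor C X X"
    using ident_Mor slice_obj assms(1) by blast
  ultimately have "ident C X = hzero C X X"
    using slice_Mor[OF assms(1,2)] slice_Mor[OF assms(2,1)] by (cases "\<phi> > \<psi>") auto
  then show False
    using assms zero_object_iff slice_obj by blast
qed

section \<open>Isomorphism classes of stable objects\<close>

definition stable_classes :: "real \<Rightarrow> 'o set set" where
  "stable_classes \<phi> = iso_class C ` {X. stable_of_phase C P \<phi> X}"

text \<open>The mass of a stable object, written on the class itself so that no representative has
  to be chosen.\<close>

definition weight :: "'o set \<Rightarrow> real" where
  "weight c = cmod (Z (groth_proj C (triangles C) (frag_of c)))"

lemma weight_iso_class: "weight (iso_class C X) = cmod (charge C Z X)"
  by (simp add: weight_def charge_def groth_class_def)

lemma stable_classes_subset: "stable_classes \<phi> \<subseteq> iso_class C ` obj C"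
  using stable_obj by (auto simp: stable_classes_def)

lemma iso_class_stable_iff:
  assumes "X \<in> obj C"
  shows "iso_class C X \<in> stable_classes \<phi> \<longleftrightarrow> stable_of_phase C P \<phi> X"
proof
  assume "iso_class C X \<in> stable_classes \<phi>"
  then obtain Y where "stable_of_phase C P \<phi> Y" "iso_class C X = iso_class C Y"
    by (auto simp: stable_classes_def)
  then show "stable_of_phase C P \<phi> X"
    using stable_iso iso_class_eq_iff stable_obj assms by metis
qed (auto simp: stable_classes_def)

lemma stable_classes_disjoint:
  assumes "c \<in> stable_classes \<phi>" "c \<in> stable_classes \<psi>"
  shows "\<phi> = \<psi>"
proof -
  obtain X where X: "c = iso_class C X" "stable_of_phase C P \<phi> X"
    using assms(1) by (auto simp: stable_classes_def)
  then have "stable_of_phase C P \<psi> X"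
    using assms(2) iso_class_stable_iff stable_obj by blast
  then show ?thesis
    using X(2) slices_disjoint stable_slice stable_nonzero by blast
qed

lemma shift_stable_classes_iff:
  assumes "c \<in> iso_class C ` obj C"
  shows "shift_iso_class C c \<in> stable_classes (\<phi> + 1) \<longleftrightarrow> c \<in> stable_classes \<phi>"
proof -
  obtain X where X: "X \<in> obj C" "c = iso_class C X"
    using assms by blast
  then show ?thesis
    using iso_class_shift iso_class_stable_iff shift_obj stable_shift stable_unshift by metis
qed

lemma weight_shift: "c \<in> iso_class C ` obj C \<Longrightarrow> weight (shift_iso_class C c) = weight c"
  using iso_class_shift weight_iso_class charge_shift by (auto simp: norm_minus_cancel)

abbreviation sh_class :: "int \<Rightarrow> 'o set \<Rightarrow> 'o set" where
  "sh_class \<equiv> bij_power (iso_class C ` obj C) (shift_iso_class C)"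

text \<open>An equivalence, because the induction also runs downwards, from \<open>n\<close> to
  \<open>n - 1\<close>.\<close>

lemma sh_class_stable_weight:
  assumes c: "c \<in> iso_class C ` obj C"
  shows "(sh_class n c \<in> stable_classes (\<phi> + of_int n) \<longleftrightarrow> c \<in> stable_classes \<phi>) \<and>
    weight (sh_class n c) = weight c"
proof (induction n rule: int_induct[of _ 0])
  case base
  show ?case by simp
next
  case (step1 n)
  have "\<phi> + of_int (n + 1) = (\<phi> + of_int n) + 1"
    by simp
  then show ?case
    using step1 shift_stable_classes_iff weight_shift bij_power_closed[OF bij_shift_iso_class c, of n]
      bij_power_Suc[OF bij_shift_iso_class c, of n] by metis
next
  case (step2 n)
  have "\<phi> + of_int n = (\<phi> + of_int (n - 1)) + 1"
    by simp
  then show ?case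
    using step2 shift_stable_classes_iff weight_shift bij_power_closed[OF bij_shift_iso_class c, of "n - 1"]
      bij_power_pred[OF bij_shift_iso_class c, of n] by metis
qed

lemma sh_class_stable: "c \<in> stable_classes \<phi> \<Longrightarrow> sh_class n c \<in> stable_classes (\<phi> + of_int n)"
  using sh_class_stable_weight[OF subsetD[OF stable_classes_subset]] by simp

lemma sh_class_uminus:
  assumes "c \<in> iso_class C ` obj C"
  shows "sh_class n (sh_class (- n) c) = c" "sh_class (- n) (sh_class n c) = c"
  using bij_power_add[OF bij_shift_iso_class assms, of n "- n"]
    bij_power_add[OF bij_shift_iso_class assms, of "- n" n] by simp_all

text \<open>\<open>interval_slice\<close> offers some HN filtration with phases in
  \<open>[0, 1)\<close>, not the phase at which \<open>X\<close> is stable. By uniqueness the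
  spectrum of \<open>X\<close> is concentrated at that phase and nonzero there, so some factor has
  it.\<close>

lemma heart_stables_iff:
  "X \<in> heart_stables C P \<longleftrightarrow> (\<exists>\<phi>\<in>{0..<1}. stable_of_phase C P \<phi> X)"
proof
  assume X: "X \<in> heart_stables C P"
  then obtain \<phi> where \<phi>: "stable_of_phase C P \<phi> X"
    by (auto simp: heart_stables_def)
  obtain n E Y p where hn: "HN_filtration C P X n E Y p" "\<forall>i<n. p i \<in> {0..<1}"
    using X by (auto simp: heart_stables_def interval_slice_def)
  have "spectrum X (\<lambda>\<psi>. \<Sum>i | i < n \<and> p i = \<psi>. cmod (charge C Z (Y i)))"
    using hn(1) unfolding spectrum_def by blast
  then have "(\<Sum>i | i < n \<and> p i = \<phi>. cmod (charge C Z (Y i))) = cmod (charge C Z X)"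
    using spectrum_unique[OF _ slice_spectrum[OF stable_slice[OF \<phi>]]] by (metis (mono_tags, lifting))
  moreover have "cmod (charge C Z X) \<noteq> 0"
    using charge_slice_pos stable_slice stable_nonzero \<phi> by fastforce
  ultimately obtain i where "i < n" "p i = \<phi>"
    by (metis (mono_tags, lifting) mem_Collect_eq sum.neutral_const sum.cong empty_Collect_eq sum.empty)
  then show "\<exists>\<phi>\<in>{0..<1}. stable_of_phase C P \<phi> X"
    using \<phi> hn(2) by blast
next
  assume "\<exists>\<phi>\<in>{0..<1}. stable_of_phase C P \<phi> X"
  then obtain \<phi> where \<phi>: "\<phi> \<in> {0..<1}" "stable_of_phase C P \<phi> X"
    by blast
  obtain N where "is_zero_object C N"
    using ex_zero_object by blast
  then have "X \<in> interval_slice C P {0..<1}"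
    unfolding interval_slice_def using slice_HN_filtration[OF stable_slice[OF \<phi>(2)]] \<phi>(1) stable_obj[OF \<phi>(2)]
    by blast
  then show "X \<in> heart_stables C P"
    using \<phi>(2) by (auto simp: heart_stables_def)
qed

lemma heart_stable_classes: "iso_class C ` heart_stables C P = (\<Union>\<phi>\<in>{0..<1}. stable_classes \<phi>)"
  unfolding stable_classes_def using heart_stables_iff by blast

text \<open>An isomorphism and its inverse have zero cones; as in \<open>spectrum_unique\<close>,
  one of \<open>X -> Y -> 0\<close> and \<open>Y -> X -> 0\<close> has the larger total in the
  middle.\<close>

lemma spectrum_iso:
  assumes a: "spectrum X a" and "isomorphic C X Y"
  shows "spectrum Y a"
proof -
  have cone: "\<exists>N f g h. is_zero_object C N \<and> exact_triangle C X Y N f g h" if iso: "isomorphic C X Y" for X Y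
  proof -
    obtain N where N: "is_zero_object C N"
      using ex_zero_object by blast
    obtain f where f: "is_iso C X Y f"
      using iso by (auto simp: isomorphic_def)
    then have fM: "f \<in> Mor C X Y"
      by (auto elim: is_isoE)
    have o: "X \<in> obj C" "Y \<in> obj C" "N \<in> obj C" "shift_ob C X \<in> obj C"
      using Mor_obj fM zero_object_obj N shift_obj by auto
    have "exact_triangle C X Y N f (hzero C Y N) (hzero C N (shift_ob C X))"
    proof (rule TR1_iso[OF TR1_ident[OF o(1) N] _ is_iso_ident[OF o(1)] f is_iso_ident[OF o(3)]])
      show "triangle C X Y N f (hzero C Y N) (hzero C N (shift_ob C X))"
        using fM hzero_Mor o by (simp add: triangle_def)
      show "f \<cdot> ident C X = f \<cdot> ident C X" ..
      show "ident C N \<cdot> hzero C X N = hzero C Y N \<cdot> f"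
        using cmp_ident_left[OF hzero_Mor[OF o(1,3)]] cmp_hzero_left[OF fM o(3)] by simp
      show "shift_arr C (ident C X) \<cdot> hzero C N (shift_ob C X) = hzero C N (shift_ob C X) \<cdot> ident C N"
        using shift_ident[OF o(1)] cmp_ident_left[OF hzero_Mor[OF o(3,4)]]
          cmp_ident_right[OF hzero_Mor[OF o(3,4)]] by simp
    qed
    then show ?thesis
      using N by blast
  qed
  obtain b where b: "spectrum Y b"
    using spectrum_exists isomorphic_obj assms(2) by blast
  obtain N f g h where t: "is_zero_object C N" "exact_triangle C X Y N f g h"
    using cone[OF assms(2)] by blast
  obtain N' f' g' h' where t': "is_zero_object C N'" "exact_triangle C Y X N' f' g' h'"
    using cone[OF isomorphic_sym[OF assms(2)]] by blast
  have "a = b"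
    using spectrum_exact[OF t(2) a b spectrum_zero_object[OF t(1)]]
      spectrum_exact[OF t'(2) b a spectrum_zero_object[OF t'(1)]]
    by (cases "msum a (\<lambda>_. 1 :: real) \<le> msum b (\<lambda>_. 1)") (auto simp: msum_zero fun_eq_iff)
  then show ?thesis
    using b by simp
qed

text \<open>The bridge between spectra and multiplicities: a linear functional that, on the formal
  sum of the stable factors of an object, gives the mass of its part of phase
  \<open>\<psi>\<close>.\<close>

definition phase_mass :: "real \<Rightarrow> ('o set \<Rightarrow>\<^sub>0 int) \<Rightarrow> real" where
  "phase_mass \<psi> v = (\<Sum>c\<in>Poly_Mapping.keys v \<inter> stable_classes \<psi>. of_int (Poly_Mapping.lookup v c) * weight c)"

lemma phase_mass_superset:
  assumes "finite A" "Poly_Mapping.keys v \<subseteq> A"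
  shows "phase_mass \<psi> v = (\<Sum>c\<in>A \<inter> stable_classes \<psi>. of_int (Poly_Mapping.lookup v c) * weight c)"
  unfolding phase_mass_def using assms by (intro sum.mono_neutral_left) (auto simp: in_keys_iff)

lemma phase_mass_add: "phase_mass \<psi> (v + w) = phase_mass \<psi> v + phase_mass \<psi> w"
proof -
  let ?A = "Poly_Mapping.keys v \<union> Poly_Mapping.keys w"
  have "finite ?A" "Poly_Mapping.keys v \<subseteq> ?A" "Poly_Mapping.keys w \<subseteq> ?A" "Poly_Mapping.keys (v + w) \<subseteq> ?A"
    using keys_add[of v w] by auto
  note sup = this(2-4)[THEN phase_mass_superset[OF this(1)]]
  show ?thesis
    unfolding sup by (simp add: lookup_add distrib_right sum.distrib)
qed

lemma phase_mass_zero [simp]: "phase_mass \<psi> 0 = 0"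
  by (simp add: phase_mass_def)

lemma phase_mass_diff: "phase_mass \<psi> (v - w) = phase_mass \<psi> v - phase_mass \<psi> w"
  using phase_mass_add[of \<psi> "v - w" w] by simp

lemma phase_mass_frag_of: "phase_mass \<psi> (frag_of c) = (if c \<in> stable_classes \<psi> then weight c else 0)"
  by (simp add: phase_mass_def)

lemma phase_mass_shift:
  assumes "Poly_Mapping.keys v \<subseteq> iso_class C ` obj C"
  shows "phase_mass (\<psi> + 1) (frag_map (shift_iso_class C) v) = phase_mass \<psi> v"
  using assms
proof (induction v rule: frag_induction)
  case (one c)
  then show ?case
    using shift_stable_classes_iff weight_shift by (simp add: phase_mass_frag_of)
qed (simp_all add: frag_map_diff phase_mass_diff)

lemma phase_mass_other:
  assumes "Poly_Mapping.keys v \<subseteq> stable_classes \<phi>" "\<psi> \<noteq> \<phi>"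
  shows "phase_mass \<psi> v = 0"
proof -
  have "Poly_Mapping.keys v \<inter> stable_classes \<psi> = {}"
    using assms stable_classes_disjoint by blast
  then show ?thesis
    by (simp add: phase_mass_def)
qed

end

section \<open>Multiplicities of stable objects\<close>

locale independent_stability_condition = stability_condition C P Z
  for C :: "('o, 'm, 'x) triang_cat_scheme" (structure)
    and P :: "real \<Rightarrow> 'o set" and Z :: "('o set \<Rightarrow>\<^sub>0 int) set \<Rightarrow> complex" +
  assumes finite_length: "finite_length_slices C P"
    and independent: "independent_stable_masses C P Z"
begin

text \<open>The hypothesis concerns pairwise nonisomorphic objects of the heart. Stable classes of a
  single phase move into the heart by one common power of the shift, which keeps them distinct and
  keeps their weights.\<close>

lemma weight_independent:
  assumes F: "finite F" "F \<subseteq> stable_classes \<phi>"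
    and sum0: "(\<Sum>c\<in>F. of_int (n c) * weight c) = 0" and "c \<in> F"
  shows "n c = (0::int)"
proof -
  \<comment> \<open>The shift that brings the phase \<open>\<phi>\<close> into
    \<open>[0, 1)\<close>.\<close>
  define k where "k = - \<lfloor>\<phi>\<rfloor>"
  have k: "\<phi> + of_int k \<in> {0..<1}"
    unfolding k_def atLeastLessThan_iff by linarith
  have K: "c \<in> iso_class C ` obj C" if "c \<in> F" for c
    using that F(2) stable_classes_subset by (meson subsetD)
  have "\<exists>S. S \<in> heart_stables C P \<and> iso_class C S = sh_class k c" if "c \<in> F" for c
  proof -
    have "sh_class k c \<in> stable_classes (\<phi> + of_int k)"
      using sh_class_stable subsetD[OF F(2) that] by simp
    then have "sh_class k c \<in> iso_class C ` heart_stables C P"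
      unfolding heart_stable_classes by (rule UN_I[OF k])
    then obtain S where "sh_class k c = iso_class C S" "S \<in> heart_stables C P"
      by (rule imageE)
    then show ?thesis
      by (intro exI[of _ S]) simp
  qed
  \<comment> \<open>Independence is formulated for objects, so a representative \<open>R c\<close>
    is chosen in each shifted class.\<close>
  then obtain R where R: "\<And>c. c \<in> F \<Longrightarrow> R c \<in> heart_stables C P"
    "\<And>c. c \<in> F \<Longrightarrow> iso_class C (R c) = sh_class k c"
    by metis
  have inj: "c = d" if "c \<in> F" "d \<in> F" "iso_class C (R c) = iso_class C (R d)" for c d
    using that R(2) sh_class_uminus(2)[OF K, of c k] sh_class_uminus(2)[OF K, of d k] by metis
  have injR: "inj_on R F"
    by (rule inj_onI, rule inj) simp_all
  have "(\<Sum>S\<in>R ` F. of_int (n (inv_into F R S)) * cmod (charge C Z S)) = (\<Sum>c\<in>F. of_int (n c) * weight c)"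
    unfolding sum.reindex[OF injR]
    using R(2) sh_class_stable_weight[OF K] injR
    by (intro sum.cong refl) (simp flip: weight_iso_class)
  moreover have "\<forall>S\<in>R ` F. \<forall>S'\<in>R ` F. isomorphic C S S' \<longrightarrow> S = S'"
  proof (intro ballI impI)
    fix S S' assume "S \<in> R ` F" "S' \<in> R ` F" "isomorphic C S S'"
    then show "S = S'"
      using inj iso_class_eq_iff isomorphic_obj by blast
  qed
  moreover have indep: "\<forall>S\<in>F. k S = 0"
    if "finite F \<and> F \<subseteq> heart_stables C P \<and> (\<forall>S\<in>F. \<forall>S'\<in>F. isomorphic C S S' \<longrightarrow> S = S') \<and>
      (\<Sum>S\<in>F. real_of_int (k S) * cmod (charge C Z S)) = 0" for F k
    using independent that unfolding independent_stable_masses_def by blast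
  ultimately have "\<forall>S\<in>R ` F. n (inv_into F R S) = 0"
    using F(1) R(1) sum0 by (intro indep conjI) auto
  then show ?thesis
    using \<open>c \<in> F\<close> injR by auto
qed

abbreviation stables :: "'o set set" where
  "stables \<equiv> \<Union>\<phi>. stable_classes \<phi>"

text \<open>At each phase \<open>v - w\<close> is an integral relation between the masses of
  finitely many stable classes of that phase, hence trivial.\<close>

lemma phase_mass_injective:
  assumes v: "Poly_Mapping.keys v \<subseteq> stables" and w: "Poly_Mapping.keys w \<subseteq> stables"
    and eq: "\<And>\<psi>. phase_mass \<psi> v = phase_mass \<psi> w"
  shows "v = w"
proof (rule poly_mapping_eqI)
  fix c
  have zero: "Poly_Mapping.lookup (v - w) c = 0" if c: "c \<in> Poly_Mapping.keys (v - w)"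
  proof -
    obtain \<phi> where \<phi>: "c \<in> stable_classes \<phi>"
      using c v w keys_diff[of v w] by blast
    have "phase_mass \<phi> (v - w) = 0"
      using eq by (simp add: phase_mass_diff)
    then show ?thesis
      using c \<phi> weight_independent[of "Poly_Mapping.keys (v - w) \<inter> stable_classes \<phi>" \<phi>
          "Poly_Mapping.lookup (v - w)" c] by (simp add: phase_mass_def)
  qed
  then have "Poly_Mapping.lookup (v - w) c = 0"
    by (cases "c \<in> Poly_Mapping.keys (v - w)") (simp_all add: in_keys_iff)
  then show "Poly_Mapping.lookup v c = Poly_Mapping.lookup w c"
    by (simp add: lookup_minus)
qed

section \<open>Decomposition into stable classes modulo thin relations\<close>

abbreviation thin_relations :: "('o set \<Rightarrow>\<^sub>0 int) set" where
  "thin_relations \<equiv> triangle_relations C (thin_triangles C P Z)"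

text \<open>For \<open>N -> N -> N\<close> the relation \<open>[N] - [N] + [N]\<close> is the class
  itself, and all masses are 0.\<close>

lemma zero_object_thin_relations:
  assumes N: "is_zero_object C N"
  shows "frag_of (iso_class C N) \<in> thin_relations"
proof -
  note t = TR1_ident[OF zero_object_obj[OF N] N]
  have "(ident C N, hzero C N N, hzero C N (shift_ob C N)) \<in> thin_triangles C P Z"
    using thin_trianglesI[OF t] N by (simp add: mass_def)
  then show ?thesis
    using exact_in_triangle_relations[OF t] by simp
qed

text \<open>A Jordan-Hoelder filtration stays within one slice, so its triangles are thin;
  \<open>v\<close> is the formal sum of the stable factors.\<close>

lemma slice_decomposition:
  assumes X: "X \<in> P \<phi>"
  shows "\<exists>v. Poly_Mapping.keys v \<subseteq> stable_classes \<phi> \<and> phase_mass \<phi> v = cmod (charge C Z X) \<and>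
    frag_of (iso_class C X) - v \<in> thin_relations"
proof -
  obtain n E S where E: "is_zero_object C (E 0)" "E n = X" "\<And>i. i \<le> n \<Longrightarrow> E i \<in> P \<phi>"
    and S: "\<And>i. i < n \<Longrightarrow> (\<exists>f g h. exact_triangle C (E i) (E (Suc i)) (S i) f g h) \<and>
      stable_of_phase C P \<phi> (S i)"
    using finite_length X unfolding finite_length_slices_def by metis
  have "\<exists>v. Poly_Mapping.keys v \<subseteq> stable_classes \<phi> \<and> phase_mass \<phi> v = cmod (charge C Z (E m)) \<and>
    frag_of (iso_class C (E m)) - v \<in> thin_relations" if "m \<le> n" for m
    using that
  proof (induction m)
    case 0
    then show ?case
      using E(1) charge_zero_object zero_object_thin_relations by (intro exI[of _ 0]) simp
  next
    case (Suc m)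
    then obtain v where v: "Poly_Mapping.keys v \<subseteq> stable_classes \<phi>"
      "phase_mass \<phi> v = cmod (charge C Z (E m))" "frag_of (iso_class C (E m)) - v \<in> thin_relations"
      by auto
    let ?s = "frag_of (iso_class C (S m)) :: 'o set \<Rightarrow>\<^sub>0 int"
    obtain f g h where t: "exact_triangle C (E m) (E (Suc m)) (S m) f g h"
      and st: "stable_of_phase C P \<phi> (S m)"
      using S Suc.prems by (meson Suc_le_eq)
    have sl: "E m \<in> P \<phi>" "E (Suc m) \<in> P \<phi>" "S m \<in> P \<phi>"
      using E(3) Suc.prems stable_slice[OF st] by auto
    have "iso_class C (S m) \<in> stable_classes \<phi>"
      using st by (auto simp: stable_classes_def)
    then have "Poly_Mapping.keys (v + ?s) \<subseteq> stable_classes \<phi>"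
      and "phase_mass \<phi> (v + ?s) = cmod (charge C Z (E (Suc m)))"
      using v(1,2) keys_add[of v ?s] slice_triangle_charge[OF t sl]
      by (auto simp: phase_mass_add phase_mass_frag_of weight_iso_class)
    moreover have "frag_of (iso_class C (E (Suc m))) - (v + ?s) \<in> thin_relations"
      using triangle_relations_diff[OF v(3)
          exact_in_triangle_relations[OF t slice_triangle_thin[OF t sl]]]
      by (simp add: algebra_simps)
    ultimately show ?case
      by blast
  qed
  then show ?thesis
    using E(2) by blast
qed

text \<open>An HN filtration is refined by Jordan-Hoelder filtrations of its factors. Both kinds of
  triangles are thin, so the class is unchanged modulo thin relations.\<close>

lemma decomposition:
  assumes "spectrum X a"
  shows "\<exists>v. Poly_Mapping.keys v \<subseteq> stables \<and> (\<forall>\<psi>. phase_mass \<psi> v = a \<psi>) \<and>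
    frag_of (iso_class C X) - v \<in> thin_relations"
proof -
  obtain n E Y \<phi> where hn: "HN_filtration C P X n E Y \<phi>"
    and a: "a = (\<lambda>\<psi>. \<Sum>i | i < n \<and> \<phi> i = \<psi>. cmod (charge C Z (Y i)))"
    using assms by (rule spectrumE)
  have "\<exists>v. Poly_Mapping.keys v \<subseteq> stables \<and>
    (\<forall>\<psi>. phase_mass \<psi> v = (\<Sum>i | i < m \<and> \<phi> i = \<psi>. cmod (charge C Z (Y i)))) \<and>
    frag_of (iso_class C (E m)) - v \<in> thin_relations" if "m \<le> n" for m
    using that
  proof (induction m)
    case 0
    have "is_zero_object C (E 0)"
      using hn by (simp add: HN_filtration_def)
    then show ?case
      using zero_object_thin_relations by (intro exI[of _ 0]) simp
  next
    case (Suc m)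
    then obtain v where v: "Poly_Mapping.keys v \<subseteq> stables"
      "\<And>\<psi>. phase_mass \<psi> v = (\<Sum>i | i < m \<and> \<phi> i = \<psi>. cmod (charge C Z (Y i)))"
      "frag_of (iso_class C (E m)) - v \<in> thin_relations"
      by auto
    obtain f g h where t: "exact_triangle C (E m) (E (Suc m)) (Y m) f g h" and "Y m \<in> P (\<phi> m)"
      using hn Suc.prems by (auto simp: HN_filtration_def Suc_le_eq)
    obtain w where w: "Poly_Mapping.keys w \<subseteq> stable_classes (\<phi> m)"
      "phase_mass (\<phi> m) w = cmod (charge C Z (Y m))" "frag_of (iso_class C (Y m)) - w \<in> thin_relations"
      using slice_decomposition[OF \<open>Y m \<in> P (\<phi> m)\<close>] by blast
    have "Poly_Mapping.keys (v + w) \<subseteq> stables"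
      using v(1) w(1) keys_add[of v w] by blast
    \<comment> \<open>Adding \<open>w\<close> affects the phase \<open>\<phi> m\<close>
      only.\<close>
    moreover have "phase_mass \<psi> (v + w) = (\<Sum>i | i < Suc m \<and> \<phi> i = \<psi>. cmod (charge C Z (Y i)))" for \<psi>
    proof (cases "\<psi> = \<phi> m")
      case True
      then have "{i. i < Suc m \<and> \<phi> i = \<psi>} = insert m {i. i < m \<and> \<phi> i = \<psi>}"
        by auto
      then show ?thesis
        using v(2) w(2) True by (simp add: phase_mass_add)
    next
      case False
      then have "{i. i < Suc m \<and> \<phi> i = \<psi>} = {i. i < m \<and> \<phi> i = \<psi>}"
        by (auto simp: less_Suc_eq)
      then show ?thesis
        using v(2) phase_mass_other[OF w(1) False] by (simp add: phase_mass_add)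
    qed
    moreover have "frag_of (iso_class C (E (Suc m))) - (v + w) \<in> thin_relations"
      using triangle_relations_diff[OF triangle_relations_add[OF v(3) w(3)]
          exact_in_triangle_relations[OF t HN_triangle_thin[OF hn _ t]]] Suc.prems
      by (simp add: algebra_simps)
    ultimately show ?case
      by blast
  qed
  moreover have "E n = X"
    using hn by (simp add: HN_filtration_def)
  ultimately show ?thesis
    unfolding a by blast
qed

text \<open>The stable factors with multiplicities, as a function of the class. Phase masses leave a
  single choice by \<open>phase_mass_injective\<close>, so no filtration has to appear in the
  definition.\<close>

definition stable_part :: "'o set \<Rightarrow> ('o set \<Rightarrow>\<^sub>0 int)" where
  "stable_part c = (SOME v. \<exists>X a. X \<in> c \<and> spectrum X a \<and> Poly_Mapping.keys v \<subseteq> stables \<and>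
     (\<forall>\<psi>. phase_mass \<psi> v = a \<psi>))"

lemma stable_part:
  assumes a: "spectrum X a"
  shows "Poly_Mapping.keys (stable_part (iso_class C X)) \<subseteq> stables"
    "phase_mass \<psi> (stable_part (iso_class C X)) = a \<psi>"
proof -
  let ?Q = "\<lambda>v. \<exists>Y b. Y \<in> iso_class C X \<and> spectrum Y b \<and> Poly_Mapping.keys v \<subseteq> stables \<and>
     (\<forall>\<psi>. phase_mass \<psi> v = b \<psi>)"
  have "\<exists>v. ?Q v"
    using decomposition[OF a] mem_iso_class[OF spectrum_obj[OF a]] a by blast
  then have "?Q (stable_part (iso_class C X))"
    unfolding stable_part_def by (rule someI_ex)
  then obtain Y b where Y: "isomorphic C X Y" "spectrum Y b"
    "Poly_Mapping.keys (stable_part (iso_class C X)) \<subseteq> stables"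
    "\<forall>\<psi>. phase_mass \<psi> (stable_part (iso_class C X)) = b \<psi>"
    by (auto simp: iso_class_def)
  then show "Poly_Mapping.keys (stable_part (iso_class C X)) \<subseteq> stables"
    "phase_mass \<psi> (stable_part (iso_class C X)) = a \<psi>"
    using spectrum_unique[OF Y(2) spectrum_iso[OF a Y(1)]] by auto
qed

lemma stable_part_keys: "X \<in> obj C \<Longrightarrow> Poly_Mapping.keys (stable_part (iso_class C X)) \<subseteq> stables"
  by (erule exE[OF spectrum_exists]) (rule stable_part(1))

text \<open>To identify a stable part it is enough to exhibit a stable combination with the right
  phase masses; shifts, thin triangles and stable objects are all treated this way.\<close>

lemma stable_part_unique:
  assumes "spectrum X a" "Poly_Mapping.keys v \<subseteq> stables" "\<And>\<psi>. phase_mass \<psi> v = a \<psi>"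
  shows "stable_part (iso_class C X) = v"
  by (rule phase_mass_injective[OF stable_part(1)[OF assms(1)] assms(2)])
    (simp only: stable_part(2)[OF assms(1)] assms(3))

lemma keys_frag_map_shift_stables:
  assumes "Poly_Mapping.keys v \<subseteq> stables"
  shows "Poly_Mapping.keys (frag_map (shift_iso_class C) v) \<subseteq> stables"
proof -
  have "shift_iso_class C c \<in> stables" if c: "c \<in> Poly_Mapping.keys v" for c
  proof -
    obtain \<phi> where "c \<in> stable_classes \<phi>"
      using subsetD[OF assms c] by (elim UN_E)
    then have "shift_iso_class C c \<in> stable_classes (\<phi> + 1)"
      using shift_stable_classes_iff subsetD[OF stable_classes_subset] by simp
    then show ?thesis
      by blast
  qed
  then show ?thesis
    using keys_frag_map[of "shift_iso_class C" v] by blast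
qed

lemma stables_subset: "stables \<subseteq> iso_class C ` obj C"
  using stable_classes_subset by (rule UN_least)

lemma stable_part_shift:
  assumes "X \<in> obj C"
  shows "stable_part (iso_class C (shift_ob C X)) = frag_map (shift_iso_class C) (stable_part (iso_class C X))"
proof -
  obtain a where a: "spectrum X a"
    using spectrum_exists assms by blast
  have "phase_mass \<psi> (frag_map (shift_iso_class C) (stable_part (iso_class C X))) = a (\<psi> - 1)" for \<psi>
    using phase_mass_shift[OF subset_trans[OF stable_part(1)[OF a] stables_subset], of "\<psi> - 1"]
      stable_part(2)[OF a] by simp
  then show ?thesis
    by (rule stable_part_unique[OF shift_spectrum[OF a] keys_frag_map_shift_stables[OF stable_part(1)[OF a]]])
qed

lemma stable_part_exact:
  assumes t: "exact_triangle C A B D f g h" and thin: "(f, g, h) \<in> thin_triangles C P Z"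
  shows "stable_part (iso_class C B) = stable_part (iso_class C A) + stable_part (iso_class C D)"
proof -
  note T = exact_triangleD[OF t]
  obtain a b d where s: "spectrum A a" "spectrum B b" "spectrum D d"
    using spectrum_exists T(4-6) by metis
  show ?thesis
  proof (rule stable_part_unique[OF s(2)])
    show "Poly_Mapping.keys (stable_part (iso_class C A) + stable_part (iso_class C D)) \<subseteq> stables"
      by (intro order_trans[OF keys_add] Un_least stable_part(1)[OF s(1)] stable_part(1)[OF s(3)])
    show "phase_mass \<psi> (stable_part (iso_class C A) + stable_part (iso_class C D)) = b \<psi>" for \<psi>
      using thin_spectrum[OF t thin s] stable_part(2)[OF s(1)] stable_part(2)[OF s(3)]
      by (simp add: phase_mass_add)
  qed
qed

lemma stable_part_stable:
  assumes S: "stable_of_phase C P \<phi> S"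
  shows "stable_part (iso_class C S) = frag_of (iso_class C S)"
proof (rule stable_part_unique[OF slice_spectrum[OF stable_slice[OF S]]])
  have c: "iso_class C S \<in> stable_classes \<phi>"
    using S iso_class_stable_iff stable_obj by blast
  show "Poly_Mapping.keys (frag_of (iso_class C S)) \<subseteq> stables"
    unfolding keys_frag_of using c by (intro insert_subsetI empty_subsetI) (rule UN_I[OF UNIV_I])
  show "phase_mass \<psi> (frag_of (iso_class C S)) = (if \<psi> = \<phi> then cmod (charge C Z S) else 0)" for \<psi>
  proof (cases "\<psi> = \<phi>")
    case True
    then show ?thesis
      using c by (simp only: phase_mass_frag_of weight_iso_class if_True simp_thms)
  next
    case False
    then have "iso_class C S \<notin> stable_classes \<psi>"
      using stable_classes_disjoint[OF c] by metis
    then show ?thesis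
      using False by (simp only: phase_mass_frag_of if_False)
  qed
qed

text \<open>The combination produced by \<open>decomposition\<close> has the right phase masses, so
  it is the stable part.\<close>

lemma stable_part_equiv:
  assumes "X \<in> obj C"
  shows "frag_of (iso_class C X) - stable_part (iso_class C X) \<in> thin_relations"
proof -
  obtain a where a: "spectrum X a"
    using spectrum_exists assms by blast
  obtain v where v: "Poly_Mapping.keys v \<subseteq> stables" "\<forall>\<psi>. phase_mass \<psi> v = a \<psi>"
    "frag_of (iso_class C X) - v \<in> thin_relations"
    using decomposition[OF a] by blast
  then show ?thesis
    using stable_part_unique[OF a, of v] by simp
qed

section \<open>The heart as a fundamental domain for the shift\<close>

lemma heart_class_E:
  assumes "i \<in> iso_class C ` heart_stables C P"
  obtains \<phi> where "0 \<le> \<phi>" "\<phi> < 1" "i \<in> stable_classes \<phi>"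
  using assms unfolding heart_stable_classes by auto

lemma sh_class_exhaust:
  assumes c: "c \<in> stable_classes \<phi>"
  shows "\<exists>i\<in>iso_class C ` heart_stables C P. \<exists>n. c = sh_class n i"
proof -
  have "sh_class (- \<lfloor>\<phi>\<rfloor>) c \<in> stable_classes (\<phi> + of_int (- \<lfloor>\<phi>\<rfloor>))"
    using sh_class_stable[OF c] .
  moreover have k: "\<phi> + of_int (- \<lfloor>\<phi>\<rfloor>) \<in> {0..<1}"
    unfolding atLeastLessThan_iff by linarith
  ultimately have "sh_class (- \<lfloor>\<phi>\<rfloor>) c \<in> iso_class C ` heart_stables C P"
    unfolding heart_stable_classes by (intro UN_I[OF k])
  moreover have "c = sh_class \<lfloor>\<phi>\<rfloor> (sh_class (- \<lfloor>\<phi>\<rfloor>) c)"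
    using sh_class_uminus(1)[OF subsetD[OF stable_classes_subset c]] by simp
  ultimately show ?thesis
    by (intro bexI exI)
qed

text \<open>A stable class has one phase, so the two sides give
  \<open>\<phi> + n = \<psi> + m\<close>; for phases in a half-open interval of length 1 this forces
  \<open>n = m\<close>.\<close>

lemma sh_class_free:
  assumes "i \<in> iso_class C ` heart_stables C P" "j \<in> iso_class C ` heart_stables C P"
    and eq: "sh_class n i = sh_class m j"
  shows "i = j \<and> n = m"
proof -
  obtain \<phi> where \<phi>: "0 \<le> \<phi>" "\<phi> < 1" "i \<in> stable_classes \<phi>"
    using assms(1) by (rule heart_class_E)
  obtain \<psi> where \<psi>: "0 \<le> \<psi>" "\<psi> < 1" "j \<in> stable_classes \<psi>"
    using assms(2) by (rule heart_class_E)
  have "\<phi> + of_int n = \<psi> + of_int m"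
    using stable_classes_disjoint sh_class_stable[OF \<phi>(3), of n] sh_class_stable[OF \<psi>(3), of m] eq by simp
  then have "n = m"
    using \<phi>(1,2) \<psi>(1,2) by linarith
  then have "sh_class (- n) (sh_class n i) = sh_class (- n) (sh_class n j)"
    using eq by (simp only:)
  then have "i = j"
    unfolding sh_class_uminus(2)[OF subsetD[OF stable_classes_subset \<phi>(3)]]
      sh_class_uminus(2)[OF subsetD[OF stable_classes_subset \<psi>(3)]] .
  then show ?thesis
    using \<open>n = m\<close> by (rule conjI)
qed

sublocale shift_basis C "thin_triangles C P Z" stable_part "iso_class C ` obj C" stables
  "iso_class C ` heart_stables C P"
proof unfold_locales
  show "iso_class C ` obj C = iso_class C ` obj C" ..
  show "stables \<subseteq> iso_class C ` obj C"
    by (rule stables_subset)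
  show "iso_class C ` heart_stables C P \<subseteq> stables"
    unfolding heart_stable_classes by blast
  fix c
  show "Poly_Mapping.keys (stable_part c) \<subseteq> stables" if "c \<in> iso_class C ` obj C"
    using that by (elim imageE) (simp only: stable_part_keys)
  show "frag_of c - stable_part c \<in> thin_relations" if "c \<in> iso_class C ` obj C"
    using that by (elim imageE) (simp only: stable_part_equiv)
  show "stable_part (shift_iso_class C c) = frag_map (shift_iso_class C) (stable_part c)"
    if "c \<in> iso_class C ` obj C"
    using that by (elim imageE) (simp only: stable_part_shift iso_class_shift)
  show "stable_part c = frag_of c" if "c \<in> stables"
    using that stable_part_stable by (auto simp: stable_classes_def)
  show "\<exists>i\<in>iso_class C ` heart_stables C P. \<exists>n. c = sh_class n i" if "c \<in> stables"
    using that by (elim UN_E) (rule sh_class_exhaust)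
next
  fix i n assume "i \<in> iso_class C ` heart_stables C P"
  then show "sh_class n i \<in> stables"
    by (rule heart_class_E) (rule UN_I[OF UNIV_I], erule sh_class_stable)
next
  fix A B D f g h
  assume "exact_triangle C A B D f g h" "(f, g, h) \<in> thin_triangles C P Z"
  then show "stable_part (iso_class C B) = stable_part (iso_class C A) + stable_part (iso_class C D)"
    by (rule stable_part_exact)
next
  fix i j n m
  assume "i \<in> iso_class C ` heart_stables C P" "j \<in> iso_class C ` heart_stables C P"
    "sh_class n i = sh_class m j"
  then show "i = j \<and> n = m"
    by (rule sh_class_free)
qed

end

theorem theorem2p10:
  fixes C :: "('o, 'm, 'x) triang_cat_scheme"
    and P :: "real \<Rightarrow> 'o set"
    and Z :: "('o set \<Rightarrow>\<^sub>0 int) set \<Rightarrow> complex"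
  assumes "stability_condition C P Z"
    and "finite_length_slices C P"
    and "independent_stable_masses C P Z"
  shows "Module.module laurent_ring (K0_tau C P Z) \<and>
    (\<forall>A \<in> obj C. laurent_s \<odot>\<^bsub>K0_tau C P Z\<^esub> K0_tau_class C P Z (iso_class C A)
       = K0_tau_class C P Z (iso_class C (shift_ob C A))) \<and>
    freely_generated_by laurent_ring (K0_tau C P Z)
       (iso_class C ` heart_stables C P) (K0_tau_class C P Z)"
proof -
  interpret independent_stability_condition C P Z
    using assms by (simp add: independent_stability_condition_def independent_stability_condition_axioms_def)
  have "K0_tau_class C P Z = (\<lambda>c. groth_proj C (thin_triangles C P Z) (frag_of c))"
    by (simp add: K0_tau_class_def fun_eq_iff)
  then show ?thesis
    using module_groth_module laurent_s_smult freely_generated by (simp add: K0_tau_def)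
qed

end
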